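(* For $T\in\mathcal D'(\mathbb R,X)$ the following statements are equivalent: (a) $T\in\mathcal D'_{\mathcal P}(\mathbb R,X)$; (b) $T*\varphi\in\mathcal S'(\mathbb R,X)$ for each $\varphi\in\mathcal D(\mathbb R,\mathbb K)$; (c) there exist $F\in\mathcal P(\mathbb R,X)$ and $m\in\mathbb N_0$ with $T=F^{(m)}$ (distribution derivative); (d) there exists $m_o\in\mathbb N$ with $\|T(\varphi)\|\le m_o\,\|\varphi\|_{w_{m_o},m_o}$ for all $\varphi\in\mathcal D(\mathbb R,\mathbb K)$; (e) $T\in\mathcal S'(\mathbb R,X)\,|\,\mathcal D(\mathbb R,\mathbb K)$, i.e. $T$ is the restriction to $\mathcal D(\mathbb R,\mathbb K)$ of an element of $\mathcal S'(\mathbb R,X)$; (f) there exists a sequence $(S_n)_{n\in\mathbb N}\subset\mathcal S'(\mathbb R,X)$ with $S_n(\varphi)\to T(\varphi)$ for each $\varphi\in\mathcal D(\mathbb R,\mathbb K)$ and such that $(S_n(\psi))$ is a Cauchy sequence in $X$ for each $\psi\in\mathcal S(\mathbb R,\mathbb K)$.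
   Context: $X$ is a Banach space over $\mathbb K=\mathbb R$ or $\mathbb C$. $\mathcal D(\mathbb R,\mathbb K)$: Schwartz test functions; $\mathcal D'(\mathbb R,X)$: linear continuous maps $\mathcal D(\mathbb R,\mathbb K)\to X$. $\mathcal S(\mathbb R,\mathbb K)$: Schwartz space of rapidly decreasing $C^\infty$ functions, $\mathcal S'(\mathbb R,X)$: linear continuous maps $\mathcal S(\mathbb R,\mathbb K)\to X$. Locally Bochner integrable functions are identified with the distributions they define; in (b), "$\in\mathcal S'(\mathbb R,X)$" means that the distribution defined by $T*\varphi$ is the restriction of an element of $\mathcal S'(\mathbb R,X)$. $(T*\varphi)(x)=T(y\mapsto\varphi(x-y))$. $\mathcal P(\mathbb R,X)=\{f\in C(\mathbb R,X): f=O(|x|^n)\text{ as }|x|\to\infty\text{ for some }n\in\mathbb N\}$, and $\mathcal D'_{\mathcal P}(\mathbb R,X)=\{T\in\mathcal D'(\mathbb R,X):T*\varphi\in\mathcal P(\mathbb R,X)\ \forall\varphi\in\mathcal D(\mathbb R,\mathbb K)\}$. $w_k(x)=(1+x^2)^{k/2}$ and $\|\psi\|_{w_k,m}=\sum_{j=0}^m\|\psi^{(j)}w_k\|_\infty$ for $m,k\in\mathbb N_0$; these seminorms define the topology of $\mathcal S(\mathbb R,\mathbb K)$. *)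

theory Defs
  imports "HOL-Analysis.Analysis" "HOL-Library.Landau_Symbols"
begin

text \<open>
  The scalar field is a type of sort real_normed_field and euclidean_space, i.e. a finite-dimensional
  real field with a multiplicative norm. By the theorem of Frobenius this is, up to isometric
  isomorphism, exactly the real or the complex field; both types are instances. As the library has no
  class of complex Banach spaces, a Banach space over \<open>'k\<close> is a (real) Banach space together with a
  scalar multiplication by \<open>'k\<close> that is compatible with the real one and with the norm.
\<close>

locale banach_space_over = vector_space smul
  for smul :: "'k::{real_normed_field,euclidean_space} \<Rightarrow> 'x::banach \<Rightarrow> 'x" +
  assumes scale_of_real: "smul (of_real r) x = r *\<^sub>R x"
    and norm_scale: "norm (smul c x) = norm c * norm x"

lemma banach_space_over_real: "banach_space_over ((*\<^sub>R) :: real \<Rightarrow> 'x::banach \<Rightarrow> 'x)"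
  by unfold_locales (auto simp: algebra_simps)

lemma banach_space_over_complex: "banach_space_over ((*) :: complex \<Rightarrow> complex \<Rightarrow> complex)"
  by unfold_locales (auto simp: algebra_simps norm_mult scaleR_conv_of_real)


section \<open>Smooth functions\<close>

definition nth_vector_derivative :: "nat \<Rightarrow> (real \<Rightarrow> 'a::real_normed_vector) \<Rightarrow> real \<Rightarrow> 'a" where
  "nth_vector_derivative n f = ((\<lambda>g x. vector_derivative g (at x)) ^^ n) f"

definition smooth :: "(real \<Rightarrow> 'a::real_normed_vector) \<Rightarrow> bool" where
  "smooth f \<longleftrightarrow> (\<forall>n x. nth_vector_derivative n f differentiable at x)"

definition weight :: "nat \<Rightarrow> real \<Rightarrow> real" where
  "weight k x = (1 + x\<^sup>2) powr (real k / 2)"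

text \<open>The supremum is only meaningful when the weighted derivatives are bounded, as they are
  for test functions and for functions in the Schwartz space.\<close>

definition weighted_norm :: "nat \<Rightarrow> nat \<Rightarrow> (real \<Rightarrow> 'a::real_normed_vector) \<Rightarrow> real" where
  "weighted_norm k m f = (\<Sum>j\<le>m. SUP x. norm (weight k x *\<^sub>R nth_vector_derivative j f x))"

definition test_functions_on :: "real set \<Rightarrow> (real \<Rightarrow> 'k::real_normed_field) set" where
  "test_functions_on K = {f. smooth f \<and> closure {x. f x \<noteq> 0} \<subseteq> K}"

definition test_functions :: "(real \<Rightarrow> 'k::real_normed_field) set" where
  "test_functions = {f. smooth f \<and> compact (closure {x. f x \<noteq> 0})}"

definition schwartz_functions :: "(real \<Rightarrow> 'k::real_normed_field) set" where
  "schwartz_functions =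
    {f. smooth f \<and> (\<forall>k j. bounded (range (\<lambda>x. weight k x *\<^sub>R nth_vector_derivative j f x)))}"


section \<open>Topologies on function spaces\<close>

definition seminorm_on :: "(real \<Rightarrow> 'k::real_normed_field) set \<Rightarrow> ((real \<Rightarrow> 'k) \<Rightarrow> real) \<Rightarrow> bool" where
  "seminorm_on V p \<longleftrightarrow>
    (\<forall>f\<in>V. \<forall>g\<in>V. p (\<lambda>x. f x + g x) \<le> p f + p g) \<and>
    (\<forall>c. \<forall>f\<in>V. p (\<lambda>x. c * f x) = norm c * p f)"

text \<open>The locally convex topology on \<open>V\<close> defined by a family \<open>P\<close> of seminorms.\<close>

definition seminorm_topology ::
    "(real \<Rightarrow> 'k::real_normed_field) set \<Rightarrow> ((real \<Rightarrow> 'k) \<Rightarrow> real) set \<Rightarrow> (real \<Rightarrow> 'k) topology" where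
  "seminorm_topology V P =
    topology_generated_by {{g \<in> V. p (\<lambda>x. g x - f x) < e} | f p e. f \<in> V \<and> p \<in> P \<and> 0 < e}"

definition schwartz_topology :: "(real \<Rightarrow> 'k::real_normed_field) topology" where
  "schwartz_topology = seminorm_topology schwartz_functions {weighted_norm k m | k m. True}"

text \<open>On functions supported in a compact set: uniform convergence of all derivatives
  (the weight with exponent 0 is constantly 1).\<close>

definition test_topology_on :: "real set \<Rightarrow> (real \<Rightarrow> 'k::real_normed_field) topology" where
  "test_topology_on K = seminorm_topology (test_functions_on K) {weighted_norm 0 m | m. True}"

text \<open>The Schwartz inductive limit topology, i.e. the finest locally convex topology for which the
  inclusions of all \<open>test_functions_on K\<close>, \<open>K\<close> compact, are continuous; it is
  defined by all seminorms whose restrictions to these subspaces are continuous.\<close>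

definition test_topology :: "(real \<Rightarrow> 'k::real_normed_field) topology" where
  "test_topology = seminorm_topology test_functions
    {p. seminorm_on test_functions p \<and>
        (\<forall>K. compact K \<longrightarrow> continuous_map (test_topology_on K) euclideanreal p)}"

lemma topspace_seminorm_topology:
  assumes "p \<in> P" "\<And>f. f \<in> V \<Longrightarrow> p (\<lambda>x. 0) = 0"
  shows "topspace (seminorm_topology V P) = V"
proof
  show "topspace (seminorm_topology V P) \<subseteq> V"
    by (auto simp: seminorm_topology_def)
  show "V \<subseteq> topspace (seminorm_topology V P)"
  proof
    fix f assume f: "f \<in> V"
    then have "f \<in> {g \<in> V. p (\<lambda>x. g x - f x) < 1}"
      using assms(2)[OF f] by simp
    with f assms(1) show "f \<in> topspace (seminorm_topology V P)"
      unfolding seminorm_topology_def topology_generated_by_topspace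
      by (intro UnionI[of "{g \<in> V. p (\<lambda>x. g x - f x) < 1}"]) (blast intro: zero_less_one)+
  qed
qed

lemma nth_vector_derivative_zero: "nth_vector_derivative n (\<lambda>x. 0) = (\<lambda>x. 0)"
  by (induction n) (auto simp: nth_vector_derivative_def)

lemma weighted_norm_zero: "weighted_norm k m (\<lambda>x. 0) = 0"
  by (simp add: weighted_norm_def nth_vector_derivative_zero)

lemma topspace_schwartz_topology: "topspace schwartz_topology = schwartz_functions"
  unfolding schwartz_topology_def
  by (rule topspace_seminorm_topology[where p = "weighted_norm 0 0"]) (auto simp: weighted_norm_zero)

lemma topspace_test_topology_on: "topspace (test_topology_on K) = test_functions_on K"
  unfolding test_topology_on_def
  by (rule topspace_seminorm_topology[where p = "weighted_norm 0 0"]) (auto simp: weighted_norm_zero)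

lemma topspace_test_topology: "topspace test_topology = test_functions"
  unfolding test_topology_def
  by (rule topspace_seminorm_topology[where p = "\<lambda>_. 0"]) (auto simp: seminorm_on_def)


section \<open>Vector-valued distributions\<close>

text \<open>Functionals are total functions whose values outside the space in question (test functions or
  Schwartz functions) are irrelevant.\<close>

definition linear_functional_on ::
    "('k::real_normed_field \<Rightarrow> 'x::real_normed_vector \<Rightarrow> 'x) \<Rightarrow> (real \<Rightarrow> 'k) set \<Rightarrow>
      ((real \<Rightarrow> 'k) \<Rightarrow> 'x) \<Rightarrow> bool" where
  "linear_functional_on smul V T \<longleftrightarrow>
    (\<forall>f\<in>V. \<forall>g\<in>V. T (\<lambda>x. f x + g x) = T f + T g) \<and>
    (\<forall>c. \<forall>f\<in>V. T (\<lambda>x. c * f x) = smul c (T f))"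

definition distributions ::
    "('k::real_normed_field \<Rightarrow> 'x::real_normed_vector \<Rightarrow> 'x) \<Rightarrow> ((real \<Rightarrow> 'k) \<Rightarrow> 'x) set" where
  "distributions smul =
    {T. linear_functional_on smul test_functions T \<and> continuous_map test_topology euclidean T}"

definition tempered_distributions ::
    "('k::real_normed_field \<Rightarrow> 'x::real_normed_vector \<Rightarrow> 'x) \<Rightarrow> ((real \<Rightarrow> 'k) \<Rightarrow> 'x) set" where
  "tempered_distributions smul =
    {S. linear_functional_on smul schwartz_functions S \<and>
        continuous_map schwartz_topology euclidean S}"

definition restricts_tempered ::
    "('k::real_normed_field \<Rightarrow> 'x::real_normed_vector \<Rightarrow> 'x) \<Rightarrow> ((real \<Rightarrow> 'k) \<Rightarrow> 'x) \<Rightarrow> bool" where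
  "restricts_tempered smul T \<longleftrightarrow>
    (\<exists>S\<in>tempered_distributions smul. \<forall>f\<in>test_functions. T f = S f)"

text \<open>The distribution defined by a function. It is used for continuous functions only, where the
  integrand is continuous with compact support, so that the Henstock-Kurzweil integral
  coincides with the Bochner integral (which the library restricts to separable spaces).\<close>

definition function_distribution ::
    "('k::real_normed_field \<Rightarrow> 'x::real_normed_vector \<Rightarrow> 'x) \<Rightarrow> (real \<Rightarrow> 'x) \<Rightarrow> (real \<Rightarrow> 'k) \<Rightarrow> 'x" where
  "function_distribution smul F = (\<lambda>f. integral UNIV (\<lambda>x. smul (f x) (F x)))"

definition distribution_derivative ::
    "nat \<Rightarrow> ((real \<Rightarrow> 'k::real_normed_field) \<Rightarrow> 'x::real_normed_vector) \<Rightarrow> (real \<Rightarrow> 'k) \<Rightarrow> 'x" where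
  "distribution_derivative m T = (\<lambda>f. (- 1) ^ m *\<^sub>R T (nth_vector_derivative m f))"

definition convolution :: "((real \<Rightarrow> 'k) \<Rightarrow> 'x) \<Rightarrow> (real \<Rightarrow> 'k) \<Rightarrow> real \<Rightarrow> 'x" where
  "convolution T f x = T (\<lambda>y. f (x - y))"

definition poly_growth :: "(real \<Rightarrow> 'x::real_normed_vector) set" where
  "poly_growth =
    {F. continuous_on UNIV F \<and>
        (\<exists>n::nat. (\<lambda>x. norm (F x)) \<in> O[at_infinity](\<lambda>x. \<bar>x\<bar> ^ n))}"

definition poly_growth_distributions ::
    "('k::real_normed_field \<Rightarrow> 'x::real_normed_vector \<Rightarrow> 'x) \<Rightarrow> ((real \<Rightarrow> 'k) \<Rightarrow> 'x) set" where
  "poly_growth_distributions smul =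
    {T \<in> distributions smul. \<forall>f\<in>test_functions. convolution T f \<in> poly_growth}"

end

theory Submission
  imports Defs
begin

text \<open>The seminorm estimate (d) is the hub of the proof: the implications proved are
(a) \<open>\<Longrightarrow>\<close> (b) \<open>\<Longrightarrow>\<close> (d) \<open>\<Longrightarrow>\<close> (a) and (d) \<open>\<Longrightarrow>\<close> (c) \<open>\<Longrightarrow>\<close> (e) \<open>\<Longrightarrow>\<close> (f) \<open>\<Longrightarrow>\<close> (d).

The main tool is a representation of a distribution by its convolutions with test functions
(\<open>reproducing_series\<close>). For every \<open>M \<ge> 1\<close> there are test functions \<open>\<rho>\<close>, \<open>\<theta>\<close> supported in
\<open>[-1,1]\<close> such that \<open>\<rho>\<close> has integral 1 and \<open>2 \<rho>(2x) - \<rho>(x)\<close> is the \<open>M\<close>-th derivative of \<open>\<theta>\<close>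
(\<open>kernel_exists\<close>; this says that the moments of \<open>\<rho>\<close> of orders \<open>1, ..., M - 1\<close> vanish). The
dilates \<open>2^J \<rho>(2^J x)\<close> form an approximate identity, and telescoping yields
\<open>T(\<eta>) = T(\<eta> * \<rho>) + (\<Sum>J. 2^J 2^(-JM) T(\<eta>\<^sup>(\<^sup>M\<^sup>) * \<theta>(2^J \<cdot>)))\<close>.
An estimate of \<open>T(\<eta> * \<phi>)\<close> by \<open>N\<close> derivatives of \<open>\<phi>\<close> costs a factor \<open>2^(JN)\<close> in the \<open>J\<close>-th term, so
with \<open>M = N + 2\<close> the series converges geometrically. The series does the work of a parametrix
for the \<open>M\<close>-th derivative, and it consists of test functions, to which \<open>T\<close> can be applied.

In (d) \<open>\<Longrightarrow>\<close> (c) the \<open>J\<close>-th term is the integral of \<open>\<eta>\<^sup>(\<^sup>M\<^sup>)\<close> against \<open>x \<mapsto> T(\<theta>(2^J(\<cdot> - x)))\<close>, which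
(d) bounds by a power of \<open>1 + \<bar>x\<bar>\<close>; these functions sum up to a function of polynomial growth,
and the remaining function \<open>x \<mapsto> T(\<rho>(\<cdot> - x))\<close> is integrated \<open>M\<close> times. In (b) \<open>\<Longrightarrow>\<close> (d) every single
functional \<open>\<eta> \<mapsto> T(\<eta> * \<phi>)\<close> satisfies some seminorm estimate; a Baire argument over the Frechet
space of test functions \<open>\<phi>\<close> supported in \<open>[-1,1]\<close> makes the estimate uniform in \<open>\<phi>\<close>, and then the
series gives (d). The same Baire argument over the Schwartz space is the Banach-Steinhaus theorem
that is needed for (f) \<open>\<Longrightarrow>\<close> (d) (\<open>barrel_contains_ball\<close>). For (c) \<open>\<Longrightarrow>\<close> (e), and with
\<open>m = 0\<close> for (a) \<open>\<Longrightarrow>\<close> (b), the extension to the Schwartz space is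
\<open>\<psi> \<mapsto> (-1)^m \<integral> \<psi>\<^sup>(\<^sup>m\<^sup>) F\<close>, which converges absolutely.\<close>

section \<open>Iterated derivatives\<close>

abbreviation nvd :: "nat \<Rightarrow> (real \<Rightarrow> 'a::real_normed_vector) \<Rightarrow> real \<Rightarrow> 'a" where
  "nvd \<equiv> nth_vector_derivative"

lemma nvd_0 [simp]: "nvd 0 f = f"
  by (simp add: nth_vector_derivative_def)

lemma nvd_Suc: "nvd (Suc n) f = (\<lambda>x. vector_derivative (nvd n f) (at x))"
  by (simp add: nth_vector_derivative_def)

lemma nvd_nvd: "nvd m (nvd n f) = nvd (m + n) f"
  by (simp add: nth_vector_derivative_def funpow_add)

lemma smooth_has_derivative:
  assumes "smooth f"
  shows "(nvd n f has_vector_derivative nvd (Suc n) f x) (at x)"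
  using assms by (simp add: smooth_def nvd_Suc vector_derivative_works)

text \<open>A coinductive characterisation of smoothness: a function is smooth as soon as it starts a
sequence in which every member differentiates to the next, and that sequence then consists of the
iterated derivatives. Sums, affine substitutions, convolutions and series are treated in this way.\<close>

lemma smooth_derivative_sequence:
  assumes "\<And>x. G 0 x = f x"
    and "\<And>n x. (G n has_vector_derivative G (Suc n) x) (at x)"
  shows "smooth f" and "nvd n f = G n"
proof -
  have eq: "nvd n f = G n" for n
  proof (induction n)
    case (Suc n)
    show ?case
      using assms(2)[of n] by (auto simp: nvd_Suc Suc intro!: ext vector_derivative_at)
  qed (use assms(1) in auto)
  then show "nvd n f = G n" .
  show "smooth f"
    using assms(2) by (auto simp: smooth_def eq intro: differentiableI_vector)
qed

lemma smooth_continuous: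
  assumes "smooth f"
  shows "continuous_on S (nvd n f)"
  by (meson assms continuous_at_imp_continuous_on differentiable_imp_continuous_within smooth_def)

lemma smooth_nvd: "smooth f \<Longrightarrow> smooth (nvd n f)"
  by (simp add: smooth_def nvd_nvd)

lemma smooth_zero: "smooth (\<lambda>x. 0)"
  by (simp add: smooth_def nth_vector_derivative_zero)

lemma
  assumes "smooth f" and "smooth g"
  shows smooth_add: "smooth (\<lambda>x. f x + g x)"
    and nvd_add: "nvd n (\<lambda>x. f x + g x) = (\<lambda>x. nvd n f x + nvd n g x)"
  by (rule smooth_derivative_sequence[where G = "\<lambda>n x. nvd n f x + nvd n g x"];
      auto intro!: derivative_eq_intros smooth_has_derivative assms)+

lemma
  fixes f :: "real \<Rightarrow> 'a::real_normed_vector"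
  assumes "bounded_linear h" and "smooth f"
  shows smooth_bounded_linear: "smooth (\<lambda>x. h (f x))"
    and nvd_bounded_linear: "nvd n (\<lambda>x. h (f x)) = (\<lambda>x. h (nvd n f x))"
  by (rule smooth_derivative_sequence[where G = "\<lambda>n x. h (nvd n f x)"];
      simp add: bounded_linear.has_vector_derivative smooth_has_derivative assms)+

lemmas smooth_scaleR = smooth_bounded_linear[OF bounded_linear_scaleR_right]
lemmas nvd_scaleR = nvd_bounded_linear[OF bounded_linear_scaleR_right]
lemmas smooth_mult = smooth_bounded_linear[OF bounded_linear_mult_right]
lemmas nvd_mult = nvd_bounded_linear[OF bounded_linear_mult_right]

lemma
  assumes "smooth f" and "smooth g"
  shows smooth_diff: "smooth (\<lambda>x. f x - g x)"
    and nvd_diff: "nvd n (\<lambda>x. f x - g x) = (\<lambda>x. nvd n f x - nvd n g x)"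
  using smooth_add[OF assms(1) smooth_scaleR[OF assms(2), of "-1"]]
    nvd_add[OF assms(1) smooth_scaleR[OF assms(2), of "-1"], of n]
    nvd_scaleR[OF assms(2), of n "-1"] by simp_all

lemma
  fixes f :: "'i \<Rightarrow> real \<Rightarrow> 'a::real_normed_vector"
  assumes "\<And>i. i \<in> I \<Longrightarrow> smooth (f i)"
  shows smooth_sum: "smooth (\<lambda>x. \<Sum>i\<in>I. f i x)"
    and nvd_sum: "nvd n (\<lambda>x. \<Sum>i\<in>I. f i x) = (\<lambda>x. \<Sum>i\<in>I. nvd n (f i) x)"
  by (rule smooth_derivative_sequence[where G = "\<lambda>n x. \<Sum>i\<in>I. nvd n (f i) x"];
      auto intro!: derivative_eq_intros smooth_has_derivative assms)+

lemma
  fixes f :: "real \<Rightarrow> 'a::real_normed_vector"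
  assumes "smooth f"
  shows smooth_affine: "smooth (\<lambda>x. f (a + c * x))"
    and nvd_affine: "nvd n (\<lambda>x. f (a + c * x)) = (\<lambda>x. c ^ n *\<^sub>R nvd n f (a + c * x))"
proof -
  have 1: "((\<lambda>x. c ^ n *\<^sub>R nvd n f (a + c * x)) has_vector_derivative
      c ^ Suc n *\<^sub>R nvd (Suc n) f (a + c * x)) (at x)" for n x
  proof -
    have "((\<lambda>x. a + c * x) has_real_derivative c) (at x)"
      by (auto intro!: derivative_eq_intros)
    then have "((\<lambda>x. a + c * x) has_vector_derivative c) (at x)"
      by (simp add: has_real_derivative_iff_has_vector_derivative)
    from vector_diff_chain_at[OF this smooth_has_derivative[OF assms]]
    have "((\<lambda>x. nvd n f (a + c * x)) has_vector_derivative c *\<^sub>R nvd (Suc n) f (a + c * x)) (at x)"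
      by (simp add: o_def)
    from bounded_linear.has_vector_derivative[OF bounded_linear_scaleR_right this, of "c ^ n"]
    show ?thesis by (simp add: mult.commute)
  qed
  show "smooth (\<lambda>x. f (a + c * x))"
    by (rule smooth_derivative_sequence[where G = "\<lambda>n x. c ^ n *\<^sub>R nvd n f (a + c * x)"]) (use 1 in auto)
  show "nvd n (\<lambda>x. f (a + c * x)) = (\<lambda>x. c ^ n *\<^sub>R nvd n f (a + c * x))"
    by (rule smooth_derivative_sequence[where G = "\<lambda>n x. c ^ n *\<^sub>R nvd n f (a + c * x)"]) (use 1 in auto)
qed

lemma
  assumes "smooth f"
  shows smooth_translate: "smooth (\<lambda>y. f (y - x))"
    and nvd_translate: "nvd n (\<lambda>y. f (y - x)) = (\<lambda>y. nvd n f (y - x))"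
  using smooth_affine[OF assms, of "- x" 1] nvd_affine[OF assms, of n "- x" 1] by (simp_all add: add.commute)

lemma
  assumes "smooth f"
  shows smooth_reflect: "smooth (\<lambda>y. f (x - y))"
    and nvd_reflect: "nvd n (\<lambda>y. f (x - y)) = (\<lambda>y. (-1) ^ n *\<^sub>R nvd n f (x - y))"
  using smooth_affine[OF assms, of x "-1"] nvd_affine[OF assms, of n x "-1"] by simp_all

lemma nvd_eq_0_on_open:
  assumes "open S" and "\<And>x. x \<in> S \<Longrightarrow> f x = 0" and "x \<in> S"
  shows "nvd n f x = 0"
  using assms(3)
proof (induction n arbitrary: x)
  case (Suc n)
  have "(nvd n f has_vector_derivative 0) (at x)"
    by (rule has_vector_derivative_transform_within_open[OF _ assms(1) Suc.prems, where f = "\<lambda>_. 0"])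
      (use Suc.IH in auto)
  then show ?case by (simp add: nvd_Suc vector_derivative_at)
qed (use assms in auto)

lemma derivative_bound:
  fixes f :: "real \<Rightarrow> 'a::real_normed_vector"
  assumes "\<And>x. (f has_vector_derivative f' x) (at x)" and "\<And>x. norm (f' x) \<le> B"
  shows "norm (f x - f y) \<le> B * \<bar>x - y\<bar>"
proof -
  have "norm (f x - f y) \<le> B * norm (x - y)"
  proof (rule differentiable_bound[where S = UNIV])
    show "(f has_derivative (\<lambda>h. h *\<^sub>R f' x)) (at x within UNIV)" for x
      using assms(1) by (simp add: has_vector_derivative_def)
    show "onorm (\<lambda>h. h *\<^sub>R f' x) \<le> B" for x
      using assms(2)[of x] by (intro onorm_le) (simp add: mult.commute[of B] mult_left_mono)
  qed auto
  then show ?thesis by simp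
qed

section \<open>Test functions and Schwartz functions\<close>

lemma weight_pos [simp]: "0 < weight k x"
  by (simp add: weight_def add_nonneg_eq_0_iff)

lemma weight_ge_1: "1 \<le> weight k x"
  unfolding weight_def by (rule ge_one_powr_ge_zero) auto

lemma weight_mono: "k \<le> l \<Longrightarrow> weight k x \<le> weight l x"
  unfolding weight_def by (intro powr_mono) auto

lemma weight_add: "weight (k + l) x = weight k x * weight l x"
  by (simp add: weight_def powr_add [symmetric] add_divide_distrib)

lemma weight_0 [simp]: "weight 0 x = 1"
  by (simp add: weight_def add_nonneg_eq_0_iff)

lemma weight_2: "weight 2 x = 1 + x\<^sup>2"
  by (simp add: weight_def)

lemma weight_power: "weight k x = sqrt (1 + x\<^sup>2) ^ k"
proof -
  have "weight k x = ((1 + x\<^sup>2) powr (1 / 2)) powr real k"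
    by (simp add: weight_def powr_powr)
  also have "\<dots> = sqrt (1 + x\<^sup>2) ^ k"
    by (simp add: powr_half_sqrt powr_realpow add_pos_nonneg)
  finally show ?thesis .
qed

text \<open>Peetre's inequality, which controls the weight under translations.\<close>

lemma weight_shift: "weight k (x + y) \<le> 2 ^ k * weight k x * weight k y"
proof -
  have "1 + (x + y)\<^sup>2 \<le> 4 * ((1 + x\<^sup>2) * (1 + y\<^sup>2))"
  proof -
    have "4 * ((1 + x\<^sup>2) * (1 + y\<^sup>2)) - (1 + (x + y)\<^sup>2) = 3 + 4 * (x * y)\<^sup>2 + 2 * x\<^sup>2 + 2 * y\<^sup>2 + (x - y)\<^sup>2"
      by (simp add: power2_eq_square algebra_simps)
    also have "\<dots> \<ge> 0"
      by (intro add_nonneg_nonneg) auto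
    finally show ?thesis by simp
  qed
  then have "sqrt (1 + (x + y)\<^sup>2) \<le> sqrt (2\<^sup>2 * ((1 + x\<^sup>2) * (1 + y\<^sup>2)))"
    by (intro real_sqrt_le_mono) simp
  also have "\<dots> = 2 * (sqrt (1 + x\<^sup>2) * sqrt (1 + y\<^sup>2))"
    by (simp only: real_sqrt_mult) simp
  finally have "sqrt (1 + (x + y)\<^sup>2) ^ k \<le> (2 * (sqrt (1 + x\<^sup>2) * sqrt (1 + y\<^sup>2))) ^ k"
    by (intro power_mono) auto
  then show ?thesis by (simp add: weight_power power_mult_distrib mult.assoc)
qed

lemma weight_le: "\<bar>x\<bar> \<le> R \<Longrightarrow> weight k x \<le> weight k R"
  unfolding weight_power
  by (rule power_mono) (use power2_le_iff_abs_le[of R x] in auto)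

lemma vanishing_outside_iff:
  fixes f :: "real \<Rightarrow> 'a::real_normed_vector"
  assumes "closed K"
  shows "closure {x. f x \<noteq> 0} \<subseteq> K \<longleftrightarrow> (\<forall>x. x \<notin> K \<longrightarrow> f x = 0)"
  using assms closure_minimal[of "{x. f x \<noteq> 0}" K] closure_subset[of "{x. f x \<noteq> 0}"] by blast

lemma test_functions_on_iff:
  "closed K \<Longrightarrow> f \<in> test_functions_on K \<longleftrightarrow> smooth f \<and> (\<forall>x. x \<notin> K \<longrightarrow> f x = 0)"
  unfolding test_functions_on_def by (simp add: vanishing_outside_iff)

lemma test_functions_iff:
  "f \<in> test_functions \<longleftrightarrow> smooth f \<and> (\<exists>R. \<forall>x. R < \<bar>x\<bar> \<longrightarrow> f x = 0)"
proof -
  have "compact (closure {x. f x \<noteq> 0}) \<longleftrightarrow> (\<exists>R. \<forall>x. R < \<bar>x\<bar> \<longrightarrow> f x = 0)"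
    unfolding compact_closure bounded_iff by (auto simp: not_le[symmetric])
  then show ?thesis by (simp add: test_functions_def)
qed

lemma test_functions_on_subset:
  assumes "compact K"
  shows "test_functions_on K \<subseteq> test_functions"
  using assms bounded_subset compact_imp_bounded
  by (auto simp: test_functions_on_def test_functions_def compact_eq_bounded_closed)

lemma test_function_smooth: "f \<in> test_functions \<Longrightarrow> smooth f"
  by (simp add: test_functions_def)

lemma schwartz_smooth: "f \<in> schwartz_functions \<Longrightarrow> smooth f"
  by (simp add: schwartz_functions_def)

lemma nvd_eq_0_outside:
  assumes "closed K" and "\<And>x. x \<notin> K \<Longrightarrow> f x = 0" and "x \<notin> K"
  shows "nvd n f x = 0"
  using nvd_eq_0_on_open[of "- K" f x n] assms by auto

text \<open>The radius is chosen strictly larger than the support, so that all derivatives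
  vanish at the end points as well; this makes boundary terms disappear.\<close>

lemma test_function_radius:
  assumes "f \<in> test_functions"
  obtains R where "0 < R" and "\<And>n x. R \<le> \<bar>x\<bar> \<Longrightarrow> nvd n f x = 0"
proof -
  obtain R where R: "\<And>x. R < \<bar>x\<bar> \<Longrightarrow> f x = 0"
    using assms by (auto simp: test_functions_iff)
  have "nvd n f x = 0" if "\<bar>R\<bar> + 1 \<le> \<bar>x\<bar>" for n x
    using that by (intro nvd_eq_0_outside[of "{- \<bar>R\<bar>..\<bar>R\<bar>}"]) (auto intro!: R)
  then show thesis by (intro that[of "\<bar>R\<bar> + 1"]) auto
qed

lemma test_function_boundedE:
  fixes f :: "real \<Rightarrow> 'k::real_normed_field"
  assumes "f \<in> test_functions"
  obtains B where "0 < B" and "\<And>x. norm (nvd n f x) \<le> B"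
proof -
  obtain R where R: "0 < R" "\<And>n x. R \<le> \<bar>x\<bar> \<Longrightarrow> nvd n f x = 0"
    using test_function_radius[OF assms] by metis
  have "bounded (nvd n f ` {-R..R})"
    by (intro compact_imp_bounded compact_continuous_image smooth_continuous
        test_function_smooth assms) auto
  then obtain B where B: "0 < B" "\<And>x. x \<in> {-R..R} \<Longrightarrow> norm (nvd n f x) \<le> B"
    unfolding bounded_pos by blast
  have "norm (nvd n f x) \<le> B" for x
    using B(1) B(2)[of x] R(2)[of x n] by (cases "R \<le> \<bar>x\<bar>") (auto simp: not_le abs_less_iff)
  with B(1) show thesis by (rule that)
qed

lemma test_functions_subset_schwartz: "test_functions \<subseteq> schwartz_functions"
proof
  fix f :: "real \<Rightarrow> 'k::real_normed_field" assume f: "f \<in> test_functions"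
  obtain R where R: "0 < R" "\<And>n x. R \<le> \<bar>x\<bar> \<Longrightarrow> nvd n f x = 0"
    using test_function_radius[OF f] by metis
  have "bounded (range (\<lambda>x. weight k x *\<^sub>R nvd j f x))" for k j
  proof -
    obtain B where B: "0 < B" "\<And>x. norm (nvd j f x) \<le> B"
      using test_function_boundedE[OF f] by metis
    have "norm (weight k x *\<^sub>R nvd j f x) \<le> weight k R * B" for x
    proof (cases "R \<le> \<bar>x\<bar>")
      case True then show ?thesis using R B(1) by (simp add: less_imp_le)
    next
      case False then show ?thesis
        using B by (auto intro!: mult_mono weight_le simp: less_imp_le)
    qed
    then show ?thesis unfolding bounded_iff by blast
  qed
  then show "f \<in> schwartz_functions"
    using f by (auto simp: schwartz_functions_def test_function_smooth)
qed

lemma schwartz_bdd: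
  assumes "f \<in> schwartz_functions"
  shows "bdd_above (range (\<lambda>x. norm (weight k x *\<^sub>R nvd j f x)))"
  using assms by (force simp: schwartz_functions_def bounded_iff bdd_above_def)

lemma schwartz_sup_nonneg:
  assumes "f \<in> schwartz_functions"
  shows "0 \<le> (SUP x. norm (weight k x *\<^sub>R nvd j f x))"
  using order_trans[OF norm_ge_zero cSUP_upper[OF UNIV_I schwartz_bdd[OF assms]]] .

text \<open>A real supremum bounds the values only if these are bounded above, hence the restriction to
Schwartz functions.\<close>

lemma weighted_norm_ge:
  assumes "f \<in> schwartz_functions" and "j \<le> m"
  shows "weight k x * norm (nvd j f x) \<le> weighted_norm k m f"
proof -
  have "weight k x * norm (nvd j f x) = norm (weight k x *\<^sub>R nvd j f x)"
    by (simp add: less_imp_le)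
  also have "\<dots> \<le> (SUP x. norm (weight k x *\<^sub>R nvd j f x))"
    by (intro cSUP_upper schwartz_bdd assms) auto
  also have "\<dots> \<le> weighted_norm k m f"
    unfolding weighted_norm_def
    by (rule member_le_sum[of j "{..m}" "\<lambda>i. SUP x. norm (weight k x *\<^sub>R nvd i f x)"])
      (use assms schwartz_sup_nonneg[OF assms(1)] in auto)
  finally show ?thesis .
qed

lemma norm_nvd_le_weighted_norm:
  assumes "f \<in> schwartz_functions" and "j \<le> m"
  shows "norm (nvd j f x) \<le> weighted_norm k m f"
proof -
  have "1 * norm (nvd j f x) \<le> weight k x * norm (nvd j f x)"
    by (intro mult_right_mono weight_ge_1) auto
  with weighted_norm_ge[OF assms, of k x] show ?thesis by simp
qed

lemma weighted_norm_nonneg: "f \<in> schwartz_functions \<Longrightarrow> 0 \<le> weighted_norm k m f"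
  by (rule order_trans[OF norm_ge_zero norm_nvd_le_weighted_norm[of f 0 m]]) auto

lemma weighted_norm_le:
  assumes "\<And>j x. j \<le> m \<Longrightarrow> weight k x * norm (nvd j f x) \<le> B j"
  shows "weighted_norm k m f \<le> (\<Sum>j\<le>m. B j)"
  unfolding weighted_norm_def
  by (intro sum_mono cSUP_least) (use assms in \<open>auto simp: less_imp_le\<close>)

lemma weighted_norm_mono:
  assumes "f \<in> schwartz_functions" and "k \<le> k'" and "m \<le> m'"
  shows "weighted_norm k m f \<le> weighted_norm k' m' f"
proof -
  have "weighted_norm k m f \<le> (\<Sum>j\<le>m'. SUP x. norm (weight k x *\<^sub>R nvd j f x))"
    unfolding weighted_norm_def by (intro sum_mono2) (use assms schwartz_sup_nonneg[OF assms(1)] in auto)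
  also have "\<dots> \<le> weighted_norm k' m' f"
    unfolding weighted_norm_def
  proof (intro sum_mono cSUP_mono schwartz_bdd assms)
    show "\<exists>y\<in>UNIV. norm (weight k x *\<^sub>R nvd j f x) \<le> norm (weight k' y *\<^sub>R nvd j f y)" for j x
      using weight_mono[OF assms(2), of x] by (intro bexI[of _ x]) (auto intro: mult_right_mono simp: less_imp_le)
  qed auto
  finally show ?thesis .
qed

lemma schwartz_add:
  assumes "f \<in> schwartz_functions" and "g \<in> schwartz_functions"
  shows "(\<lambda>x. f x + g x) \<in> schwartz_functions"
  using assms
  by (auto simp: schwartz_functions_def smooth_add nvd_add scaleR_add_right intro: bounded_plus_comp)

lemma schwartz_bounded_linear:
  fixes f :: "real \<Rightarrow> 'k::real_normed_field"
  assumes "bounded_linear h" and "f \<in> schwartz_functions"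
  shows "(\<lambda>x. h (f x)) \<in> schwartz_functions"
proof -
  interpret h: bounded_linear h by fact
  have sm: "smooth f" by (simp add: assms schwartz_smooth)
  have "bounded (range (\<lambda>x. weight k x *\<^sub>R nvd j (\<lambda>x. h (f x)) x))" for k j
  proof -
    have "bounded (h ` range (\<lambda>x. weight k x *\<^sub>R nvd j f x))"
      using assms by (intro bounded_linear_image[OF _ assms(1)]) (auto simp: schwartz_functions_def)
    then show ?thesis
      by (simp add: image_image nvd_bounded_linear[OF assms(1) sm] h.scaleR)
  qed
  then show ?thesis
    by (simp add: schwartz_functions_def smooth_bounded_linear[OF assms(1) sm])
qed

lemmas schwartz_mult = schwartz_bounded_linear[OF bounded_linear_mult_right]

lemma schwartz_diff:
  assumes "f \<in> schwartz_functions" and "g \<in> schwartz_functions"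
  shows "(\<lambda>x. f x - g x) \<in> schwartz_functions"
  using schwartz_add[OF assms(1) schwartz_mult[OF assms(2), of "-1"]] by simp

lemma schwartz_zero: "(\<lambda>x. 0) \<in> schwartz_functions"
  using test_functions_subset_schwartz by (auto simp: test_functions_iff smooth_zero)

lemma schwartz_sum:
  "finite I \<Longrightarrow> (\<And>i. i \<in> I \<Longrightarrow> F i \<in> schwartz_functions) \<Longrightarrow> (\<lambda>x. \<Sum>i\<in>I. F i x) \<in> schwartz_functions"
  by (induction I rule: finite_induct) (auto simp: schwartz_zero schwartz_add)

lemma test_functions_mult:
  "f \<in> test_functions \<Longrightarrow> (\<lambda>x. c * f x) \<in> test_functions"
  by (auto simp: test_functions_iff smooth_mult)

lemma test_functions_add:
  assumes "f \<in> test_functions" "g \<in> test_functions"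
  shows "(\<lambda>x. f x + g x) \<in> test_functions"
proof -
  obtain R S where "\<And>x. R < \<bar>x\<bar> \<Longrightarrow> f x = 0" "\<And>x. S < \<bar>x\<bar> \<Longrightarrow> g x = 0"
    using assms by (auto simp: test_functions_iff)
  then show ?thesis
    using assms by (auto simp: test_functions_iff smooth_add intro!: exI[of _ "max R S"])
qed

lemma test_functions_nvd: "f \<in> test_functions \<Longrightarrow> nvd n f \<in> test_functions"
  using test_function_radius[of f] by (metis less_imp_le smooth_nvd test_function_smooth test_functions_iff)

lemma test_functions_affine:
  assumes "f \<in> test_functions" and "c \<noteq> 0"
  shows "(\<lambda>x. f (a + c * x)) \<in> test_functions"
proof -
  obtain R where R: "\<And>x. R < \<bar>x\<bar> \<Longrightarrow> f x = 0"
    using assms by (auto simp: test_functions_iff)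
  have "f (a + c * x) = 0" if "(\<bar>R\<bar> + \<bar>a\<bar>) / \<bar>c\<bar> < \<bar>x\<bar>" for x
  proof (rule R)
    have "\<bar>R\<bar> + \<bar>a\<bar> < \<bar>c * x\<bar>"
      using that assms(2) by (simp add: pos_divide_less_eq abs_mult mult.commute)
    then show "R < \<bar>a + c * x\<bar>" by linarith
  qed
  then show ?thesis
    using assms by (auto simp: test_functions_iff smooth_affine)
qed

lemma test_functions_translate: "f \<in> test_functions \<Longrightarrow> (\<lambda>y. f (y - x)) \<in> test_functions"
  using test_functions_affine[of f 1 "- x"] by (simp add: add.commute)

lemma test_functions_reflect: "f \<in> test_functions \<Longrightarrow> (\<lambda>y. f (x - y)) \<in> test_functions"
  using test_functions_affine[of f "-1" x] by simp

lemma weighted_norm_add: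
  assumes "f \<in> schwartz_functions" and "g \<in> schwartz_functions"
  shows "weighted_norm k m (\<lambda>x. f x + g x) \<le> weighted_norm k m f + weighted_norm k m g"
  unfolding weighted_norm_def sum.distrib[symmetric]
proof (intro sum_mono cSUP_least)
  fix j x
  have "norm (weight k x *\<^sub>R nvd j (\<lambda>x. f x + g x) x)
      \<le> norm (weight k x *\<^sub>R nvd j f x) + norm (weight k x *\<^sub>R nvd j g x)"
    using assms norm_triangle_ineq[of "weight k x *\<^sub>R nvd j f x" "weight k x *\<^sub>R nvd j g x"]
    by (simp only: nvd_add schwartz_smooth scaleR_add_right)
  also have "\<dots> \<le> (SUP x. norm (weight k x *\<^sub>R nvd j f x)) + (SUP x. norm (weight k x *\<^sub>R nvd j g x))"
    by (intro add_mono cSUP_upper schwartz_bdd assms) auto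
  finally show "norm (weight k x *\<^sub>R nvd j (\<lambda>x. f x + g x) x) \<le> \<dots>" .
qed auto

lemma weighted_norm_mult:
  fixes f :: "real \<Rightarrow> 'k::real_normed_field"
  assumes "f \<in> schwartz_functions"
  shows "weighted_norm k m (\<lambda>x. c * f x) = norm c * weighted_norm k m f"
proof -
  have "(SUP x. norm (weight k x *\<^sub>R nvd j (\<lambda>x. c * f x) x)) = norm c * (SUP x. norm (weight k x *\<^sub>R nvd j f x))" for j
  proof -
    have "norm c * (SUP x. norm (weight k x *\<^sub>R nvd j f x)) = (SUP x. norm c * norm (weight k x *\<^sub>R nvd j f x))"
      using continuous_at_Sup_mono[of "\<lambda>x. norm c * x" "range (\<lambda>x. norm (weight k x *\<^sub>R nvd j f x))"]
        schwartz_bdd[OF assms]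
      by (simp add: image_image mono_def mult_left_mono continuous_at_imp_continuous_at_within)
    then show ?thesis
      using assms by (simp add: nvd_mult schwartz_smooth norm_mult mult.left_commute)
  qed
  then show ?thesis by (simp add: weighted_norm_def sum_distrib_left)
qed

lemma weighted_norm_nvd:
  assumes "f \<in> schwartz_functions"
  shows "weighted_norm k m (nvd n f) \<le> real (Suc m) * weighted_norm k (m + n) f"
  using weighted_norm_le[of m k "nvd n f" "\<lambda>_. weighted_norm k (m + n) f"]
    weighted_norm_ge[OF assms] by (simp add: nvd_nvd)

section \<open>Continuity and seminorm estimates\<close>

definition function_subspace :: "(real \<Rightarrow> 'k::real_normed_field) set \<Rightarrow> bool" where
  "function_subspace V \<longleftrightarrow> (\<lambda>x. 0) \<in> V \<and> (\<forall>f\<in>V. \<forall>g\<in>V. (\<lambda>x. f x + g x) \<in> V) \<and>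
    (\<forall>c. \<forall>f\<in>V. (\<lambda>x. c * f x) \<in> V)"

lemma function_subspaceD:
  assumes "function_subspace V"
  shows "(\<lambda>x. 0) \<in> V"
    and "f \<in> V \<Longrightarrow> g \<in> V \<Longrightarrow> (\<lambda>x. f x + g x) \<in> V"
    and "f \<in> V \<Longrightarrow> (\<lambda>x. c * f x) \<in> V"
    and "f \<in> V \<Longrightarrow> (\<lambda>x. r *\<^sub>R f x) \<in> V"
    and "f \<in> V \<Longrightarrow> (\<lambda>x. - f x) \<in> V"
    and "f \<in> V \<Longrightarrow> g \<in> V \<Longrightarrow> (\<lambda>x. f x - g x) \<in> V"
proof -
  show 0: "(\<lambda>x. 0) \<in> V" using assms by (auto simp: function_subspace_def)
  show add: "(\<lambda>x. f x + g x) \<in> V" if "f \<in> V" "g \<in> V" for f g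
    using assms that by (auto simp: function_subspace_def)
  show mult: "(\<lambda>x. c * f x) \<in> V" if "f \<in> V" for f c
    using assms that by (auto simp: function_subspace_def)
  show "(\<lambda>x. r *\<^sub>R f x) \<in> V" if "f \<in> V"
    using mult[OF that, of "of_real r"] by (simp add: scaleR_conv_of_real)
  show minus: "(\<lambda>x. - f x) \<in> V" if "f \<in> V" for f
    using mult[OF that, of "-1"] by simp
  show "(\<lambda>x. f x - g x) \<in> V" if "f \<in> V" "g \<in> V"
    using add[OF that(1) minus[OF that(2)]] by simp
qed

lemma function_subspace_test: "function_subspace test_functions"
  by (auto simp: function_subspace_def test_functions_add test_functions_mult)
    (auto simp: test_functions_iff smooth_zero)

lemma function_subspace_schwartz: "function_subspace schwartz_functions"
  by (auto simp: function_subspace_def schwartz_add schwartz_mult schwartz_zero)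

lemma function_subspace_test_on:
  assumes "closed K"
  shows "function_subspace (test_functions_on K)"
  using assms
  by (auto simp: function_subspace_def test_functions_on_iff smooth_add smooth_mult smooth_zero)

lemma seminorm_onD:
  assumes "seminorm_on V p"
  shows "f \<in> V \<Longrightarrow> g \<in> V \<Longrightarrow> p (\<lambda>x. f x + g x) \<le> p f + p g"
    and "f \<in> V \<Longrightarrow> p (\<lambda>x. c * f x) = norm c * p f"
  using assms by (simp_all add: seminorm_on_def)

lemma seminorm_on_nonneg:
  assumes "seminorm_on V p" and "function_subspace V" and "f \<in> V"
  shows "0 \<le> p f"
proof -
  note V = function_subspaceD[OF assms(2)]
  have "p (\<lambda>x. 0 * f x) = norm (0 :: 'a) * p f" and "p (\<lambda>x. (-1) * f x) = norm (-1 :: 'a) * p f"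
    by (rule seminorm_onD[OF assms(1,3)])+
  moreover have "p (\<lambda>x. f x + (-1) * f x) \<le> p f + p (\<lambda>x. (-1) * f x)"
    by (rule seminorm_onD(1)[OF assms(1,3) V(3)[OF assms(3)]])
  ultimately show ?thesis by simp
qed

lemma seminorm_on_weighted_norm:
  "V \<subseteq> schwartz_functions \<Longrightarrow> seminorm_on V (weighted_norm k m)"
  by (auto simp: seminorm_on_def weighted_norm_add weighted_norm_mult subset_iff)

lemma test_functions_on_subset_schwartz:
  "compact K \<Longrightarrow> test_functions_on K \<subseteq> schwartz_functions"
  using test_functions_on_subset test_functions_subset_schwartz by blast

text \<open>The subbasic sets are balls around arbitrary centres, not only around 0. If such a ball with
centre \<open>f\<close> and radius \<open>e\<close> contains 0, then it contains the ball around 0 of radius \<open>e - p (-f)\<close>.\<close>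

lemma seminorm_topology_neighbourhood_zero:
  assumes P: "\<And>p. p \<in> P \<Longrightarrow> seminorm_on V p" and V: "function_subspace V"
    and "openin (seminorm_topology V P) U" and "(\<lambda>x. 0) \<in> U"
  shows "\<exists>Q e. finite Q \<and> Q \<subseteq> P \<and> 0 < e \<and> (\<forall>g\<in>V. (\<forall>p\<in>Q. p g < e) \<longrightarrow> g \<in> U)"
proof -
  let ?B = "{{g \<in> V. p (\<lambda>x. g x - f x) < e} | f p e. f \<in> V \<and> p \<in> P \<and> 0 < e}"
  have "generate_topology_on ?B U"
    using assms(3) by (simp add: seminorm_topology_def openin_topology_generated_by_iff)
  then show ?thesis using assms(4)
  proof (induction rule: generate_topology_on.induct)
    case (Int a b)
    from Int.IH(1) Int.prems obtain Q e
      where Q: "finite Q" "Q \<subseteq> P" "0 < e" "\<And>g. g \<in> V \<Longrightarrow> \<forall>p\<in>Q. p g < e \<Longrightarrow> g \<in> a"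
      by auto
    from Int.IH(2) Int.prems obtain Q' e'
      where Q': "finite Q'" "Q' \<subseteq> P" "0 < e'" "\<And>g. g \<in> V \<Longrightarrow> \<forall>p\<in>Q'. p g < e' \<Longrightarrow> g \<in> b"
      by auto
    have "g \<in> a \<inter> b" if "g \<in> V" "\<forall>p\<in>Q \<union> Q'. p g < min e e'" for g
      using Q(4)[OF that(1)] Q'(4)[OF that(1)] that(2) by simp
    with Q(1-3) Q'(1-3) show ?case
      by (intro exI[of _ "Q \<union> Q'"] exI[of _ "min e e'"]) simp
  next
    case (UN A)
    then obtain a where a: "a \<in> A" "(\<lambda>x. 0) \<in> a" by auto
    from UN.IH[OF this] obtain Q e
      where Q: "finite Q" "Q \<subseteq> P" "0 < e" "\<And>g. g \<in> V \<Longrightarrow> \<forall>p\<in>Q. p g < e \<Longrightarrow> g \<in> a"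
      by auto
    have "g \<in> \<Union>A" if "g \<in> V" "\<forall>p\<in>Q. p g < e" for g
      using Q(4)[OF that] a(1) by (rule UnionI[rotated])
    with Q(1-3) show ?case by (intro exI[of _ Q] exI[of _ e]) simp
  next
    case (Basis s)
    then obtain f p e where s: "s = {g \<in> V. p (\<lambda>x. g x - f x) < e}" "f \<in> V" "p \<in> P" "0 < e"
      by blast
    have minus: "(\<lambda>x. - f x) \<in> V" using s V by (simp add: function_subspaceD)
    have "p (\<lambda>x. - f x) < e" using Basis s by auto
    moreover have "p (\<lambda>x. g x - f x) \<le> p g + p (\<lambda>x. - f x)" if "g \<in> V" for g
    proof -
      have "p (\<lambda>x. g x + - f x) \<le> p g + p (\<lambda>x. - f x)"
        by (rule seminorm_onD(1)[OF P[OF s(3)] that minus])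
      then show ?thesis by simp
    qed
    ultimately have "g \<in> s" if "g \<in> V" "p g < e - p (\<lambda>x. - f x)" for g
      unfolding s(1) using that by (smt (verit) mem_Collect_eq)
    then show ?case
      using s(3) \<open>p (\<lambda>x. - f x) < e\<close> by (intro exI[of _ "{p}"] exI[of _ "e - p (\<lambda>x. - f x)"]) simp
  qed auto
qed

text \<open>Homogeneity turns a bound on a neighbourhood of 0 into a seminorm estimate. The functional \<open>q\<close>
is the norm of a linear map in one application and one of the seminorms that define the
inductive limit topology in another.\<close>

lemma seminorm_topology_bounded:
  assumes P: "\<And>p. p \<in> P \<Longrightarrow> seminorm_on V p" and V: "function_subspace V"
    and U: "openin (seminorm_topology V P) U" "(\<lambda>x. 0) \<in> U"
    and q: "\<And>g. g \<in> U \<Longrightarrow> q g < 1" "\<And>r g. 0 < r \<Longrightarrow> g \<in> V \<Longrightarrow> q (\<lambda>x. of_real r * g x) = r * q g"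
  shows "\<exists>Q C. finite Q \<and> Q \<subseteq> P \<and> 0 \<le> C \<and> (\<forall>g\<in>V. q g \<le> C * (\<Sum>p\<in>Q. p g))"
proof -
  have "\<exists>Q e. finite Q \<and> Q \<subseteq> P \<and> 0 < e \<and> (\<forall>g\<in>V. (\<forall>p\<in>Q. p g < e) \<longrightarrow> g \<in> U)"
    by (rule seminorm_topology_neighbourhood_zero[OF P V U])
  then obtain Q e where Q: "finite Q" "Q \<subseteq> P" "0 < e" "\<forall>g\<in>V. (\<forall>p\<in>Q. p g < e) \<longrightarrow> g \<in> U"
    by (elim exE conjE)
  have "q g \<le> (1 / e) * (\<Sum>p\<in>Q. p g)" if g: "g \<in> V" for g
  proof -
    have nonneg: "0 \<le> p g" if "p \<in> Q" for p
      using that Q(2) by (intro seminorm_on_nonneg[OF P V g]) auto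
    have "q g * e \<le> t" if t: "(\<Sum>p\<in>Q. p g) < t" for t
    proof -
      have t0: "0 < t" using t sum_nonneg[of Q "\<lambda>p. p g"] nonneg by force
      have et: "\<bar>e / t\<bar> = e / t" "0 < e / t" using t0 Q(3) by auto
      have "(\<lambda>x. of_real (e / t) * g x) \<in> U"
      proof (rule Q(4)[rule_format])
        show "(\<lambda>x. of_real (e / t) * g x) \<in> V" using g by (rule function_subspaceD(3)[OF V])
        fix p assume p: "p \<in> Q"
        have "p (\<lambda>x. of_real (e / t) * g x) = norm (of_real (e / t) :: 'a) * p g"
          using p Q(2) by (intro seminorm_onD(2)[OF P g]) auto
        also have "\<dots> = e / t * p g" by (simp only: norm_of_real et)
        also have "\<dots> < e / t * t"
          using Q(3) t0 t member_le_sum[OF p, of "\<lambda>p. p g"] nonneg Q(1)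
          by (intro mult_strict_left_mono) auto
        finally show "p (\<lambda>x. of_real (e / t) * g x) < e" using t0 by simp
      qed
      from q(1)[OF this] have "e / t * q g < 1"
        by (simp only: q(2)[OF et(2) g])
      then have "e * q g < t" using t0 by (simp add: pos_divide_less_eq)
      then show ?thesis by (simp add: mult.commute)
    qed
    then have "q g * e \<le> (\<Sum>p\<in>Q. p g)" by (rule dense_ge)
    then show ?thesis using Q(3) by (simp add: field_simps)
  qed
  with Q(1-3) show ?thesis by (intro exI[of _ Q] exI[of _ "1 / e"]) auto
qed

lemma weighted_norms_directed:
  fixes Q :: "((real \<Rightarrow> 'k::real_normed_field) \<Rightarrow> real) set"
  assumes "finite Q" and "Q \<subseteq> {weighted_norm k m | k m. k \<in> I}"
    and I: "i \<in> I" "\<And>a b. a \<in> I \<Longrightarrow> b \<in> I \<Longrightarrow> max a b \<in> (I :: nat set)"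
  shows "\<exists>k\<in>I. \<exists>m C. 0 \<le> C \<and> (\<forall>f\<in>schwartz_functions. (\<Sum>p\<in>Q. p f) \<le> C * weighted_norm k m f)"
  using assms(1,2)
proof (induction Q rule: finite_induct)
  case empty
  show ?case using I(1) by (auto intro!: bexI[of _ i] exI[of _ 0])
next
  case (insert p Q)
  then obtain k m C where 1: "k \<in> I" "0 \<le> C"
    "\<And>f. f \<in> schwartz_functions \<Longrightarrow> (\<Sum>p\<in>Q. p f) \<le> C * weighted_norm k m f"
    by blast
  obtain k' m' where 2: "k' \<in> I" "p = weighted_norm k' m'" using insert.prems by blast
  have "(\<Sum>p\<in>insert p Q. p f) \<le> (C + 1) * weighted_norm (max k k') (max m m') f"
    if f: "f \<in> schwartz_functions" for f
  proof -
    have "C * weighted_norm k m f \<le> C * weighted_norm (max k k') (max m m') f"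
      using f 1(2) by (intro mult_left_mono weighted_norm_mono) auto
    moreover have "p f \<le> weighted_norm (max k k') (max m m') f"
      unfolding 2 using f by (intro weighted_norm_mono) auto
    ultimately show ?thesis
      using 1(3)[OF f] insert.hyps by (simp add: algebra_simps)
  qed
  then show ?case using 1 2 I(2)
    by (intro bexI[of _ "max k k'"] exI[of _ "max m m'"] exI[of _ "C + 1"]) auto
qed

context banach_space_over
begin

lemma linear_functional_onD:
  assumes "linear_functional_on smul V T" and V: "function_subspace V"
  shows "f \<in> V \<Longrightarrow> g \<in> V \<Longrightarrow> T (\<lambda>x. f x + g x) = T f + T g"
    and "f \<in> V \<Longrightarrow> T (\<lambda>x. c * f x) = smul c (T f)"
    and "f \<in> V \<Longrightarrow> T (\<lambda>x. r *\<^sub>R f x) = r *\<^sub>R T f"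
    and "f \<in> V \<Longrightarrow> g \<in> V \<Longrightarrow> T (\<lambda>x. f x - g x) = T f - T g"
    and "T (\<lambda>x. 0) = 0"
proof -
  show add: "T (\<lambda>x. f x + g x) = T f + T g" if "f \<in> V" "g \<in> V" for f g
    using assms(1) that by (auto simp: linear_functional_on_def)
  show mult: "T (\<lambda>x. c * f x) = smul c (T f)" if "f \<in> V" for f c
    using assms(1) that by (auto simp: linear_functional_on_def)
  show "T (\<lambda>x. r *\<^sub>R f x) = r *\<^sub>R T f" if "f \<in> V" for f r
    using mult[OF that, of "of_real r"] by (simp add: scaleR_conv_of_real scale_of_real)
  show "T (\<lambda>x. f x - g x) = T f - T g" if "f \<in> V" "g \<in> V" for f g
    using add[of f "\<lambda>x. (-1) * g x"] mult[of g "-1"] that function_subspaceD[OF V] by simp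
  show "T (\<lambda>x. 0) = 0"
    using mult[of "\<lambda>x. 0" 0] function_subspaceD[OF V] by simp
qed

lemma linear_functional_bounded:
  assumes lin: "linear_functional_on smul V T" and V: "function_subspace V"
    and P: "\<And>p. p \<in> P \<Longrightarrow> seminorm_on V p"
    and cont: "continuous_map (seminorm_topology V P) euclidean T"
    and top: "topspace (seminorm_topology V P) = V"
  shows "\<exists>Q C. finite Q \<and> Q \<subseteq> P \<and> 0 \<le> C \<and> (\<forall>g\<in>V. norm (T g) \<le> C * (\<Sum>p\<in>Q. p g))"
proof (rule seminorm_topology_bounded[OF P V, where U = "{g \<in> V. T g \<in> ball 0 1}"])
  show "openin (seminorm_topology V P) {g \<in> V. T g \<in> ball 0 1}"
    using openin_continuous_map_preimage[OF cont, of "ball 0 1"] by (simp add: top)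
  show "(\<lambda>x. 0) \<in> {g \<in> V. T g \<in> ball 0 1}"
    using linear_functional_onD(5)[OF lin V] function_subspaceD(1)[OF V] by simp
  show "norm (T (\<lambda>x. of_real r * g x)) = r * norm (T g)" if "0 < r" "g \<in> V" for r g
    using linear_functional_onD(2)[OF lin V that(2)] that(1) by (simp add: scale_of_real)
qed auto

lemma tempered_distribution_bound:
  assumes "S \<in> tempered_distributions smul"
  obtains N C where "0 \<le> C" and "\<And>f. f \<in> schwartz_functions \<Longrightarrow> norm (S f) \<le> C * weighted_norm N N f"
proof -
  have "\<exists>Q C. finite Q \<and> Q \<subseteq> {weighted_norm k m | k m. True} \<and> 0 \<le> C \<and>
      (\<forall>g\<in>schwartz_functions. norm (S g) \<le> C * (\<Sum>p\<in>Q. p g))"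
    using assms topspace_schwartz_topology unfolding tempered_distributions_def schwartz_topology_def
    by (intro linear_functional_bounded function_subspace_schwartz)
      (auto intro: seminorm_on_weighted_norm)
  then obtain Q C where Q: "finite Q" "Q \<subseteq> {weighted_norm k m | k m. True}" "0 \<le> C"
    "\<And>g. g \<in> schwartz_functions \<Longrightarrow> norm (S g) \<le> C * (\<Sum>p\<in>Q. p g)"
    by blast
  then obtain k m D where D: "0 \<le> D"
    "\<And>f. f \<in> schwartz_functions \<Longrightarrow> (\<Sum>p\<in>Q. p f) \<le> D * weighted_norm k m f"
    using weighted_norms_directed[of Q UNIV] by auto metis
  show thesis
  proof (rule that[of "C * D" "max k m"])
    fix f :: "real \<Rightarrow> 'k" assume f: "f \<in> schwartz_functions"
    have "norm (S f) \<le> C * (D * weighted_norm k m f)"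
      using Q(4)[OF f] mult_left_mono[OF D(2)[OF f] Q(3)] by simp
    also have "\<dots> \<le> C * (D * weighted_norm (max k m) (max k m) f)"
      using f Q(3) D(1) by (intro mult_left_mono weighted_norm_mono) auto
    finally show "norm (S f) \<le> C * D * weighted_norm (max k m) (max k m) f" by simp
  qed (use Q D in auto)
qed

lemma tempered_distributionI:
  assumes lin: "linear_functional_on smul schwartz_functions S"
    and bound: "\<And>f. f \<in> schwartz_functions \<Longrightarrow> norm (S f) \<le> C * weighted_norm k m f"
  shows "S \<in> tempered_distributions smul"
proof -
  have "openin schwartz_topology {f \<in> schwartz_functions. S f \<in> U}" if "open U" for U
    unfolding openin_subopen[of _ "{f \<in> schwartz_functions. S f \<in> U}"]
  proof safe
    fix f :: "real \<Rightarrow> 'k" assume f: "f \<in> schwartz_functions" "S f \<in> U"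
    obtain e where e: "0 < e" "ball (S f) e \<subseteq> U" using f \<open>open U\<close> openE by blast
    let ?d = "e / (\<bar>C\<bar> + 1)"
    let ?B = "{g \<in> schwartz_functions. weighted_norm k m (\<lambda>x. g x - f x) < ?d}"
    have "openin schwartz_topology ?B"
      unfolding schwartz_topology_def seminorm_topology_def openin_topology_generated_by_iff
    proof (rule generate_topology_on.Basis, rule CollectI, intro exI conjI)
      show "f \<in> schwartz_functions" "0 < ?d" using f(1) e(1) by auto
      show "weighted_norm k m \<in> {weighted_norm k m |k m. True}" by blast
    qed (rule refl)
    moreover have "f \<in> ?B" using f(1) e(1) by (simp add: weighted_norm_zero)
    moreover have "S g \<in> U" if g: "g \<in> ?B" for g
    proof -
      have "norm (S g - S f) = norm (S (\<lambda>x. g x - f x))"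
        using g f linear_functional_onD(4)[OF lin function_subspace_schwartz] by simp
      also have "\<dots> \<le> C * weighted_norm k m (\<lambda>x. g x - f x)"
        using g f by (intro bound schwartz_diff) auto
      also have "\<dots> \<le> (\<bar>C\<bar> + 1) * weighted_norm k m (\<lambda>x. g x - f x)"
        using g f by (intro mult_right_mono weighted_norm_nonneg schwartz_diff) auto
      also have "\<dots> < e" using g by (simp add: pos_less_divide_eq mult.commute)
      finally show ?thesis using e(2) by (auto simp: dist_norm norm_minus_commute)
    qed
    ultimately show "\<exists>B. openin schwartz_topology B \<and> f \<in> B \<and> B \<subseteq> {f \<in> schwartz_functions. S f \<in> U}"
      by (intro exI[of _ ?B]) auto
  qed
  then show ?thesis
    using lin by (auto simp: tempered_distributions_def continuous_map topspace_schwartz_topology)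
qed

lemma distribution_linear:
  "T \<in> distributions smul \<Longrightarrow> linear_functional_on smul test_functions T"
  by (simp add: distributions_def)

text \<open>Two levels of seminorms are unwound: by continuity on the inductive limit, \<open>T\<close> is dominated by
finitely many seminorms \<open>p\<close> that are continuous on each \<open>test_functions_on K\<close>, and on the
given \<open>K\<close> each \<open>p\<close> is dominated by finitely many unweighted norms.\<close>

lemma distribution_bound:
  assumes T: "T \<in> distributions smul" and K: "compact K"
  obtains m C where "0 \<le> C" and "\<And>f. f \<in> test_functions_on K \<Longrightarrow> norm (T f) \<le> C * weighted_norm 0 m f"
proof -
  let ?P = "{p. seminorm_on (test_functions :: (real \<Rightarrow> 'k) set) p \<and>
        (\<forall>K. compact K \<longrightarrow> continuous_map (test_topology_on K) euclideanreal p)}"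
  let ?W = "{weighted_norm 0 m | m. True} :: ((real \<Rightarrow> 'k) \<Rightarrow> real) set"
  note sub = test_functions_on_subset[OF K]
  have VK: "function_subspace (test_functions_on K :: (real \<Rightarrow> 'k) set)"
    using K by (intro function_subspace_test_on compact_imp_closed)
  have "\<exists>Q C. finite Q \<and> Q \<subseteq> ?P \<and> 0 \<le> C \<and> (\<forall>g\<in>test_functions. norm (T g) \<le> C * (\<Sum>p\<in>Q. p g))"
    using T topspace_test_topology[where 'a = 'k] unfolding distributions_def test_topology_def
    by (intro linear_functional_bounded function_subspace_test) auto
  then obtain Q C where Q: "finite Q" "Q \<subseteq> ?P" "0 \<le> C"
    "\<And>g. g \<in> test_functions \<Longrightarrow> norm (T g) \<le> C * (\<Sum>p\<in>Q. p g)"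
    by blast
  have pbound: "\<exists>R D. finite R \<and> R \<subseteq> ?W \<and> 0 \<le> D \<and> (\<forall>g\<in>test_functions_on K. p g \<le> D * (\<Sum>r\<in>R. r g))"
    if p: "p \<in> Q" for p
  proof (rule seminorm_topology_bounded[OF _ VK, where U = "{g \<in> test_functions_on K. p g < 1}"])
    have sn: "seminorm_on test_functions p" and cont: "continuous_map (test_topology_on K) euclideanreal p"
      using p Q(2) K by auto
    show "seminorm_on (test_functions_on K) r" if "r \<in> ?W" for r
      using that test_functions_on_subset_schwartz[OF K] seminorm_on_weighted_norm by auto
    show "openin (seminorm_topology (test_functions_on K) ?W) {g \<in> test_functions_on K. p g < 1}"
      using openin_continuous_map_preimage[OF cont, of "{..<1}"] 
      by (simp add: topspace_test_topology_on) (simp add: test_topology_on_def)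
    have scale: "p (\<lambda>x. c * g x) = norm c * p g" if "g \<in> test_functions" for c g
      by (rule seminorm_onD(2)[OF sn that])
    show "p (\<lambda>x. of_real r * g x) = r * p g" if "0 < r" "g \<in> test_functions_on K" for r g
      using scale[of g "of_real r"] that sub by auto
    show "(\<lambda>x. 0) \<in> {g \<in> test_functions_on K. p g < 1}"
      using scale[of "\<lambda>x. 0" 0] function_subspaceD(1)[OF VK] sub by auto
  qed auto
  have "\<exists>m D. 0 \<le> D \<and> (\<forall>g\<in>test_functions_on K. p g \<le> D * weighted_norm 0 m g)" if p: "p \<in> Q" for p
  proof -
    obtain R D where R: "finite R" "R \<subseteq> ?W" "0 \<le> D"
      "\<And>g. g \<in> test_functions_on K \<Longrightarrow> p g \<le> D * (\<Sum>r\<in>R. r g)"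
      using pbound[OF p] by blast
    have "\<exists>k\<in>{0}. \<exists>m C. 0 \<le> C \<and> (\<forall>f\<in>schwartz_functions. (\<Sum>p\<in>R. p f) \<le> C * weighted_norm k m f)"
      using R by (intro weighted_norms_directed) auto
    then obtain m E where E: "0 \<le> E" "\<And>f. f \<in> schwartz_functions \<Longrightarrow> (\<Sum>p\<in>R. p f) \<le> E * weighted_norm 0 m f"
      by auto
    have "p g \<le> (D * E) * weighted_norm 0 m g" if "g \<in> test_functions_on K" for g
    proof -
      have "g \<in> schwartz_functions" using that test_functions_on_subset_schwartz[OF K] by blast
      from mult_left_mono[OF E(2)[OF this] R(3)] R(4)[OF that] show ?thesis by (simp add: mult.assoc)
    qed
    then show ?thesis using R E by (intro exI[of _ m] exI[of _ "D * E"]) auto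
  qed
  then obtain m D where D: "\<And>p. p \<in> Q \<Longrightarrow> 0 \<le> D p"
    "\<And>p g. p \<in> Q \<Longrightarrow> g \<in> test_functions_on K \<Longrightarrow> p g \<le> D p * weighted_norm 0 (m p) g"
    by metis
  define M where "M = Max (insert 0 (m ` Q))"
  have mM: "m p \<le> M" if "p \<in> Q" for p using that Q(1) by (simp add: M_def)
  show thesis
  proof (rule that[of "C * (\<Sum>p\<in>Q. D p)" M])
    fix g :: "real \<Rightarrow> 'k" assume g: "g \<in> test_functions_on K"
    then have gs: "g \<in> schwartz_functions" and gt: "g \<in> test_functions"
      using test_functions_on_subset_schwartz[OF K] sub by auto
    have "(\<Sum>p\<in>Q. p g) \<le> (\<Sum>p\<in>Q. D p * weighted_norm 0 M g)"
    proof (rule sum_mono)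
      fix p assume p: "p \<in> Q"
      have "p g \<le> D p * weighted_norm 0 (m p) g" by (rule D(2)[OF p g])
      also have "\<dots> \<le> D p * weighted_norm 0 M g"
        by (rule mult_left_mono[OF weighted_norm_mono[OF gs order_refl mM[OF p]] D(1)[OF p]])
      finally show "p g \<le> D p * weighted_norm 0 M g" .
    qed
    then have "C * (\<Sum>p\<in>Q. p g) \<le> C * ((\<Sum>p\<in>Q. D p) * weighted_norm 0 M g)"
      using Q(3) by (intro mult_left_mono) (auto simp: sum_distrib_right)
    with Q(4)[OF gt] show "norm (T g) \<le> C * (\<Sum>p\<in>Q. D p) * weighted_norm 0 M g"
      by (simp add: mult.assoc)
  qed (use Q(3) D(1) in \<open>auto intro!: mult_nonneg_nonneg sum_nonneg\<close>)
qed

text \<open>Continuity in the form in which it is used: supports in a fixed compact set and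
uniform convergence of every derivative.\<close>

lemma distribution_tendsto:
  assumes T: "T \<in> distributions smul" and K: "compact K"
    and \<phi>: "\<forall>\<^sub>F t in F. \<phi> t \<in> test_functions_on K" and \<psi>: "\<psi> \<in> test_functions_on K"
    and lim: "\<And>j. uniform_limit UNIV (\<lambda>t. nvd j (\<phi> t)) (nvd j \<psi>) F"
  shows "((\<lambda>t. T (\<phi> t)) \<longlongrightarrow> T \<psi>) F"
proof -
  obtain m C where C: "0 \<le> C" "\<And>f. f \<in> test_functions_on K \<Longrightarrow> norm (T f) \<le> C * weighted_norm 0 m f"
    using distribution_bound[OF T K] by metis
  note VK = function_subspaceD[OF function_subspace_test_on[OF compact_imp_closed[OF K]]]
  note sub = test_functions_on_subset[OF K]
  show ?thesis
  proof (rule tendstoI)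
    fix e :: real assume e: "0 < e"
    define d where "d = e / (C * real (Suc m) + 1)"
    have d: "0 < d" using e C(1) by (auto simp: d_def intro!: divide_pos_pos add_nonneg_pos)
    have "\<forall>\<^sub>F t in F. \<forall>j\<in>{..m}. \<forall>y\<in>UNIV. dist (nvd j (\<phi> t) y) (nvd j \<psi> y) < d"
      using lim d by (intro eventually_ball_finite) (use uniform_limitD[OF lim] in auto)
    with \<phi> show "\<forall>\<^sub>F t in F. dist (T (\<phi> t)) (T \<psi>) < e"
    proof eventually_elim
      case (elim t)
      then have sm: "smooth (\<phi> t)" "smooth \<psi>"
        using \<psi> by (auto simp: test_functions_on_def)
      have "T (\<phi> t) - T \<psi> = T (\<lambda>y. \<phi> t y - \<psi> y)"
        using elim \<psi> sub by (subst linear_functional_onD(4)[OF distribution_linear[OF T] function_subspace_test]) auto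
      also have "norm \<dots> \<le> C * weighted_norm 0 m (\<lambda>y. \<phi> t y - \<psi> y)"
        by (intro C VK \<psi> elim)
      also have "weighted_norm 0 m (\<lambda>y. \<phi> t y - \<psi> y) \<le> (\<Sum>j\<le>m. d)"
        by (rule weighted_norm_le) (use elim in \<open>auto simp: nvd_diff[OF sm] dist_norm less_imp_le\<close>)
      finally have "norm (T (\<phi> t) - T \<psi>) \<le> C * (\<Sum>j\<le>m. d)"
        using C(1) by (simp add: mult_left_mono)
      also have "\<dots> = (C * real (Suc m)) * d" by simp
      also have "\<dots> < (C * real (Suc m) + 1) * d" using d by (intro mult_strict_right_mono) auto
      also have "\<dots> = e"
        using C(1) by (simp add: d_def add_nonneg_eq_0_iff)
      finally show ?case by (simp add: dist_norm)
    qed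
  qed
qed

end

section \<open>Convolution over an interval\<close>

text \<open>Antiderivatives on the whole line of functions with values in a Banach space; integrals below are
often evaluated by choosing one and applying the fundamental theorem of calculus.\<close>

lemma antiderivative_exists:
  fixes f :: "real \<Rightarrow> 'a::banach"
  assumes "continuous_on UNIV f"
  obtains F where "F 0 = 0" and "\<And>x. (F has_vector_derivative f x) (at x)"
proof -
  define F where "F x = (if 0 \<le> x then integral {0..x} f else - integral {x..0} f)" for x
  have int: "f integrable_on {a..b}" for a b
    by (intro integrable_continuous_real continuous_on_subset[OF assms]) auto
  have F: "F x = integral {-R..x} f - integral {-R..0} f" if "\<bar>x\<bar> < R" for x R
  proof (cases "0 \<le> x")
    case True
    then have "integral {-R..0} f + integral {0..x} f = integral {-R..x} f"
      using that by (intro Henstock_Kurzweil_Integration.integral_combine int) auto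
    then show ?thesis using True by (simp add: F_def eq_diff_eq add.commute)
  next
    case False
    then have "integral {-R..0} f = integral {-R..x} f + integral {x..0} f"
      using that by (intro Henstock_Kurzweil_Integration.integral_combine[symmetric] int) auto
    then show ?thesis using False by (simp add: F_def)
  qed
  have "(F has_vector_derivative f x) (at x)" for x
  proof (rule has_vector_derivative_transform_within_open)
    let ?R = "\<bar>x\<bar> + 1"
    have "((\<lambda>u. integral {-?R..u} f) has_vector_derivative f x) (at x within {-?R..?R})"
      by (intro integral_has_vector_derivative continuous_on_subset[OF assms]) auto
    then show "((\<lambda>u. integral {-?R..u} f - integral {-?R..0} f) has_vector_derivative f x) (at x)"
      by (subst (asm) at_within_interior) (auto simp: interior_atLeastAtMost_real intro!: derivative_eq_intros)
    show "integral {-?R..y} f - integral {-?R..0} f = F y" if "y \<in> {-?R<..<?R}" for y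
      using that by (intro F[symmetric]) (auto simp: abs_less_iff)
  qed auto
  moreover have "F 0 = 0" by (simp add: F_def)
  ultimately show thesis by (rule that[rotated])
qed

lemma has_integral_UNIV_of_support:
  fixes f :: "real \<Rightarrow> 'a::banach"
  assumes "continuous_on {a..b} f" and "\<And>x. x \<notin> {a..b} \<Longrightarrow> f x = 0"
  shows "(f has_integral integral {a..b} f) UNIV"
  by (rule has_integral_on_superset[OF integrable_integral[OF integrable_continuous_real]])
    (use assms in auto)

lemma integral_eq_of_supports:
  fixes f :: "real \<Rightarrow> 'a::banach"
  assumes "continuous_on UNIV f" and "\<And>x. x \<notin> {a..b} \<Longrightarrow> f x = 0" and "\<And>x. x \<notin> {c..d} \<Longrightarrow> f x = 0"
  shows "integral {a..b} f = integral {c..d} f"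
proof (rule has_integral_unique)
  show "(f has_integral integral {a..b} f) UNIV" "(f has_integral integral {c..d} f) UNIV"
    by (intro has_integral_UNIV_of_support continuous_on_subset[OF assms(1)]; use assms in auto)+
qed

text \<open>For \<open>\<eta>\<close> vanishing outside \<open>[a,b]\<close> this is the convolution of \<open>\<eta>\<close> and \<open>\<phi>\<close>. The end points are kept as
parameters because the integral is differentiated with respect to the upper one.\<close>

definition conv_on ::
    "real \<Rightarrow> real \<Rightarrow> (real \<Rightarrow> 'k::{real_normed_field,euclidean_space}) \<Rightarrow> (real \<Rightarrow> 'k) \<Rightarrow> real \<Rightarrow> 'k" where
  "conv_on a b \<eta> \<phi> y = integral {a..b} (\<lambda>x. \<eta> x * \<phi> (y - x))"

lemma continuous_convolution_integrand:
  fixes \<eta> \<phi> :: "real \<Rightarrow> 'k::real_normed_field"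
  assumes "continuous_on UNIV \<eta>" and "continuous_on UNIV \<phi>"
  shows "continuous_on S (\<lambda>x. \<eta> x * \<phi> (y - x))"
  by (intro continuous_on_mult continuous_on_subset[OF assms(1)]
      continuous_on_compose2[OF assms(2)] continuous_intros) auto

lemma
  fixes \<eta> \<phi> :: "real \<Rightarrow> 'k::{real_normed_field,euclidean_space}"
  assumes \<eta>: "continuous_on UNIV \<eta>" and \<phi>: "smooth \<phi>"
  shows smooth_conv_on: "smooth (conv_on a b \<eta> \<phi>)"
    and nvd_conv_on:
      "nvd n (conv_on a b \<eta> \<phi>) = conv_on a b \<eta> (nvd n \<phi>)"
proof -
  have *: "(conv_on a b \<eta> (nvd n \<phi>) has_vector_derivative
      conv_on a b \<eta> (nvd (Suc n) \<phi>) y) (at y)" for n y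
  proof -
    have "((\<lambda>y. \<eta> x * nvd n \<phi> (y - x)) has_vector_derivative \<eta> x * nvd (Suc n) \<phi> (y - x)) (at y)" for y x
    proof -
      have "((\<lambda>y. nvd n \<phi> (y - x)) has_vector_derivative nvd (Suc n) \<phi> (y - x)) (at y)"
        using smooth_has_derivative[OF smooth_translate[OF \<phi>, of x], of n y]
        by (simp only: nvd_translate[OF \<phi>])
      from bounded_linear.has_vector_derivative[OF bounded_linear_mult_right this]
      show ?thesis .
    qed
    moreover have "(\<lambda>x. \<eta> x * nvd n \<phi> (y - x)) integrable_on {a..b}" for y
      by (intro integrable_continuous_real continuous_convolution_integrand \<eta> smooth_continuous \<phi>)
    moreover have "continuous_on (UNIV \<times> {a..b}) (\<lambda>z. \<eta> (snd z) * nvd (Suc n) \<phi> (fst z - snd z))"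
      by (intro continuous_on_mult continuous_on_compose2[OF \<eta>]
          continuous_on_compose2[OF smooth_continuous[OF \<phi>]] continuous_intros) auto
    ultimately show ?thesis
      unfolding conv_on_def
      using leibniz_rule_vector_derivative[of UNIV a b "\<lambda>y x. \<eta> x * nvd n \<phi> (y - x)"
          "\<lambda>y x. \<eta> x * nvd (Suc n) \<phi> (y - x)" y]
      by (simp add: case_prod_beta)
  qed
  have 0: "conv_on a b \<eta> (nvd 0 \<phi>) x = conv_on a b \<eta> \<phi> x" for x
    by simp
  show "smooth (conv_on a b \<eta> \<phi>)"
    by (rule smooth_derivative_sequence(1)[where G = "\<lambda>n. conv_on a b \<eta> (nvd n \<phi>)", OF 0 *])
  show "nvd n (conv_on a b \<eta> \<phi>) = conv_on a b \<eta> (nvd n \<phi>)"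
    by (rule smooth_derivative_sequence(2)[where G = "\<lambda>n. conv_on a b \<eta> (nvd n \<phi>)", OF 0 *])
qed

lemma conv_on_eq_0:
  assumes "\<And>x. x \<notin> {c..d} \<Longrightarrow> \<phi> x = 0" and "y \<notin> {a + c..b + d}"
  shows "conv_on a b \<eta> \<phi> y = 0"
proof -
  have "\<eta> x * \<phi> (y - x) = 0" if "x \<in> {a..b}" for x
    using assms that by (subst assms(1)) auto
  then show ?thesis
    unfolding conv_on_def by (intro integral_unique has_integral_is_0)
qed

lemma conv_on_test_on:
  fixes \<eta> \<phi> :: "real \<Rightarrow> 'k::{real_normed_field,euclidean_space}"
  assumes "continuous_on UNIV \<eta>" and "\<phi> \<in> test_functions_on {c..d}"
  shows "conv_on a b \<eta> \<phi> \<in> test_functions_on {a + c..b + d}"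
proof -
  have "smooth \<phi>" and 0: "\<And>x. x \<notin> {c..d} \<Longrightarrow> \<phi> x = 0"
    using assms(2) by (auto simp: test_functions_on_iff)
  then show ?thesis
    using smooth_conv_on[OF assms(1)] conv_on_eq_0[of c d \<phi>, OF 0]
    by (simp add: test_functions_on_iff)
qed

lemma test_function_on_interval:
  assumes "\<phi> \<in> test_functions"
  obtains R where "0 < R" and "\<phi> \<in> test_functions_on {-R..R}" and "\<And>n x. R \<le> \<bar>x\<bar> \<Longrightarrow> nvd n \<phi> x = 0"
proof -
  obtain R where R: "0 < R" "\<And>n x. R \<le> \<bar>x\<bar> \<Longrightarrow> nvd n \<phi> x = 0"
    using test_function_radius[OF assms] by metis
  have "\<phi> \<in> test_functions_on {-R..R}"
    using R(2)[of _ 0] by (auto simp: test_functions_on_iff test_function_smooth[OF assms])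
  with R show thesis by (intro that)
qed

lemma conv_on_test:
  fixes \<eta> \<phi> :: "real \<Rightarrow> 'k::{real_normed_field,euclidean_space}"
  assumes "continuous_on UNIV \<eta>" and "\<phi> \<in> test_functions"
  shows "conv_on a b \<eta> \<phi> \<in> test_functions"
proof -
  obtain R where "\<phi> \<in> test_functions_on {-R..R}" using test_function_on_interval[OF assms(2)] by metis
  from conv_on_test_on[OF assms(1) this, of a b] test_functions_on_subset[of "{a + - R..b + R}"]
  show ?thesis by blast
qed

lemma norm_conv_on_le:
  fixes \<eta> \<phi> :: "real \<Rightarrow> 'k::{real_normed_field,euclidean_space}"
  assumes "continuous_on UNIV \<eta>" and "continuous_on UNIV \<phi>" and "a \<le> b"
    and "\<And>x. norm (\<eta> x) \<le> A" and "\<And>x. norm (\<phi> x) \<le> B"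
  shows "norm (conv_on a b \<eta> \<phi> y) \<le> A * B * (b - a)"
  unfolding conv_on_def
proof (rule integral_bound[OF assms(3) continuous_convolution_integrand[OF assms(1,2)]])
  show "norm (\<eta> t * \<phi> (y - t)) \<le> A * B" for t
    unfolding norm_mult by (rule mult_mono) (use assms norm_ge_zero order_trans in blast)+
qed

lemma conv_on_diff:
  fixes \<eta> \<phi> \<psi> :: "real \<Rightarrow> 'k::{real_normed_field,euclidean_space}"
  assumes "continuous_on UNIV \<eta>" and "continuous_on UNIV \<phi>" and "continuous_on UNIV \<psi>"
  shows "conv_on a b \<eta> (\<lambda>x. \<phi> x - \<psi> x) =
    (\<lambda>y. conv_on a b \<eta> \<phi> y - conv_on a b \<eta> \<psi> y)"
proof
  fix y
  have "integral {a..b} (\<lambda>x. \<eta> x * \<phi> (y - x) - \<eta> x * \<psi> (y - x)) =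
      integral {a..b} (\<lambda>x. \<eta> x * \<phi> (y - x)) - integral {a..b} (\<lambda>x. \<eta> x * \<psi> (y - x))"
    by (intro Henstock_Kurzweil_Integration.integral_diff integrable_continuous_real continuous_convolution_integrand assms)
  then show "conv_on a b \<eta> (\<lambda>x. \<phi> x - \<psi> x) y =
      conv_on a b \<eta> \<phi> y - conv_on a b \<eta> \<psi> y"
    by (simp only: conv_on_def right_diff_distrib)
qed

lemma conv_on_scaleR:
  "conv_on a b \<eta> (\<lambda>x. r *\<^sub>R \<phi> x) = (\<lambda>y. r *\<^sub>R conv_on a b \<eta> \<phi> y)"
  by (simp add: conv_on_def fun_eq_iff)

text \<open>Integration by parts; the boundary terms vanish since all derivatives of \<open>\<eta>\<close> do so at the end
points.\<close>

lemma conv_on_nvd_swap: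
  fixes \<eta> \<phi> :: "real \<Rightarrow> 'k::{real_normed_field,euclidean_space}"
  assumes "smooth \<eta>" and "smooth \<phi>" and "a \<le> b" and "\<And>j. nvd j \<eta> a = 0" and "\<And>j. nvd j \<eta> b = 0"
  shows "conv_on a b \<eta> (nvd n \<phi>) = conv_on a b (nvd n \<eta>) \<phi>"
  using assms(2)
proof (induction n arbitrary: \<phi>)
  case (Suc n)
  have "conv_on a b (nvd n \<eta>) (nvd 1 \<phi>) y = conv_on a b (nvd (Suc n) \<eta>) \<phi> y" for y
  proof -
    let ?f = "\<lambda>x. nvd n \<eta> x * \<phi> (y - x)"
    have "((\<lambda>x. nvd (Suc n) \<eta> x * \<phi> (y - x) - nvd n \<eta> x * nvd 1 \<phi> (y - x)) has_integral (?f b - ?f a)) {a..b}"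
    proof (rule fundamental_theorem_of_calculus[OF assms(3)])
      fix x
      have "((\<lambda>x. \<phi> (y - x)) has_vector_derivative - nvd 1 \<phi> (y - x)) (at x within {a..b})"
        using has_vector_derivative_at_within[OF smooth_has_derivative[OF smooth_reflect[OF Suc.prems, of y], of 0 x]]
        by (simp add: nvd_reflect[OF Suc.prems])
      from has_vector_derivative_mult[OF has_vector_derivative_at_within[OF smooth_has_derivative[OF assms(1)]] this]
      show "(?f has_vector_derivative nvd (Suc n) \<eta> x * \<phi> (y - x) - nvd n \<eta> x * nvd 1 \<phi> (y - x)) (at x within {a..b})"
        by (simp add: algebra_simps)
    qed
    then have "integral {a..b} (\<lambda>x. nvd (Suc n) \<eta> x * \<phi> (y - x) - nvd n \<eta> x * nvd 1 \<phi> (y - x)) = 0"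
      using assms(4,5) by (simp add: integral_unique)
    moreover have "integral {a..b} (\<lambda>x. nvd (Suc n) \<eta> x * \<phi> (y - x) - nvd n \<eta> x * nvd 1 \<phi> (y - x)) =
        conv_on a b (nvd (Suc n) \<eta>) \<phi> y - conv_on a b (nvd n \<eta>) (nvd 1 \<phi>) y"
      unfolding conv_on_def
      using smooth_continuous[OF Suc.prems, of UNIV 0]
      by (intro Henstock_Kurzweil_Integration.integral_diff integrable_continuous_real
          continuous_convolution_integrand smooth_continuous assms Suc.prems) simp
    ultimately show ?thesis by simp
  qed
  then have step: "conv_on a b (nvd n \<eta>) (nvd 1 \<phi>) = conv_on a b (nvd (Suc n) \<eta>) \<phi>"
    by (rule ext)
  have "conv_on a b \<eta> (nvd (Suc n) \<phi>) = conv_on a b \<eta> (nvd n (nvd 1 \<phi>))"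
    by (simp add: nvd_nvd)
  also have "\<dots> = conv_on a b (nvd n \<eta>) (nvd 1 \<phi>)"
    by (rule Suc.IH[OF smooth_nvd[OF Suc.prems]])
  finally show ?case using step by simp
qed simp

text \<open>\<open>\<phi>\<close> is bounded and Lipschitz, so the convergence is uniform in \<open>y\<close>.\<close>

lemma uniform_limit_mult_translate:
  fixes \<eta> \<phi> :: "real \<Rightarrow> 'k::real_normed_field"
  assumes \<eta>: "continuous_on UNIV \<eta>" and \<phi>: "\<phi> \<in> test_functions"
  shows "uniform_limit UNIV (\<lambda>x y. \<eta> x * \<phi> (y - x)) (\<lambda>y. \<eta> t * \<phi> (y - t)) (at t within S)"
proof -
  obtain A where A: "0 < A" "\<And>x. norm (\<phi> x) \<le> A" using test_function_boundedE[OF \<phi>, of 0] by auto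
  obtain B where B: "0 < B" "\<And>x. norm (nvd 1 \<phi> x) \<le> B" using test_function_boundedE[OF \<phi>, of 1] by auto
  have lip: "norm (\<phi> x - \<phi> y) \<le> B * \<bar>x - y\<bar>" for x y
    using derivative_bound[OF smooth_has_derivative[OF test_function_smooth[OF \<phi>], of 0], of B x y] B(2) by simp
  have bound: "norm (\<eta> x * \<phi> (y - x) - \<eta> t * \<phi> (y - t)) \<le> norm (\<eta> x - \<eta> t) * A + norm (\<eta> t) * (B * \<bar>x - t\<bar>)" for x y
  proof -
    have "\<eta> x * \<phi> (y - x) - \<eta> t * \<phi> (y - t) = (\<eta> x - \<eta> t) * \<phi> (y - x) + \<eta> t * (\<phi> (y - x) - \<phi> (y - t))"
      by (simp add: algebra_simps)
    also have "norm \<dots> \<le> norm (\<eta> x - \<eta> t) * norm (\<phi> (y - x)) + norm (\<eta> t) * norm (\<phi> (y - x) - \<phi> (y - t))"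
      by (intro norm_triangle_le add_mono) (simp_all add: norm_mult)
    also have "\<dots> \<le> norm (\<eta> x - \<eta> t) * A + norm (\<eta> t) * (B * \<bar>x - t\<bar>)"
      using lip[of "y - x" "y - t"] by (intro add_mono mult_left_mono A) (auto simp: abs_minus_commute)
    finally show ?thesis .
  qed
  have "(\<eta> \<longlongrightarrow> \<eta> t) (at t within S)"
    using \<eta> by (auto simp: continuous_on_eq_continuous_at isCont_def intro: Lim_at_imp_Lim_at_within)
  then have "((\<lambda>x. norm (\<eta> x - \<eta> t) * A + norm (\<eta> t) * (B * \<bar>x - t\<bar>)) \<longlongrightarrow>
      norm (\<eta> t - \<eta> t) * A + norm (\<eta> t) * (B * \<bar>t - t\<bar>)) (at t within S)"
    by (intro tendsto_intros)
  then have lim: "((\<lambda>x. norm (\<eta> x - \<eta> t) * A + norm (\<eta> t) * (B * \<bar>x - t\<bar>)) \<longlongrightarrow> 0) (at t within S)"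
    by simp
  show ?thesis
  proof (rule uniform_limitI)
    fix e :: real assume "0 < e"
    from order_tendstoD(2)[OF lim this]
    show "\<forall>\<^sub>F x in at t within S. \<forall>y\<in>UNIV. dist (\<eta> x * \<phi> (y - x)) (\<eta> t * \<phi> (y - t)) < e"
      by eventually_elim (use bound in \<open>auto simp: dist_norm intro: le_less_trans\<close>)
  qed
qed

lemma uniform_limit_translate:
  fixes \<phi> :: "real \<Rightarrow> 'k::real_normed_field"
  assumes "\<phi> \<in> test_functions"
  shows "uniform_limit UNIV (\<lambda>x y. \<phi> (y - x)) (\<lambda>y. \<phi> (y - t)) (at t within S)"
  using uniform_limit_mult_translate[OF continuous_on_const assms, of 1] by simp

section \<open>Distributions applied to convolutions\<close>

lemma test_on_translate:
  assumes "\<phi> \<in> test_functions_on {c..d}" and "p \<le> c + x" and "d + x \<le> q"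
  shows "(\<lambda>y. \<phi> (y - x)) \<in> test_functions_on {p..q}"
proof -
  have sm: "smooth \<phi>" and 0: "\<And>x. x \<notin> {c..d} \<Longrightarrow> \<phi> x = 0"
    using assms(1) by (auto simp: test_functions_on_iff)
  have "\<phi> (y - x) = 0" if "y \<notin> {p..q}" for y
    by (rule 0) (use that assms(2,3) in auto)
  then show ?thesis by (simp add: test_functions_on_iff smooth_translate[OF sm])
qed

lemma difference_quotient_test_on:
  assumes "continuous_on UNIV \<eta>" and "\<phi> \<in> test_functions_on {-R..R}" and "0 < R"
    and "t \<in> {a..b}" and "s \<in> {a..b}"
  shows "(\<lambda>y. r *\<^sub>R (conv_on a s \<eta> \<phi> y - conv_on a t \<eta> \<phi> y -
      (s - t) *\<^sub>R (\<eta> t * \<phi> (y - t)))) \<in> test_functions_on {a - R..b + R}"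
proof -
  note V = function_subspaceD[OF function_subspace_test_on, of "{a - R..b + R}"]
  have "conv_on a u \<eta> \<phi> \<in> test_functions_on {a - R..b + R}" if "u \<in> {a..b}" for u
    using conv_on_test_on[OF assms(1,2), of a u] that
    by (auto simp: test_functions_on_iff)
  moreover have "(\<lambda>y. \<phi> (y - t)) \<in> test_functions_on {a - R..b + R}"
    using assms(4) by (intro test_on_translate[OF assms(2)]) auto
  ultimately show ?thesis
    using assms(4,5) by (intro V(4) V(6) V(3)) auto
qed

text \<open>Differentiating \<open>conv_on a s \<eta> \<phi>\<close> with respect to \<open>s\<close> gives a multiple of a translate of \<open>\<phi>\<close>. By the mean
value inequality the difference quotients converge uniformly in \<open>y\<close>; applied to the derivatives
of \<open>\<phi>\<close>, this is convergence in the space of test functions.\<close>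

lemma conv_on_difference_quotient:
  fixes \<eta> \<phi> :: "real \<Rightarrow> 'k::{real_normed_field,euclidean_space}"
  assumes \<eta>: "continuous_on UNIV \<eta>" and \<phi>: "\<phi> \<in> test_functions" and t: "t \<in> {a..b}"
  shows "uniform_limit UNIV
    (\<lambda>s y. (1 / norm (s - t)) *\<^sub>R (conv_on a s \<eta> \<phi> y - conv_on a t \<eta> \<phi> y -
      (s - t) *\<^sub>R (\<eta> t * \<phi> (y - t)))) (\<lambda>y. 0) (at t within {a..b})"
proof (rule uniform_limitI)
  fix e :: real assume e: "0 < e"
  have "\<forall>\<^sub>F x in at t within {a..b}. \<forall>y\<in>UNIV. dist (\<eta> x * \<phi> (y - x)) (\<eta> t * \<phi> (y - t)) < e / 2"
    by (rule uniform_limitD[OF uniform_limit_mult_translate[OF \<eta> \<phi>]]) (use e in simp)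
  then obtain d where d: "0 < d"
    "\<And>x y. x \<in> {a..b} \<Longrightarrow> x \<noteq> t \<Longrightarrow> dist x t < d \<Longrightarrow> dist (\<eta> x * \<phi> (y - x)) (\<eta> t * \<phi> (y - t)) < e / 2"
    unfolding eventually_at by auto
  have small: "norm (\<eta> x * \<phi> (y - x) - \<eta> t * \<phi> (y - t)) \<le> e / 2" if "x \<in> {a..b} \<inter> ball t d" for x y
  proof (cases "x = t")
    case False
    then show ?thesis using d(2)[of x y] that by (auto simp: dist_norm norm_minus_commute less_imp_le)
  qed (use e in simp)
  have cont: "continuous_on {a..b} (\<lambda>x. \<eta> x * \<phi> (y - x))" for y
    by (intro continuous_convolution_integrand \<eta>)
      (use smooth_continuous[OF test_function_smooth[OF \<phi>], of UNIV 0] in simp)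
  have quotient: "norm (conv_on a s \<eta> \<phi> y - conv_on a t \<eta> \<phi> y -
      (s - t) *\<^sub>R (\<eta> t * \<phi> (y - t))) \<le> norm (s - t) * (e / 2)" if s: "s \<in> {a..b} \<inter> ball t d" for s y
    unfolding conv_on_def
  proof (rule vector_differentiable_bound_linearization[where S = "{a..b} \<inter> ball t d"
        and f = "\<lambda>u. integral {a..u} (\<lambda>x. \<eta> x * \<phi> (y - x))"
        and f' = "\<lambda>x. \<eta> x * \<phi> (y - x)"])
    show "((\<lambda>u. integral {a..u} (\<lambda>x. \<eta> x * \<phi> (y - x))) has_vector_derivative \<eta> x * \<phi> (y - x))
        (at x within {a..b} \<inter> ball t d)" if "x \<in> {a..b} \<inter> ball t d" for x
      by (rule has_vector_derivative_within_subset[OF integral_has_vector_derivative[OF cont]])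
        (use that in auto)
    show "closed_segment t s \<subseteq> {a..b} \<inter> ball t d"
      using s t d(1) by (intro closed_segment_subset convex_Int) auto
    show "t \<in> {a..b} \<inter> ball t d" using t d(1) by simp
  qed (use small in auto)
  have "\<forall>\<^sub>F s in at t within {a..b}. s \<in> {a..b} \<inter> ball t d \<and> s \<noteq> t"
    using d(1) by (auto simp: eventually_at dist_commute intro!: exI[of _ d])
  then show "\<forall>\<^sub>F s in at t within {a..b}. \<forall>y\<in>UNIV. dist ((1 / norm (s - t)) *\<^sub>R
      (conv_on a s \<eta> \<phi> y - conv_on a t \<eta> \<phi> y -
        (s - t) *\<^sub>R (\<eta> t * \<phi> (y - t)))) 0 < e"
  proof eventually_elim
    case (elim s)
    show ?case
    proof
      fix y
      have "norm ((1 / norm (s - t)) *\<^sub>R (conv_on a s \<eta> \<phi> y - conv_on a t \<eta> \<phi> y -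
        (s - t) *\<^sub>R (\<eta> t * \<phi> (y - t)))) \<le> (1 / norm (s - t)) * (norm (s - t) * (e / 2))"
        unfolding norm_scaleR using elim by (intro mult_mono quotient) auto
      also have "\<dots> < e" using elim e by simp
      finally show "dist ((1 / norm (s - t)) *\<^sub>R (conv_on a s \<eta> \<phi> y - conv_on a t \<eta> \<phi> y -
        (s - t) *\<^sub>R (\<eta> t * \<phi> (y - t)))) 0 < e" by simp
    qed
  qed
qed

context banach_space_over
begin

lemma distribution_translate_continuous:
  fixes \<phi> :: "real \<Rightarrow> 'k"
  assumes T: "T \<in> distributions smul" and \<phi>: "\<phi> \<in> test_functions"
  shows "continuous_on S (\<lambda>x. T (\<lambda>y. \<phi> (y - x)))"
  unfolding continuous_on_def
proof
  fix t
  obtain R where R: "0 < R" "\<phi> \<in> test_functions_on {-R..R}"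
    using test_function_on_interval[OF \<phi>] by metis
  have mem: "(\<lambda>y. \<phi> (y - x)) \<in> test_functions_on {t - R - 1..t + R + 1}" if "\<bar>x - t\<bar> < 1" for x
    using that by (intro test_on_translate[OF R(2)]) auto
  show "((\<lambda>x. T (\<lambda>y. \<phi> (y - x))) \<longlongrightarrow> T (\<lambda>y. \<phi> (y - t))) (at t within S)"
  proof (rule distribution_tendsto[OF T])
    show "\<forall>\<^sub>F x in at t within S. (\<lambda>y. \<phi> (y - x)) \<in> test_functions_on {t - R - 1..t + R + 1}"
      using mem by (auto simp: eventually_at dist_norm intro!: exI[of _ 1])
    show "uniform_limit UNIV (\<lambda>x. nvd j (\<lambda>y. \<phi> (y - x))) (nvd j (\<lambda>y. \<phi> (y - t))) (at t within S)" for j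
      using uniform_limit_translate[OF test_functions_nvd[OF \<phi>], of j]
      by (simp add: nvd_translate[OF test_function_smooth[OF \<phi>]])
  qed (use mem[of t] in auto)
qed

text \<open>\<open>T\<close> commutes with the integral that defines a convolution. The function
\<open>s \<mapsto> T (conv_on a s \<eta> \<phi>)\<close> vanishes at \<open>a\<close>, and since the difference quotients of \<open>conv_on a s \<eta> \<phi>\<close> converge
in the space of test functions, its derivative is \<open>smul (\<eta> s) (T (\<lambda>y. \<phi> (y - s)))\<close>. The fundamental
theorem of calculus then gives the claim.\<close>

lemma distribution_conv_on:
  fixes \<phi> :: "real \<Rightarrow> 'k"
  assumes T: "T \<in> distributions smul" and \<eta>: "continuous_on UNIV \<eta>" and \<phi>: "\<phi> \<in> test_functions"
    and "a \<le> b"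
  shows "((\<lambda>x. smul (\<eta> x) (T (\<lambda>y. \<phi> (y - x)))) has_integral T (conv_on a b \<eta> \<phi>)) {a..b}"
proof -
  note lin = linear_functional_onD[OF distribution_linear[OF T] function_subspace_test]
  note V = function_subspaceD[OF function_subspace_test]
  obtain R where R: "0 < R" "\<phi> \<in> test_functions_on {-R..R}"
    using test_function_on_interval[OF \<phi>] by metis
  have sm: "smooth \<phi>" using \<phi> by (rule test_function_smooth)
  have G: "((\<lambda>s. T (conv_on a s \<eta> \<phi>)) has_vector_derivative smul (\<eta> t) (T (\<lambda>y. \<phi> (y - t))))
      (at t within {a..b})" if t: "t \<in> {a..b}" for t
  proof -
    \<comment> \<open>The remainder of the first-order expansion, divided by the increment; \<open>T\<close> of it tends to 0.\<close>
    define \<psi> where "\<psi> s y = (1 / norm (s - t)) *\<^sub>R (conv_on a s \<eta> \<phi> y -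
      conv_on a t \<eta> \<phi> y - (s - t) *\<^sub>R (\<eta> t * \<phi> (y - t)))" for s y
    have smc: "smooth (conv_on a u \<eta> \<phi>)" for u by (rule smooth_conv_on[OF \<eta> sm])
    have smt: "smooth (\<lambda>y. (s - t) *\<^sub>R (\<eta> t * \<phi> (y - t)))" for s
      by (intro smooth_scaleR smooth_mult smooth_translate sm)
    have "((\<lambda>s. T (\<psi> s)) \<longlongrightarrow> T (\<lambda>y. 0)) (at t within {a..b})"
    proof (rule distribution_tendsto[OF T, where K = "{a - R..b + R}"])
      show "\<forall>\<^sub>F s in at t within {a..b}. \<psi> s \<in> test_functions_on {a - R..b + R}"
        using difference_quotient_test_on[OF \<eta> R(2,1) t]
        by (auto simp: eventually_at \<psi>_def[abs_def] intro!: exI[of _ 1])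
      show "(\<lambda>y. 0) \<in> test_functions_on {a - R..b + R}"
        by (rule function_subspaceD(1)[OF function_subspace_test_on]) simp
      fix j
      have "nvd j (\<psi> s) y = (1 / norm (s - t)) *\<^sub>R (conv_on a s \<eta> (nvd j \<phi>) y -
          conv_on a t \<eta> (nvd j \<phi>) y - (s - t) *\<^sub>R (\<eta> t * nvd j \<phi> (y - t)))" for s y
        unfolding \<psi>_def[abs_def]
        by (simp only: nvd_scaleR smooth_diff smc smt nvd_diff nvd_conv_on[OF \<eta> sm]
            smooth_mult smooth_translate sm nvd_mult nvd_translate)
      then have "(\<lambda>s. nvd j (\<psi> s)) = (\<lambda>s y. (1 / norm (s - t)) *\<^sub>R (conv_on a s \<eta> (nvd j \<phi>) y -
          conv_on a t \<eta> (nvd j \<phi>) y - (s - t) *\<^sub>R (\<eta> t * nvd j \<phi> (y - t))))"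
        by (intro ext)
      then show "uniform_limit UNIV (\<lambda>s. nvd j (\<psi> s)) (nvd j (\<lambda>y. 0)) (at t within {a..b})"
        using conv_on_difference_quotient[OF \<eta> test_functions_nvd[OF \<phi>] t, of j]
        by (simp add: nth_vector_derivative_zero)
    qed simp
    moreover have "T (\<psi> s) = (1 / norm (s - t)) *\<^sub>R (T (conv_on a s \<eta> \<phi>) -
        (T (conv_on a t \<eta> \<phi>) + (s - t) *\<^sub>R smul (\<eta> t) (T (\<lambda>y. \<phi> (y - t)))))" for s
    proof -
      note tests = conv_on_test[OF \<eta> \<phi>] test_functions_translate[OF \<phi>]
      have "T (\<psi> s) = (1 / norm (s - t)) *\<^sub>R (T (conv_on a s \<eta> \<phi>) -
        T (conv_on a t \<eta> \<phi>) - (s - t) *\<^sub>R smul (\<eta> t) (T (\<lambda>y. \<phi> (y - t))))"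
        unfolding \<psi>_def[abs_def]
        by (subst lin(3) lin(4) lin(2), (intro V(6) V(4) V(3) tests)+)+ (rule refl)
      then show ?thesis by (simp add: algebra_simps)
    qed
    ultimately show ?thesis
      unfolding has_vector_derivative_def has_derivative_within
      by (simp add: lin(5) bounded_linear_scaleR_left)
  qed
  have "conv_on a a \<eta> \<phi> = (\<lambda>y. 0)"
    by (simp add: conv_on_def fun_eq_iff)
  with fundamental_theorem_of_calculus[OF \<open>a \<le> b\<close> G] show ?thesis by (simp add: lin(5))
qed

end

section \<open>Dilations and approximate identities\<close>

text \<open>The factor \<open>c\<close> preserves the integral.\<close>

definition dilation :: "real \<Rightarrow> (real \<Rightarrow> 'a::real_normed_vector) \<Rightarrow> real \<Rightarrow> 'a" where
  "dilation c \<phi> x = c *\<^sub>R \<phi> (c * x)"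

lemma nvd_scaled_argument:
  fixes \<phi> :: "real \<Rightarrow> 'a::real_normed_vector"
  assumes "smooth \<phi>"
  shows "nvd n (\<lambda>x. \<phi> (c * x)) = (\<lambda>x. c ^ n *\<^sub>R nvd n \<phi> (c * x))"
  using nvd_affine[OF assms, of n 0 c] by simp

lemma smooth_scaled_argument: "smooth \<phi> \<Longrightarrow> smooth (\<lambda>x. \<phi> (c * x))"
  using smooth_affine[of \<phi> 0 c] by simp

lemma test_on_scaled_argument:
  assumes "\<phi> \<in> test_functions_on {-1..1}" and "1 \<le> c"
  shows "(\<lambda>x. \<phi> (c * x)) \<in> test_functions_on {-1..1}"
proof -
  have "\<phi> (c * x) = 0" if "x \<notin> {-1..1}" for x
  proof -
    have "1 < \<bar>x\<bar>" using that by auto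
    also have "\<bar>x\<bar> \<le> c * \<bar>x\<bar>" using assms(2) by (simp add: mult_le_cancel_right1)
    also have "\<dots> = \<bar>c * x\<bar>" using assms(2) by (simp add: abs_mult)
    finally have "c * x \<notin> {-1..1}" by auto
    then show ?thesis using assms(1) by (simp add: test_functions_on_iff)
  qed
  then show ?thesis using assms(1) by (simp add: test_functions_on_iff smooth_scaled_argument)
qed

lemma dilation_test_on:
  "\<phi> \<in> test_functions_on {-1..1} \<Longrightarrow> 1 \<le> c \<Longrightarrow> dilation c \<phi> \<in> test_functions_on {-1..1}"
  unfolding dilation_def[abs_def]
  by (intro function_subspaceD(4)[OF function_subspace_test_on] test_on_scaled_argument) auto

lemma integral_dilation_translate:
  fixes \<rho> :: "real \<Rightarrow> 'a::banach"
  assumes cont: "continuous_on UNIV \<rho>" and "0 < c"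
  shows "((\<lambda>x. dilation c \<rho> (y - x)) has_integral integral {-1..1} \<rho>) {y - 1 / c..y + 1 / c}"
proof -
  obtain H where H: "\<And>x. (H has_vector_derivative \<rho> x) (at x)"
    using antiderivative_exists[OF cont] by metis
  have "(\<rho> has_integral H 1 - H (-1)) {-1..1}"
    by (rule fundamental_theorem_of_calculus) (auto intro: has_vector_derivative_at_within H)
  then have int: "integral {-1..1} \<rho> = H 1 - H (-1)" by (rule integral_unique)
  have deriv: "((\<lambda>x. - H (c * (y - x))) has_vector_derivative dilation c \<rho> (y - x)) (at x)" for x
  proof -
    have "((\<lambda>x. c * (y - x)) has_real_derivative - c) (at x)"
      by (auto intro!: derivative_eq_intros)
    then have "((\<lambda>x. c * (y - x)) has_vector_derivative - c) (at x)"
      by (simp add: has_real_derivative_iff_has_vector_derivative)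
    from has_vector_derivative_minus[OF vector_diff_chain_at[OF this H]] show ?thesis
      by (simp add: o_def dilation_def)
  qed
  have "((\<lambda>x. dilation c \<rho> (y - x)) has_integral
      (- H (c * (y - (y + 1 / c))) - - H (c * (y - (y - 1 / c))))) {y - 1 / c..y + 1 / c}"
    using assms(2) by (intro fundamental_theorem_of_calculus[OF _ has_vector_derivative_at_within[OF deriv]]) simp
  then show ?thesis using assms(2) by (simp add: int)
qed

lemma test_function_lipschitz:
  fixes \<eta> :: "real \<Rightarrow> 'k::real_normed_field"
  assumes "\<eta> \<in> test_functions"
  obtains L where "0 < L" and "\<And>x y. norm (nvd j \<eta> x - nvd j \<eta> y) \<le> L * \<bar>x - y\<bar>"
proof -
  obtain L where L: "0 < L" "\<And>x. norm (nvd (Suc j) \<eta> x) \<le> L"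
    using test_function_boundedE[OF assms] by metis
  with derivative_bound[OF smooth_has_derivative[OF test_function_smooth[OF assms]] L(2)]
  show thesis by (intro that)
qed

text \<open>Since \<open>dilation c \<rho>\<close> has integral 1, lives on an interval of length \<open>2 / c\<close> and is bounded by
\<open>c B\<close>, the error is the average of \<open>\<eta> x - \<eta> y\<close>, which is at most \<open>L / c\<close> on that interval.\<close>

lemma approximate_identity:
  fixes \<eta> \<rho> :: "real \<Rightarrow> 'k::{real_normed_field,euclidean_space}"
  assumes \<rho>: "\<rho> \<in> test_functions_on {-1..1}" "integral {-1..1} \<rho> = 1" "\<And>x. norm (\<rho> x) \<le> B"
    and \<eta>: "continuous_on UNIV \<eta>" "\<And>x. R \<le> \<bar>x\<bar> \<Longrightarrow> \<eta> x = 0" "\<And>x y. norm (\<eta> x - \<eta> y) \<le> L * \<bar>x - y\<bar>"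
    and "0 < c" "0 \<le> L"
  shows "norm (conv_on (-R) R \<eta> (dilation c \<rho>) y - \<eta> y) \<le> 2 * B * L / c"
proof -
  let ?I = "{y - 1 / c..y + 1 / c}"
  let ?f = "\<lambda>x. \<eta> x * dilation c \<rho> (y - x)"
  have \<rho>c: "continuous_on UNIV \<rho>"
    using \<rho>(1) smooth_continuous[of \<rho> UNIV 0] by (simp add: test_functions_on_def)
  have dc: "continuous_on UNIV (dilation c \<rho>)"
    unfolding dilation_def[abs_def] by (intro continuous_intros continuous_on_compose2[OF \<rho>c]) auto
  have d0: "dilation c \<rho> (y - x) = 0" if "x \<notin> ?I" for x
  proof -
    have "1 / c < \<bar>y - x\<bar>" using that by auto
    then have "1 < c * \<bar>y - x\<bar>" using \<open>0 < c\<close> by (simp add: pos_divide_less_eq mult.commute)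
    also have "\<dots> = \<bar>c * (y - x)\<bar>" using \<open>0 < c\<close> by (simp add: abs_mult)
    finally have "c * (y - x) \<notin> {-1..1}" by auto
    then show ?thesis using \<rho>(1) by (simp add: dilation_def test_functions_on_iff)
  qed
  have \<eta>0: "\<eta> x = 0" if "x \<notin> {-R..R}" for x
    by (rule \<eta>(2)) (use that in auto)
  have eq: "conv_on (-R) R \<eta> (dilation c \<rho>) y = integral ?I ?f"
    unfolding conv_on_def
    by (rule integral_eq_of_supports[OF continuous_convolution_integrand[OF \<eta>(1) dc]])
      (simp_all add: \<eta>0 d0 del: atLeastAtMost_iff)
  have "((\<lambda>x. \<eta> y * dilation c \<rho> (y - x)) has_integral \<eta> y * 1) ?I"
    using integral_dilation_translate[OF \<rho>c \<open>0 < c\<close>, of y] unfolding \<rho>(2) by (rule has_integral_mult_right)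
  moreover have "(?f has_integral integral ?I ?f) ?I"
    by (intro integrable_integral integrable_continuous_real continuous_convolution_integrand \<eta> dc)
  ultimately have "((\<lambda>x. ?f x - \<eta> y * dilation c \<rho> (y - x)) has_integral
      (conv_on (-R) R \<eta> (dilation c \<rho>) y - \<eta> y * 1)) ?I"
    unfolding eq by (rule has_integral_diff[rotated])
  then have int: "conv_on (-R) R \<eta> (dilation c \<rho>) y - \<eta> y =
      integral ?I (\<lambda>x. ?f x - \<eta> y * dilation c \<rho> (y - x))"
    by (simp add: integral_unique)
  have "norm (integral ?I (\<lambda>x. ?f x - \<eta> y * dilation c \<rho> (y - x))) \<le> L * B * ((y + 1 / c) - (y - 1 / c))"
  proof (rule integral_bound)
    show "continuous_on ?I (\<lambda>x. ?f x - \<eta> y * dilation c \<rho> (y - x))"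
      by (intro continuous_on_diff continuous_convolution_integrand \<eta> dc continuous_on_const)
    fix x assume x: "x \<in> ?I"
    have "norm (?f x - \<eta> y * dilation c \<rho> (y - x)) = norm (\<eta> x - \<eta> y) * (c * norm (\<rho> (c * (y - x))))"
      using \<open>0 < c\<close> by (simp add: dilation_def norm_mult flip: left_diff_distrib scaleR_diff_right)
    also have "\<dots> \<le> (L * (1 / c)) * (c * B)"
    proof (intro mult_mono \<rho>(3))
      have "norm (\<eta> x - \<eta> y) \<le> L * \<bar>x - y\<bar>" by (rule \<eta>(3))
      also have "\<dots> \<le> L * (1 / c)" using x \<open>0 \<le> L\<close> by (intro mult_left_mono) auto
      finally show "norm (\<eta> x - \<eta> y) \<le> L * (1 / c)" .
    qed (use \<open>0 < c\<close> \<open>0 \<le> L\<close> in auto)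
    finally show "norm (?f x - \<eta> y * dilation c \<rho> (y - x)) \<le> L * B" using \<open>0 < c\<close> by simp
  qed (use \<open>0 < c\<close> in auto)
  then show ?thesis using int by (simp add: field_simps)
qed

section \<open>A kernel with vanishing moments\<close>

text \<open>The derivatives of \<open>exp (-1 / (1 - x^2))\<close> are of this form with a suitable polynomial \<open>P\<close> and exponent
\<open>k\<close>; \<open>bump_step\<close> below gives the polynomial of the next derivative.\<close>

definition bump_derivative :: "real poly \<Rightarrow> nat \<Rightarrow> real \<Rightarrow> real" where
  "bump_derivative P k x =
    (if \<bar>x\<bar> < 1 then poly P x * inverse (1 - x\<^sup>2) ^ k * exp (- inverse (1 - x\<^sup>2)) else 0)"

text \<open>The exponential series gives \<open>u^(-k-2) exp (-1/u) \<le> (k+2)!\<close> for \<open>u = 1 - y^2 > 0\<close>, hence the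
function is at most a multiple of \<open>u^2\<close>, and \<open>u\<close> is at most twice the distance of \<open>y\<close> to any point
outside the open interval. This quadratic bound makes the derivative vanish there, in
particular at \<open>1\<close> and \<open>-1\<close>.\<close>

lemma bump_derivative_bound:
  obtains C where "0 \<le> C" and "\<And>x y. 1 \<le> \<bar>x\<bar> \<Longrightarrow> \<bar>bump_derivative P k y\<bar> \<le> C * \<bar>y - x\<bar>\<^sup>2"
proof -
  have "bounded (poly P ` {-1..1})"
    by (intro compact_imp_bounded compact_continuous_image continuous_intros) auto
  then obtain B where "0 < B" "\<forall>z\<in>poly P ` {-1..1}. norm z \<le> B"
    unfolding bounded_pos by metis
  then have B: "0 < B" "\<And>x. x \<in> {-1..1} \<Longrightarrow> \<bar>poly P x\<bar> \<le> B"
    by auto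
  have "\<bar>bump_derivative P k y\<bar> \<le> (4 * B * fact (k + 2)) * \<bar>y - x\<bar>\<^sup>2" if x: "1 \<le> \<bar>x\<bar>" for x y
  proof (cases "\<bar>y\<bar> < 1")
    case True
    define u where "u = 1 - y\<^sup>2"
    have u: "0 < u" using True by (simp add: u_def abs_square_less_1)
    have "u = (1 - \<bar>y\<bar>) * (1 + \<bar>y\<bar>)" by (simp add: u_def power2_eq_square algebra_simps)
    also have "\<dots> \<le> \<bar>y - x\<bar> * 2" using True x by (intro mult_mono) auto
    finally have u2: "u\<^sup>2 \<le> (2 * \<bar>y - x\<bar>)\<^sup>2" using u by (intro power_mono) auto
    define F :: real where "F = fact (k + 2)"
    have F: "0 < F" unfolding F_def by (rule fact_gt_zero)
    have "inverse u ^ (k + 2) / F \<le> exp (inverse u)"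
      using sum_le_suminf[OF summable_exp, of "{k + 2}" "inverse u"] u
      by (simp add: exp_def F_def divide_inverse mult.commute del: fact_Suc add_2_eq_Suc' power_inverse)
    then have "inverse u ^ (k + 2) \<le> exp (inverse u) * F"
      using F by (simp add: pos_divide_le_eq del: add_2_eq_Suc')
    then have "inverse u ^ (k + 2) * exp (- inverse u) \<le> exp (inverse u) * F * exp (- inverse u)"
      by (intro mult_right_mono) auto
    also have "\<dots> = F" by (simp add: exp_minus)
    finally have le: "u\<^sup>2 * (inverse u ^ (k + 2) * exp (- inverse u)) \<le> u\<^sup>2 * F"
      by (intro mult_left_mono) auto
    have eq: "u\<^sup>2 * inverse u ^ (k + 2) = inverse u ^ k"
    proof -
      have "u\<^sup>2 * inverse u ^ (k + 2) = inverse u ^ k * (u * inverse u)\<^sup>2"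
        by (simp only: power_add power_mult_distrib mult_ac)
      then show ?thesis using u by simp
    qed
    have "inverse u ^ k * exp (- inverse u) \<le> F * u\<^sup>2"
      using le unfolding mult.assoc [symmetric] eq by (simp only: mult.commute)
    also have "\<dots> \<le> F * (2 * \<bar>y - x\<bar>)\<^sup>2"
      using u2 F by (intro mult_left_mono) auto
    finally have e: "inverse u ^ k * exp (- inverse u) \<le> F * (2 * \<bar>y - x\<bar>)\<^sup>2" .
    have "\<bar>bump_derivative P k y\<bar> = \<bar>poly P y\<bar> * (inverse u ^ k * exp (- inverse u))"
      using True u by (simp add: bump_derivative_def abs_mult mult.assoc u_def)
    also have "\<dots> \<le> B * (F * (2 * \<bar>y - x\<bar>)\<^sup>2)"
      using True B u by (intro mult_mono e B) auto
    finally show ?thesis unfolding F_def [symmetric] power_mult_distrib by (simp add: mult_ac)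
  qed (use B(1) in \<open>simp add: bump_derivative_def\<close>)
  with B(1) show thesis by (intro that[of "4 * B * fact (k + 2)"]) auto
qed

lemma has_vector_derivative_zeroI:
  fixes f :: "real \<Rightarrow> real"
  assumes "f x = 0" and "\<And>y. \<bar>f y\<bar> \<le> C * \<bar>y - x\<bar>\<^sup>2"
  shows "(f has_vector_derivative 0) (at x)"
proof -
  have "((\<lambda>h. f (x + h) / h) \<longlongrightarrow> 0) (at 0)"
  proof (rule Lim_null_comparison)
    show "\<forall>\<^sub>F h in at 0. norm (f (x + h) / h) \<le> C * \<bar>h\<bar>"
    proof (rule always_eventually, rule allI)
      fix h show "norm (f (x + h) / h) \<le> C * \<bar>h\<bar>"
        using assms(2)[of "x + h"] by (cases "h = 0") (simp_all add: field_simps power2_eq_square abs_mult)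
    qed
    show "((\<lambda>h. C * \<bar>h\<bar>) \<longlongrightarrow> 0) (at 0)"
      by (auto intro!: tendsto_eq_intros)
  qed
  then have "(f has_real_derivative 0) (at x)"
    using assms(1) by (simp add: DERIV_def)
  then show ?thesis by (simp add: has_real_derivative_iff_has_vector_derivative)
qed

abbreviation bump_step :: "nat \<Rightarrow> real poly \<Rightarrow> real poly" where
  "bump_step k P \<equiv> pderiv P * [:1, 0, -1:]\<^sup>2 + smult (2 * real k) ([:0, 1:] * P * [:1, 0, -1:]) - smult 2 ([:0, 1:] * P)"

lemma bump_derivative_has_derivative:
  "(bump_derivative P k has_vector_derivative bump_derivative (bump_step k P) (k + 2) x) (at x)"
proof (cases "\<bar>x\<bar> < 1")
  case False
  obtain C where C: "\<And>x y. 1 \<le> \<bar>x\<bar> \<Longrightarrow> \<bar>bump_derivative P k y\<bar> \<le> C * \<bar>y - x\<bar>\<^sup>2"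
    using bump_derivative_bound by metis
  have "(bump_derivative P k has_vector_derivative 0) (at x)"
  proof (rule has_vector_derivative_zeroI[where C = C])
    show "bump_derivative P k x = 0" using False by (simp add: bump_derivative_def)
    show "\<bar>bump_derivative P k y\<bar> \<le> C * \<bar>y - x\<bar>\<^sup>2" for y using False by (intro C) simp
  qed
  with False show ?thesis by (simp add: bump_derivative_def)
next
  case True
  define v where "v x = inverse (1 - x\<^sup>2)" for x :: real
  have nz: "1 - x\<^sup>2 \<noteq> 0" using True abs_square_less_1[of x] by auto
  have v: "(v has_real_derivative 2 * x * v x ^ 2) (at x)"
    unfolding v_def[abs_def] using nz
    by (auto intro!: derivative_eq_intros simp: power2_eq_square field_simps)
  have vk: "((\<lambda>x. v x ^ k) has_real_derivative 2 * real k * x * v x ^ (k + 1)) (at x)"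
  proof (cases k)
    case (Suc l)
    then show ?thesis
      using DERIV_power[OF v, of k] by (simp add: power2_eq_square algebra_simps)
  qed simp
  have uv: "(1 - x\<^sup>2) * v x = 1" using nz by (simp add: v_def)
  have "((\<lambda>x. poly P x * v x ^ k * exp (- v x)) has_real_derivative
      (poly (pderiv P) x * v x ^ k + 2 * real k * x * v x ^ (k + 1) * poly P x) * exp (- v x) +
      exp (- v x) * (- (2 * x * v x ^ 2)) * (poly P x * v x ^ k)) (at x)"
    by (intro DERIV_mult DERIV_fun_exp DERIV_minus v vk poly_DERIV)
  moreover have "(poly (pderiv P) x * v x ^ k + 2 * real k * x * v x ^ (k + 1) * poly P x) * exp (- v x) +
      exp (- v x) * (- (2 * x * v x ^ 2)) * (poly P x * v x ^ k) =
      poly (bump_step k P) x * v x ^ (k + 2) * exp (- v x)"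
  proof -
    have "(1 - x\<^sup>2)\<^sup>2 * v x ^ (k + 2) = ((1 - x\<^sup>2) * v x)\<^sup>2 * v x ^ k"
      by (simp only: power_add power_mult_distrib mult_ac)
    then have 1: "v x ^ k = (1 - x\<^sup>2)\<^sup>2 * v x ^ (k + 2)" by (simp only: uv) simp
    have "(1 - x\<^sup>2) * v x ^ (k + 2) = ((1 - x\<^sup>2) * v x) * v x ^ (k + 1)"
      by simp
    then have 2: "v x ^ (k + 1) = (1 - x\<^sup>2) * v x ^ (k + 2)" by (simp only: uv mult_1_left)
    have 3: "v x ^ 2 * v x ^ k = v x ^ (k + 2)" by (simp only: power_add mult.commute)
    have "(p' * w + c * x * w' * p) * e + e * (- (2 * x * y)) * (p * w) =
        (p' * u\<^sup>2 + c * (x * p * u) - 2 * (x * p)) * z * e"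
      if "w = u\<^sup>2 * z" "w' = u * z" "y * w = z" for p' w c w' p e y u z :: real
      using that by algebra
    from this[OF 1 2 3, of "poly (pderiv P) x" "2 * real k" "poly P x" "exp (- v x)"] show ?thesis
      by (simp add: power2_eq_square algebra_simps)
  qed
  ultimately have "((\<lambda>x. poly P x * v x ^ k * exp (- v x)) has_vector_derivative
      bump_derivative (bump_step k P) (k + 2) x) (at x)"
    using True by (simp add: bump_derivative_def v_def has_real_derivative_iff_has_vector_derivative)
  then show ?thesis
    by (rule has_vector_derivative_transform_within_open[where S = "{-1<..<1}"])
      (use True in \<open>auto simp: bump_derivative_def v_def abs_less_iff\<close>)
qed

primrec bump_poly :: "nat \<Rightarrow> real poly" where
  "bump_poly 0 = 1"
| "bump_poly (Suc n) = bump_step (2 * n) (bump_poly n)"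

lemma test_function_exists:
  obtains \<rho> :: "real \<Rightarrow> 'k::{real_normed_field,euclidean_space}"
  where "\<rho> \<in> test_functions_on {-1..1}" and "integral {-1..1} \<rho> = 1"
proof -
  define \<beta> where "\<beta> = bump_derivative 1 0"
  have "smooth \<beta>"
  proof (rule smooth_derivative_sequence(1)[where G = "\<lambda>n. bump_derivative (bump_poly n) (2 * n)"])
    show "bump_derivative (bump_poly 0) (2 * 0) x = \<beta> x" for x by (simp add: \<beta>_def)
    show "(bump_derivative (bump_poly n) (2 * n) has_vector_derivative
        bump_derivative (bump_poly (Suc n)) (2 * Suc n) x) (at x)" for n x
      using bump_derivative_has_derivative[of "bump_poly n" "2 * n" x] by simp
  qed
  then have cont: "continuous_on {-1..1} \<beta>" using smooth_continuous[of \<beta> _ 0] by simp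
  define I where "I = integral {-1..1} \<beta>"
  have "I \<noteq> 0"
    unfolding I_def
    by (subst integral_eq_0_iff[OF cont]) (auto simp: \<beta>_def bump_derivative_def intro!: bexI[of _ 0])
  have lin: "bounded_linear (\<lambda>r. of_real (r / I) :: 'k)"
    by (rule bounded_linear_compose[OF bounded_linear_of_real bounded_linear_divide])
  show thesis
  proof (rule that)
    show "(\<lambda>x. of_real (\<beta> x / I) :: 'k) \<in> test_functions_on {-1..1}"
      using smooth_bounded_linear[OF lin \<open>smooth \<beta>\<close>]
      by (auto simp: test_functions_on_iff \<beta>_def bump_derivative_def)
    have "integral {-1..1} ((\<lambda>r. of_real (r / I) :: 'k) \<circ> \<beta>) = of_real (integral {-1..1} \<beta> / I)"
      by (rule integral_linear[OF integrable_continuous_real[OF cont] lin])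
    then show "integral {-1..1} (\<lambda>x. of_real (\<beta> x / I) :: 'k) = 1"
      using \<open>I \<noteq> 0\<close> by (simp add: o_def I_def)
  qed
qed

lemma test_function_continuous: "\<phi> \<in> test_functions_on K \<Longrightarrow> continuous_on S \<phi>"
  using smooth_continuous[of \<phi> S 0] by (simp add: test_functions_on_def)

text \<open>The antiderivative that vanishes at \<open>-1\<close> vanishes to the right of \<open>1\<close> as well because the
integral is 0.\<close>

lemma test_function_antiderivative:
  fixes \<theta> :: "real \<Rightarrow> 'k::{real_normed_field,euclidean_space}"
  assumes \<theta>: "\<theta> \<in> test_functions_on {-1..1}" and int: "integral {-1..1} \<theta> = 0"
  obtains \<Theta> where "\<Theta> \<in> test_functions_on {-1..1}" and "nvd 1 \<Theta> = \<theta>"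
proof -
  have sm: "smooth \<theta>" and 0: "\<And>x. x \<notin> {-1..1} \<Longrightarrow> \<theta> x = 0"
    using \<theta> by (auto simp: test_functions_on_iff)
  note cont = test_function_continuous[OF \<theta>]
  obtain H where H: "\<And>x. (H has_vector_derivative \<theta> x) (at x)"
    using antiderivative_exists[OF cont] by metis
  have ftc: "integral {a..b} \<theta> = H b - H a" if "a \<le> b" for a b
    by (rule integral_unique[OF fundamental_theorem_of_calculus[OF that has_vector_derivative_at_within[OF H]]])
  have eq: "integral {a..b} \<theta> = 0" if "a \<le> -1" "1 \<le> b" for a b
  proof -
    have "\<theta> x = 0" if "x \<notin> {a..b}" for x
      by (rule 0) (use that \<open>a \<le> -1\<close> \<open>1 \<le> b\<close> in auto)
    then have "integral {a..b} \<theta> = integral {-1..1} \<theta>"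
      by (rule integral_eq_of_supports[OF cont _ 0])
    then show ?thesis using int by simp
  qed
  define \<Theta> where "\<Theta> x = H x - H (-1)" for x
  define G where "G n = (case n of 0 \<Rightarrow> \<Theta> | Suc n \<Rightarrow> nvd n \<theta>)" for n
  have G: "(G n has_vector_derivative G (Suc n) x) (at x)" for n x
  proof (cases n)
    case 0
    have "((\<lambda>x. H x - H (-1)) has_vector_derivative \<theta> x - 0) (at x)"
      by (intro has_vector_derivative_diff H has_vector_derivative_const)
    with 0 show ?thesis by (simp add: G_def \<Theta>_def[abs_def])
  qed (simp add: G_def smooth_has_derivative[OF sm])
  have G0: "G 0 x = \<Theta> x" for x by (simp add: G_def)
  have "\<Theta> x = 0" if "x \<notin> {-1..1}" for x
  proof (cases "1 \<le> x")
    case True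
    then show ?thesis using ftc[of "-1" x] eq[of "-1" x] by (simp add: \<Theta>_def)
  next
    case False
    then have "x \<le> -1" using that by auto
    then show ?thesis using ftc[of x 1] eq[of x 1] ftc[of "-1" 1] eq[of "-1" 1] by (simp add: \<Theta>_def)
  qed
  then have "\<Theta> \<in> test_functions_on {-1..1}"
    using smooth_derivative_sequence(1)[of G, OF G0 G] by (simp add: test_functions_on_iff)
  moreover have "nvd 1 \<Theta> = \<theta>"
    using smooth_derivative_sequence(2)[of G, OF G0 G, of 1] by (simp add: G_def)
  ultimately show thesis by (rule that)
qed

lemma nvd_dilation:
  "smooth \<phi> \<Longrightarrow> nvd n (dilation c \<phi>) = (\<lambda>x. c ^ n *\<^sub>R dilation c (nvd n \<phi>) x)"
  unfolding dilation_def[abs_def]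
  by (simp only: nvd_scaleR smooth_scaled_argument nvd_scaled_argument scaleR_scaleR mult.commute[of c "c ^ n"])

lemma integral_dilation:
  fixes \<rho> :: "real \<Rightarrow> 'k::{real_normed_field,euclidean_space}"
  assumes \<rho>: "\<rho> \<in> test_functions_on {-1..1}" and "1 \<le> c"
  shows "integral {-1..1} (dilation c \<rho>) = integral {-1..1} \<rho>"
proof -
  note cont = test_function_continuous[OF \<rho>]
  obtain H where H: "\<And>x. (H has_vector_derivative \<rho> x) (at x)"
    using antiderivative_exists[OF cont] by metis
  have deriv: "((\<lambda>x. H (c * x)) has_vector_derivative dilation c \<rho> x) (at x)" for x
  proof -
    have "((\<lambda>x. c * x) has_vector_derivative c) (at x)"
      by (auto intro!: derivative_eq_intros simp flip: has_real_derivative_iff_has_vector_derivative)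
    from vector_diff_chain_at[OF this H] show ?thesis
      by (simp add: o_def dilation_def)
  qed
  have "integral {-1..1} (dilation c \<rho>) = H (c * 1) - H (c * -1)"
    by (rule integral_unique[OF fundamental_theorem_of_calculus[OF _ has_vector_derivative_at_within[OF deriv]]]) simp
  also have "\<dots> = integral {-c..c} \<rho>"
    using assms(2) by (subst integral_unique[OF fundamental_theorem_of_calculus[OF _ has_vector_derivative_at_within[OF H]]]) auto
  also have "\<dots> = integral {-1..1} \<rho>"
    by (rule integral_eq_of_supports[OF cont]) (use assms in \<open>auto simp: test_functions_on_iff\<close>)
  finally show ?thesis .
qed

text \<open>Induction on \<open>k\<close>. For \<open>k = 1\<close> any \<open>\<rho>\<close> of integral 1 works since \<open>dilation 2 \<rho> - \<rho>\<close> has integral 0. Passing from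
\<open>k\<close> to \<open>k + 1\<close>, the new kernel \<open>\<sigma> = a dilation 2 \<rho> + b \<rho>\<close> is such that \<open>dilation 2 \<sigma> - \<sigma>\<close> is the \<open>k\<close>-th derivative of
\<open>\<omega> = (a / 2^k) dilation 2 \<theta> + b \<theta>\<close>. The condition \<open>a + b = 1\<close> keeps the integral of the kernel equal
to 1, and \<open>a / 2^k + b = 0\<close> makes the integral of \<open>\<omega>\<close> vanish, so that \<open>\<omega>\<close> is a derivative of a
test function. These two equations are solvable since \<open>2^k \<noteq> 1\<close>.\<close>

lemma kernel_exists:
  fixes k :: nat
  assumes "1 \<le> k"
  obtains \<rho> \<theta> :: "real \<Rightarrow> 'k::{real_normed_field,euclidean_space}"
  where "\<rho> \<in> test_functions_on {-1..1}" and "\<theta> \<in> test_functions_on {-1..1}"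
    and "integral {-1..1} \<rho> = 1" and "\<And>x. dilation 2 \<rho> x - \<rho> x = nvd k \<theta> x"
proof -
  let ?V = "test_functions_on {-1..1} :: (real \<Rightarrow> 'k) set"
  note V = function_subspaceD[OF function_subspace_test_on[OF closed_atLeastAtMost, of "-1" 1]]
  have int: "(f has_integral integral {-1..1} f) {-1..1}" if "f \<in> ?V" for f
    using that by (intro integrable_integral integrable_continuous_real test_function_continuous)
  have dil: "dilation 2 f \<in> ?V" if "f \<in> ?V" for f
    using that by (rule dilation_test_on) simp
  have "\<exists>\<rho>\<in>?V. \<exists>\<theta>\<in>?V. integral {-1..1} \<rho> = 1 \<and> (\<forall>x. dilation 2 \<rho> x - \<rho> x = nvd k \<theta> x)"
    using assms
  proof (induction k rule: dec_induct)
    case base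
    obtain \<rho> :: "real \<Rightarrow> 'k" where \<rho>: "\<rho> \<in> ?V" "integral {-1..1} \<rho> = 1"
      using test_function_exists by metis
    have "integral {-1..1} (\<lambda>x. dilation 2 \<rho> x - \<rho> x) = integral {-1..1} (dilation 2 \<rho>) - integral {-1..1} \<rho>"
      by (intro integral_unique has_integral_diff int \<rho> dil)
    then have "integral {-1..1} (\<lambda>x. dilation 2 \<rho> x - \<rho> x) = 0"
      using integral_dilation[OF \<rho>(1), of 2] by simp
    from test_function_antiderivative[OF V(6)[OF dil[OF \<rho>(1)] \<rho>(1)] this]
    obtain \<theta> where \<theta>: "\<theta> \<in> ?V" "nvd 1 \<theta> = (\<lambda>x. dilation 2 \<rho> x - \<rho> x)" by metis
    show ?case
      by (intro bexI[of _ \<rho>] bexI[of _ \<theta>] conjI) (simp_all add: \<rho> \<theta> del: One_nat_def)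
  next
    case (step k)
    then obtain \<rho> \<theta> where \<rho>: "\<rho> \<in> ?V" "\<theta> \<in> ?V" "integral {-1..1} \<rho> = 1"
      "\<And>x. dilation 2 \<rho> x - \<rho> x = nvd k \<theta> x"
      by blast
    have sm: "smooth \<theta>" using \<rho>(2) by (simp add: test_functions_on_def)
    have "1 < (2::real) ^ k" by (rule one_less_power) (use \<open>1 \<le> k\<close> in auto)
    then have pow: "(2::real) ^ k - 1 \<noteq> 0" "(2::real) ^ k \<noteq> 0" by linarith+
    \<comment> \<open>The solution of \<open>a + b = 1\<close> and \<open>a / 2 ^ k + b = 0\<close>.\<close>
    define a b :: real where "a = 2 ^ k / (2 ^ k - 1)" and "b = - 1 / (2 ^ k - 1)"
    have ab: "a + b = 1" "a / 2 ^ k + b = 0"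
      using pow by (simp_all add: a_def b_def flip: diff_divide_distrib)
    define \<omega> where "\<omega> x = (a / 2 ^ k) *\<^sub>R dilation 2 \<theta> x + b *\<^sub>R \<theta> x" for x
    have \<omega>: "\<omega> \<in> ?V"
      unfolding \<omega>_def[abs_def] by (intro V(2) V(4) dil \<rho>)
    have "integral {-1..1} \<omega> = (a / 2 ^ k) *\<^sub>R integral {-1..1} (dilation 2 \<theta>) + b *\<^sub>R integral {-1..1} \<theta>"
      unfolding \<omega>_def[abs_def] by (intro integral_unique has_integral_add has_integral_cmul int dil \<rho>)
    also have "\<dots> = (a / 2 ^ k + b) *\<^sub>R integral {-1..1} \<theta>"
      using integral_dilation[OF \<rho>(2), of 2] by (simp add: scaleR_add_left)
    also have "\<dots> = 0" by (simp only: ab scaleR_zero_left)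
    finally obtain \<Theta> where \<Theta>: "\<Theta> \<in> ?V" "nvd 1 \<Theta> = \<omega>"
      using test_function_antiderivative[OF \<omega>] by metis
    define \<sigma> where "\<sigma> x = a *\<^sub>R dilation 2 \<rho> x + b *\<^sub>R \<rho> x" for x
    have \<sigma>: "\<sigma> \<in> ?V"
      unfolding \<sigma>_def[abs_def] by (intro V(2) V(4) dil \<rho>)
    have "integral {-1..1} \<sigma> = a *\<^sub>R integral {-1..1} (dilation 2 \<rho>) + b *\<^sub>R integral {-1..1} \<rho>"
      unfolding \<sigma>_def[abs_def] by (intro integral_unique has_integral_add has_integral_cmul int dil \<rho>)
    also have "\<dots> = (a + b) *\<^sub>R 1"
      using integral_dilation[OF \<rho>(1), of 2] \<rho>(3) by (simp add: scaleR_add_left)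
    finally have "integral {-1..1} \<sigma> = 1" by (simp add: ab)
    moreover have "dilation 2 \<sigma> x - \<sigma> x = nvd (Suc k) \<Theta> x" for x
    proof -
      have "dilation 2 \<sigma> x - \<sigma> x = a *\<^sub>R dilation 2 (\<lambda>x. dilation 2 \<rho> x - \<rho> x) x + b *\<^sub>R (dilation 2 \<rho> x - \<rho> x)"
        by (simp add: \<sigma>_def dilation_def algebra_simps)
      also have "\<dots> = a *\<^sub>R dilation 2 (nvd k \<theta>) x + b *\<^sub>R nvd k \<theta> x"
        by (simp only: \<rho>(4))
      also have "\<dots> = nvd k \<omega> x"
      proof -
        have smd: "smooth (dilation 2 \<theta>)" using dil[OF \<rho>(2)] by (simp add: test_functions_on_def)
        show ?thesis
          unfolding \<omega>_def[abs_def]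
          by (simp add: nvd_add nvd_scaleR smooth_scaleR sm smd nvd_dilation[OF sm])
      qed
      also have "\<dots> = nvd (Suc k) \<Theta> x"
        using nvd_nvd[of k 1 \<Theta>] unfolding \<Theta>(2) by simp
      finally show ?thesis .
    qed
    ultimately show ?case using \<sigma> \<Theta>(1) by (intro bexI[of _ \<sigma>] bexI[of _ \<Theta>]) auto
  qed
  then show thesis using that by blast
qed

section \<open>The reproducing series\<close>

context banach_space_over
begin

text \<open>The partial sums telescope to \<open>T (\<eta> * dilation (2 ^ J) \<rho>) - T (\<eta> * \<rho>)\<close>: the difference of two consecutive
dilates of \<open>\<rho>\<close> is a multiple of the \<open>M\<close>-th derivative of \<open>\<theta>(2^J \<cdot>)\<close>, and this derivative is moved to
\<open>\<eta>\<close> by integration by parts.\<close>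

lemma reproducing_series:
  fixes \<eta> \<rho> \<theta> :: "real \<Rightarrow> 'k"
  assumes T: "T \<in> distributions smul" and \<eta>: "\<eta> \<in> test_functions"
    and R: "0 < R" "\<And>n x. R \<le> \<bar>x\<bar> \<Longrightarrow> nvd n \<eta> x = 0"
    and \<rho>: "\<rho> \<in> test_functions_on {-1..1}" and \<theta>: "\<theta> \<in> test_functions_on {-1..1}"
    and int: "integral {-1..1} \<rho> = 1" and kernel: "\<And>x. dilation 2 \<rho> x - \<rho> x = nvd M \<theta> x"
  shows "(\<lambda>J. (2 ^ J / 2 ^ (J * M)) *\<^sub>R T (conv_on (-R) R (nvd M \<eta>) (\<lambda>x. \<theta> (2 ^ J * x))))
    sums (T \<eta> - T (conv_on (-R) R \<eta> \<rho>))"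
proof -
  note lin = linear_functional_onD[OF distribution_linear[OF T] function_subspace_test]
  note test1 = subsetD[OF test_functions_on_subset[OF compact_Icc, of "-1" 1]]
  have sm\<eta>: "smooth \<eta>" using \<eta> by (rule test_function_smooth)
  have cont\<eta>: "continuous_on UNIV \<eta>" using smooth_continuous[OF sm\<eta>, of _ 0] by simp
  have sm\<theta>: "smooth \<theta>" using \<theta> by (simp add: test_functions_on_def)
  define \<rho>' where "\<rho>' J = dilation (2 ^ J) \<rho>" for J :: nat
  have \<rho>': "\<rho>' J \<in> test_functions_on {-1..1}" for J
    unfolding \<rho>'_def by (rule dilation_test_on[OF \<rho>]) simp
  obtain B where B: "0 < B" "\<And>x. norm (\<rho> x) \<le> B"
    using test_function_boundedE[OF test1[OF \<rho>], of 0] by auto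
  have "(\<lambda>J. T (conv_on (-R) R \<eta> (\<rho>' J))) \<longlonglongrightarrow> T \<eta>"
  proof (rule distribution_tendsto[OF T, where K = "{-R + -1..R + 1}"])
    show "\<forall>\<^sub>F J in sequentially. conv_on (-R) R \<eta> (\<rho>' J) \<in> test_functions_on {-R + -1..R + 1}"
      by (intro always_eventually allI conv_on_test_on cont\<eta> \<rho>')
    have "\<eta> x = 0" if "x \<notin> {-R + -1..R + 1}" for x
      using R(2)[of x 0] that by auto
    then show "\<eta> \<in> test_functions_on {-R + -1..R + 1}"
      using sm\<eta> by (simp add: test_functions_on_iff del: atLeastAtMost_iff)
    fix j
    obtain L where L: "0 < L" "\<And>x y. norm (nvd j \<eta> x - nvd j \<eta> y) \<le> L * \<bar>x - y\<bar>"
      using test_function_lipschitz[OF \<eta>] by metis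
    have bound: "dist (nvd j (conv_on (-R) R \<eta> (\<rho>' J)) y) (nvd j \<eta> y) \<le> 2 * B * L * (1 / 2) ^ J" for J y
    proof -
      have "nvd j (conv_on (-R) R \<eta> (\<rho>' J)) = conv_on (-R) R \<eta> (nvd j (\<rho>' J))"
        using \<rho>'[of J] by (intro nvd_conv_on cont\<eta>) (simp add: test_functions_on_def)
      also have "\<dots> = conv_on (-R) R (nvd j \<eta>) (\<rho>' J)"
        using \<rho>'[of J] R by (intro conv_on_nvd_swap sm\<eta>) (simp_all add: test_functions_on_def)
      finally show ?thesis
        using approximate_identity[OF \<rho> int B(2) smooth_continuous[OF sm\<eta>] R(2) L(2), where c = "2 ^ J" and y = y] L(1)
        by (simp add: \<rho>'_def dist_norm power_one_over)
    qed
    have lim: "(\<lambda>J. 2 * B * L * (1 / 2) ^ J) \<longlonglongrightarrow> 0"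
      by (intro tendsto_mult_right_zero LIMSEQ_power_zero) simp
    show "uniform_limit UNIV (\<lambda>J. nvd j (conv_on (-R) R \<eta> (\<rho>' J))) (nvd j \<eta>) sequentially"
    proof (rule uniform_limitI)
      fix e :: real assume "0 < e"
      from order_tendstoD(2)[OF lim this]
      show "\<forall>\<^sub>F J in sequentially. \<forall>y\<in>UNIV. dist (nvd j (conv_on (-R) R \<eta> (\<rho>' J)) y) (nvd j \<eta> y) < e"
        by eventually_elim (use bound le_less_trans in blast)
    qed
  qed simp
  moreover have "T (conv_on (-R) R \<eta> (\<rho>' (Suc J))) - T (conv_on (-R) R \<eta> (\<rho>' J)) =
      (2 ^ J / 2 ^ (J * M)) *\<^sub>R T (conv_on (-R) R (nvd M \<eta>) (\<lambda>x. \<theta> (2 ^ J * x)))" for J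
  proof -
    let ?\<theta> = "\<lambda>x. \<theta> (2 ^ J * x)"
    have \<theta>J: "?\<theta> \<in> test_functions_on {-1..1}" by (rule test_on_scaled_argument[OF \<theta>]) simp
    have sm\<theta>J: "smooth ?\<theta>" by (rule smooth_scaled_argument[OF sm\<theta>])
    have diff: "(\<lambda>x. \<rho>' (Suc J) x - \<rho>' J x) = (\<lambda>x. (2 ^ J / 2 ^ (J * M)) *\<^sub>R nvd M ?\<theta> x)"
    proof
      fix x
      have "\<rho>' (Suc J) x - \<rho>' J x = 2 ^ J *\<^sub>R (dilation 2 \<rho> (2 ^ J * x) - \<rho> (2 ^ J * x))"
        by (simp add: \<rho>'_def dilation_def scaleR_diff_right mult_ac)
      also have "\<dots> = (2 ^ J / 2 ^ (J * M)) *\<^sub>R nvd M ?\<theta> x"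
        unfolding kernel nvd_scaled_argument[OF sm\<theta>] by (simp add: power_mult)
      finally show "\<rho>' (Suc J) x - \<rho>' J x = (2 ^ J / 2 ^ (J * M)) *\<^sub>R nvd M ?\<theta> x" .
    qed
    have "T (conv_on (-R) R \<eta> (\<rho>' (Suc J))) - T (conv_on (-R) R \<eta> (\<rho>' J)) =
        T (conv_on (-R) R \<eta> (\<lambda>x. \<rho>' (Suc J) x - \<rho>' J x))"
      unfolding conv_on_diff[OF cont\<eta> test_function_continuous[OF \<rho>'] test_function_continuous[OF \<rho>']]
      by (rule lin(4)[symmetric]) (intro conv_on_test cont\<eta> test1 \<rho>')+
    also have "\<dots> = T (\<lambda>y. (2 ^ J / 2 ^ (J * M)) *\<^sub>R conv_on (-R) R \<eta> (nvd M ?\<theta>) y)"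
      unfolding diff conv_on_scaleR ..
    also have "\<dots> = (2 ^ J / 2 ^ (J * M)) *\<^sub>R T (conv_on (-R) R \<eta> (nvd M ?\<theta>))"
      by (intro lin(3) conv_on_test cont\<eta> test_functions_nvd test1 \<theta>J)
    also have "conv_on (-R) R \<eta> (nvd M ?\<theta>) = conv_on (-R) R (nvd M \<eta>) ?\<theta>"
      using R by (intro conv_on_nvd_swap sm\<eta> sm\<theta>J) auto
    finally show ?thesis .
  qed
  moreover have "\<rho>' 0 = \<rho>" by (simp add: \<rho>'_def dilation_def fun_eq_iff)
  ultimately show ?thesis
    using telescope_sums[of "\<lambda>J. T (conv_on (-R) R \<eta> (\<rho>' J))" "T \<eta>"] by simp
qed

lemma bounded_bilinear_smul: "bounded_bilinear smul"
proof
  show "\<exists>K. \<forall>a b. norm (smul a b) \<le> norm a * norm b * K"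
    by (intro exI[of _ 1]) (simp add: norm_scale)
  show "smul (r *\<^sub>R a) b = r *\<^sub>R smul a b" for r a b
    by (simp add: scaleR_conv_of_real scale_of_real flip: scale_scale)
  show "smul a (r *\<^sub>R b) = r *\<^sub>R smul a b" for r a b
    using scale_left_commute[of a "of_real r" b] unfolding scale_of_real .
qed (simp_all add: scale_left_distrib scale_right_distrib)

lemma continuous_on_smul:
  "continuous_on S f \<Longrightarrow> continuous_on S g \<Longrightarrow> continuous_on S (\<lambda>x. smul (f x) (g x))"
  by (rule bounded_bilinear.continuous_on[OF bounded_bilinear_smul])

end

section \<open>Functions of polynomial growth\<close>

lemma abs_power_le_weight: "\<bar>x\<bar> ^ n \<le> weight n x"
  unfolding weight_power by (intro power_mono) (auto intro: real_le_rsqrt)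

text \<open>Continuity turns the growth condition at infinity into a bound on the whole line, with a weight
that does not vanish at 0.\<close>

lemma poly_growth_iff:
  "F \<in> poly_growth \<longleftrightarrow> continuous_on UNIV F \<and> (\<exists>C n. 0 \<le> C \<and> (\<forall>x. norm (F x) \<le> C * weight n x))"
proof (intro iffI conjI)
  assume F: "F \<in> poly_growth"
  then show cont: "continuous_on UNIV F" by (simp add: poly_growth_def)
  obtain n where "(\<lambda>x. norm (F x)) \<in> O[at_infinity](\<lambda>x. \<bar>x\<bar> ^ n)"
    using F by (auto simp: poly_growth_def)
  then obtain c where c: "0 < c" "\<forall>\<^sub>F x in at_infinity. norm (norm (F x)) \<le> c * norm (\<bar>x\<bar> ^ n)"
    by (rule landau_o.bigE)
  then obtain b where b: "\<And>x. b \<le> norm x \<Longrightarrow> norm (F x) \<le> c * \<bar>x\<bar> ^ n"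
    by (auto simp: eventually_at_infinity)
  have "bounded (F ` {-b..b})"
    by (intro compact_imp_bounded compact_continuous_image continuous_on_subset[OF cont]) auto
  then obtain B where "0 < B" "\<forall>z\<in>F ` {-b..b}. norm z \<le> B" unfolding bounded_pos by metis
  then have B: "0 < B" "\<And>x. x \<in> {-b..b} \<Longrightarrow> norm (F x) \<le> B" by auto
  have "norm (F x) \<le> (c + B) * weight n x" for x
  proof (cases "b \<le> norm x")
    case True
    have "norm (F x) \<le> c * \<bar>x\<bar> ^ n" by (rule b[OF True])
    also have "\<dots> \<le> (c + B) * weight n x"
      using c(1) B(1) by (intro mult_mono abs_power_le_weight) auto
    finally show ?thesis .
  next
    case False
    then have "x \<in> {-b..b}" by (auto simp: not_le abs_less_iff)
    then have "norm (F x) \<le> B * 1" using B(2) by simp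
    also have "\<dots> \<le> (c + B) * weight n x"
      using c(1) B(1) by (intro mult_mono weight_ge_1) auto
    finally show ?thesis .
  qed
  then show "\<exists>C n. 0 \<le> C \<and> (\<forall>x. norm (F x) \<le> C * weight n x)"
    using c(1) B(1) by (intro exI[of _ "c + B"] exI[of _ n]) auto
next
  assume "continuous_on UNIV F \<and> (\<exists>C n. 0 \<le> C \<and> (\<forall>x. norm (F x) \<le> C * weight n x))"
  then obtain C n where cont: "continuous_on UNIV F" and C: "0 \<le> C" "\<And>x. norm (F x) \<le> C * weight n x"
    by blast
  have "(\<lambda>x. norm (F x)) \<in> O[at_infinity](\<lambda>x. \<bar>x\<bar> ^ n)"
  proof (rule bigoI)
    have "norm (norm (F x)) \<le> C * 2 ^ n * norm (\<bar>x\<bar> ^ n)" if "1 \<le> norm x" for x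
    proof -
      have "1 \<le> x\<^sup>2" using that by (simp add: abs_le_square_iff[of 1, simplified])
      then have "sqrt (1 + x\<^sup>2) \<le> 2 * \<bar>x\<bar>"
        by (intro real_le_lsqrt) (auto simp: power_mult_distrib)
      then have "weight n x \<le> (2 * \<bar>x\<bar>) ^ n"
        unfolding weight_power by (intro power_mono) auto
      then have "C * weight n x \<le> C * (2 * \<bar>x\<bar>) ^ n" using C(1) by (rule mult_left_mono)
      with C(2)[of x] have "norm (F x) \<le> C * (2 * \<bar>x\<bar>) ^ n" by (rule order_trans)
      then show ?thesis by (simp add: power_mult_distrib mult.assoc)
    qed
    then show "\<forall>\<^sub>F x in at_infinity. norm (norm (F x)) \<le> C * 2 ^ n * norm (\<bar>x\<bar> ^ n)"
      by (auto simp: eventually_at_infinity)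
  qed
  with cont show "F \<in> poly_growth" by (auto simp: poly_growth_def)
qed

lemma poly_growth_antiderivative:
  fixes G :: "real \<Rightarrow> 'x::banach"
  assumes "G \<in> poly_growth"
  obtains F where "F \<in> poly_growth" and "\<And>x. (F has_vector_derivative G x) (at x)"
proof -
  have cont: "continuous_on UNIV G" using assms by (simp add: poly_growth_iff)
  obtain C n where C: "0 \<le> C" "\<And>x. norm (G x) \<le> C * weight n x"
    using assms by (auto simp: poly_growth_iff)
  obtain F where F: "F 0 = 0" "\<And>x. (F has_vector_derivative G x) (at x)"
    using antiderivative_exists[OF cont] by metis
  have "continuous_on UNIV F"
    using F(2) by (meson continuous_at_imp_continuous_on has_vector_derivative_continuous)
  moreover have "norm (F x) \<le> C * weight (n + 1) x" for x
  proof -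
    have "norm (F x - F 0) \<le> C * weight n x * norm (x - 0)"
    proof (rule differentiable_bound[where S = "{-\<bar>x\<bar>..\<bar>x\<bar>}"])
      show "(F has_derivative (\<lambda>h. h *\<^sub>R G y)) (at y within {-\<bar>x\<bar>..\<bar>x\<bar>})" for y
        using has_vector_derivative_at_within[OF F(2)] by (simp add: has_vector_derivative_def)
      show "onorm (\<lambda>h. h *\<^sub>R G y) \<le> C * weight n x" if "y \<in> {-\<bar>x\<bar>..\<bar>x\<bar>}" for y
      proof (rule onorm_le)
        have "weight n y \<le> weight n \<bar>x\<bar>" using that by (intro weight_le) auto
        also have "weight n \<bar>x\<bar> = weight n x" by (simp add: weight_def)
        finally have "norm (G y) \<le> C * weight n x"
          using C(1) by (intro order_trans[OF C(2)] mult_left_mono)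
        then show "norm (h *\<^sub>R G y) \<le> C * weight n x * norm h" for h
          by (simp add: mult.commute[of _ "\<bar>h\<bar>"] mult_left_mono)
      qed
    qed auto
    also have "\<dots> \<le> C * weight n x * weight 1 x"
      using C(1) abs_power_le_weight[of x 1] by (intro mult_left_mono) (auto simp: less_imp_le)
    finally show ?thesis by (simp only: F(1) weight_add mult.assoc diff_0_right)
  qed
  ultimately have "F \<in> poly_growth" using C(1) by (auto simp: poly_growth_iff)
  then show thesis using F(2) by (rule that)
qed

lemma weighted_norm_translate:
  assumes "\<phi> \<in> schwartz_functions"
  shows "weighted_norm k m (\<lambda>y. \<phi> (y - x)) \<le> real (Suc m) * (2 ^ k * weight k x * weighted_norm k m \<phi>)"
proof -
  have "weighted_norm k m (\<lambda>y. \<phi> (y - x)) \<le> (\<Sum>j\<le>m. 2 ^ k * weight k x * weighted_norm k m \<phi>)"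
  proof (rule weighted_norm_le)
    fix j y assume "j \<le> m"
    have "weight k y \<le> 2 ^ k * weight k x * weight k (y - x)"
      using weight_shift[of k x "y - x"] by simp
    then have "weight k y * norm (nvd j \<phi> (y - x)) \<le>
        2 ^ k * weight k x * weight k (y - x) * norm (nvd j \<phi> (y - x))"
      by (intro mult_right_mono) auto
    also have "\<dots> = 2 ^ k * weight k x * (weight k (y - x) * norm (nvd j \<phi> (y - x)))"
      by (simp only: mult.assoc)
    also have "\<dots> \<le> 2 ^ k * weight k x * weighted_norm k m \<phi>"
      by (intro mult_left_mono weighted_norm_ge assms \<open>j \<le> m\<close>) (simp add: less_imp_le)
    finally show "weight k y * norm (nvd j (\<lambda>y. \<phi> (y - x)) y) \<le> 2 ^ k * weight k x * weighted_norm k m \<phi>"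
      by (simp only: nvd_translate[OF schwartz_smooth[OF assms]])
  qed
  then show ?thesis by simp
qed

lemma weighted_norm_scaled_argument:
  assumes "\<phi> \<in> schwartz_functions" and "1 \<le> c"
  shows "weighted_norm k m (\<lambda>x. \<phi> (c * x)) \<le> real (Suc m) * (c ^ m * weighted_norm k m \<phi>)"
proof -
  have "weighted_norm k m (\<lambda>x. \<phi> (c * x)) \<le> (\<Sum>j\<le>m. c ^ m * weighted_norm k m \<phi>)"
  proof (rule weighted_norm_le)
    fix j x assume "j \<le> m"
    have "\<bar>x\<bar> \<le> c * \<bar>x\<bar>" using assms(2) by (simp add: mult_le_cancel_right1)
    then have "weight k x \<le> weight k (c * \<bar>x\<bar>)" by (rule weight_le)
    also have "weight k (c * \<bar>x\<bar>) = weight k (c * x)" by (simp add: weight_def power_mult_distrib)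
    finally have w: "weight k x \<le> weight k (c * x)" .
    have "weight k x * norm (nvd j (\<lambda>x. \<phi> (c * x)) x) = c ^ j * (weight k x * norm (nvd j \<phi> (c * x)))"
      using assms(2) by (simp add: nvd_scaled_argument[OF schwartz_smooth[OF assms(1)]])
    also have "\<dots> \<le> c ^ m * (weight k (c * x) * norm (nvd j \<phi> (c * x)))"
      using assms(2) w \<open>j \<le> m\<close>
      by (intro mult_mono mult_right_mono power_increasing) (auto simp: less_imp_le)
    also have "\<dots> \<le> c ^ m * weighted_norm k m \<phi>"
      using assms(2) by (intro mult_left_mono weighted_norm_ge assms(1) \<open>j \<le> m\<close>) auto
    finally show "weight k x * norm (nvd j (\<lambda>x. \<phi> (c * x)) x) \<le> c ^ m * weighted_norm k m \<phi>" .
  qed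
  then show ?thesis by simp
qed

section \<open>Consequences of a seminorm estimate\<close>

context banach_space_over
begin

lemma function_distribution_interval:
  fixes \<eta> :: "real \<Rightarrow> 'k"
  assumes F: "continuous_on UNIV F" and \<eta>: "continuous_on UNIV \<eta>" "\<And>x. R \<le> \<bar>x\<bar> \<Longrightarrow> \<eta> x = 0"
  shows "function_distribution smul F \<eta> = integral {-R..R} (\<lambda>x. smul (\<eta> x) (F x))"
  unfolding function_distribution_def
proof (rule integral_unique[OF has_integral_UNIV_of_support])
  show "continuous_on {-R..R} (\<lambda>x. smul (\<eta> x) (F x))"
    by (intro continuous_on_smul continuous_on_subset[OF F] continuous_on_subset[OF \<eta>(1)]) auto
  show "smul (\<eta> x) (F x) = 0" if "x \<notin> {-R..R}" for x
    using \<eta>(2)[of x] that by auto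
qed

lemma distribution_convolution:
  fixes \<eta> \<phi> :: "real \<Rightarrow> 'k"
  assumes T: "T \<in> distributions smul" and \<eta>: "continuous_on UNIV \<eta>" and \<phi>: "\<phi> \<in> test_functions"
    and R: "0 < R" "\<And>x. R \<le> \<bar>x\<bar> \<Longrightarrow> \<eta> x = 0"
  shows "function_distribution smul (\<lambda>x. T (\<lambda>y. \<phi> (y - x))) \<eta> = T (conv_on (-R) R \<eta> \<phi>)"
proof -
  have "function_distribution smul (\<lambda>x. T (\<lambda>y. \<phi> (y - x))) \<eta> =
      integral {-R..R} (\<lambda>x. smul (\<eta> x) (T (\<lambda>y. \<phi> (y - x))))"
    by (rule function_distribution_interval[OF distribution_translate_continuous[OF T \<phi>] \<eta> R(2)])
  also have "\<dots> = T (conv_on (-R) R \<eta> \<phi>)"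
    using R(1) by (intro integral_unique distribution_conv_on[OF T \<eta> \<phi>]) simp
  finally show ?thesis .
qed

lemma function_distribution_by_parts:
  fixes \<eta> :: "real \<Rightarrow> 'k"
  assumes F: "\<And>x. (F has_vector_derivative G x) (at x)" and G: "continuous_on UNIV G"
    and \<eta>: "\<eta> \<in> test_functions"
  shows "function_distribution smul G \<eta> = - function_distribution smul F (nvd 1 \<eta>)"
proof -
  obtain R where R: "0 < R" "\<And>n x. R \<le> \<bar>x\<bar> \<Longrightarrow> nvd n \<eta> x = 0"
    using test_function_radius[OF \<eta>] by metis
  have contF: "continuous_on UNIV F"
    using F by (meson continuous_at_imp_continuous_on has_vector_derivative_continuous)
  note sm = test_function_smooth[OF \<eta>]
  note cont\<eta> = smooth_continuous[OF sm]
  have "((\<lambda>x. smul (\<eta> x) (G x) + smul (nvd 1 \<eta> x) (F x)) has_integral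
      (smul (\<eta> R) (F R) - smul (\<eta> (-R)) (F (-R)))) {-R..R}"
  proof (rule fundamental_theorem_of_calculus)
    fix x
    have "(\<eta> has_vector_derivative nvd 1 \<eta> x) (at x within {-R..R})"
      using smooth_has_derivative[OF sm, of 0 x] by (simp add: has_vector_derivative_at_within)
    from bounded_bilinear.has_vector_derivative[OF bounded_bilinear_smul this has_vector_derivative_at_within[OF F]]
    show "((\<lambda>x. smul (\<eta> x) (F x)) has_vector_derivative
        smul (\<eta> x) (G x) + smul (nvd 1 \<eta> x) (F x)) (at x within {-R..R})" .
  qed (use R in auto)
  moreover have "\<eta> R = 0" "\<eta> (-R) = 0" using R(2)[of _ 0] R(1) by auto
  ultimately have "((\<lambda>x. smul (\<eta> x) (G x) + smul (nvd 1 \<eta> x) (F x)) has_integral 0) {-R..R}" by simp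
  moreover have "((\<lambda>x. smul (\<eta> x) (G x) + smul (nvd 1 \<eta> x) (F x)) has_integral
      (integral {-R..R} (\<lambda>x. smul (\<eta> x) (G x)) + integral {-R..R} (\<lambda>x. smul (nvd 1 \<eta> x) (F x)))) {-R..R}"
    using cont\<eta>[of _ 0]
    by (intro has_integral_add integrable_integral integrable_continuous_real continuous_on_smul cont\<eta>
        continuous_on_subset[OF G] continuous_on_subset[OF contF]) auto
  ultimately have "integral {-R..R} (\<lambda>x. smul (\<eta> x) (G x)) + integral {-R..R} (\<lambda>x. smul (nvd 1 \<eta> x) (F x)) = 0"
    by (rule has_integral_unique[symmetric])
  moreover have "function_distribution smul G \<eta> = integral {-R..R} (\<lambda>x. smul (\<eta> x) (G x))"
    using cont\<eta>[of _ 0] R(2)[of _ 0] by (intro function_distribution_interval G) auto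
  moreover have "function_distribution smul F (nvd 1 \<eta>) = integral {-R..R} (\<lambda>x. smul (nvd 1 \<eta> x) (F x))"
    by (intro function_distribution_interval contF cont\<eta> R(2))
  ultimately show ?thesis by (simp add: eq_neg_iff_add_eq_0)
qed

lemma function_distribution_iterated_antiderivative:
  assumes "G \<in> poly_growth"
  shows "\<exists>F\<in>poly_growth. \<forall>\<eta>\<in>test_functions.
    function_distribution smul G \<eta> = distribution_derivative m (function_distribution smul F) \<eta>"
proof (induction m)
  case 0
  show ?case using assms by (intro bexI[of _ G]) (auto simp: distribution_derivative_def)
next
  case (Suc m)
  then obtain F where F: "F \<in> poly_growth" "\<And>\<eta>. \<eta> \<in> test_functions \<Longrightarrow>
      function_distribution smul G \<eta> = distribution_derivative m (function_distribution smul F) \<eta>"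
    by blast
  obtain H where H: "H \<in> poly_growth" "\<And>x. (H has_vector_derivative F x) (at x)"
    using poly_growth_antiderivative[OF F(1)] by metis
  have contF: "continuous_on UNIV F" using F(1) by (simp add: poly_growth_iff)
  have "function_distribution smul G \<eta> = distribution_derivative (Suc m) (function_distribution smul H) \<eta>"
    if \<eta>: "\<eta> \<in> test_functions" for \<eta>
  proof -
    have "nvd 1 (nvd m \<eta>) = nvd (Suc m) \<eta>" by (subst nvd_nvd) simp
    with function_distribution_by_parts[OF H(2) contF test_functions_nvd[OF \<eta>, of m]] F(2)[OF \<eta>]
    show ?thesis by (simp add: distribution_derivative_def)
  qed
  with H(1) show ?case by blast
qed

lemma translate_bound:
  fixes \<phi> :: "real \<Rightarrow> 'k"
  assumes bound: "\<And>\<phi>. \<phi> \<in> test_functions \<Longrightarrow> norm (T \<phi>) \<le> C * weighted_norm N N \<phi>" and "0 \<le> C"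
    and \<phi>: "\<phi> \<in> test_functions"
  shows "norm (T (\<lambda>y. \<phi> (y - x))) \<le> C * (real (Suc N) * (2 ^ N * weight N x * weighted_norm N N \<phi>))"
proof -
  have "norm (T (\<lambda>y. \<phi> (y - x))) \<le> C * weighted_norm N N (\<lambda>y. \<phi> (y - x))"
    by (intro bound test_functions_translate \<phi>)
  also have "\<dots> \<le> C * (real (Suc N) * (2 ^ N * weight N x * weighted_norm N N \<phi>))"
    using assms(2) \<phi> test_functions_subset_schwartz by (intro mult_left_mono weighted_norm_translate) auto
  finally show ?thesis .
qed

lemma translate_poly_growth:
  fixes \<phi> :: "real \<Rightarrow> 'k"
  assumes T: "T \<in> distributions smul"
    and bound: "\<And>\<phi>. \<phi> \<in> test_functions \<Longrightarrow> norm (T \<phi>) \<le> C * weighted_norm N N \<phi>" and "0 \<le> C"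
    and \<phi>: "\<phi> \<in> test_functions"
  shows "(\<lambda>x. T (\<lambda>y. \<phi> (y - x))) \<in> poly_growth"
  unfolding poly_growth_iff
proof (intro conjI exI allI)
  show "continuous_on UNIV (\<lambda>x. T (\<lambda>y. \<phi> (y - x)))"
    by (rule distribution_translate_continuous[OF T \<phi>])
  show "norm (T (\<lambda>y. \<phi> (y - x))) \<le> (C * (real (Suc N) * (2 ^ N * weighted_norm N N \<phi>))) * weight N x" for x
    using translate_bound[OF bound \<open>0 \<le> C\<close> \<phi>, of x] by (simp only: mult_ac)
  have "0 \<le> weighted_norm N N \<phi>"
    using \<phi> test_functions_subset_schwartz by (intro weighted_norm_nonneg) auto
  then show "0 \<le> C * (real (Suc N) * (2 ^ N * weighted_norm N N \<phi>))"
    using \<open>0 \<le> C\<close> by (intro mult_nonneg_nonneg) auto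
qed

text \<open>Convolving with \<open>\<phi>\<close> means applying \<open>T\<close> to the translates of the reflection of \<open>\<phi>\<close>; \<open>0 - z\<close> is written
instead of \<open>- z\<close> to match \<open>test_functions_reflect\<close>.\<close>

lemma convolution_eq_translate:
  fixes \<phi> :: "real \<Rightarrow> 'k"
  shows "convolution T \<phi> = (\<lambda>x. T (\<lambda>y. (\<lambda>z. \<phi> (0 - z)) (y - x)))"
  by (simp add: convolution_def fun_eq_iff)

lemma bounded_imp_poly_growth_distribution:
  assumes T: "T \<in> distributions smul"
    and bound: "\<And>\<phi>. \<phi> \<in> test_functions \<Longrightarrow> norm (T \<phi>) \<le> C * weighted_norm N N \<phi>" and "0 \<le> C"
  shows "T \<in> poly_growth_distributions smul"
proof -
  have "convolution T \<phi> \<in> poly_growth" if "\<phi> \<in> test_functions" for \<phi>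
    unfolding convolution_eq_translate
    using translate_poly_growth[OF T bound \<open>0 \<le> C\<close> test_functions_reflect[OF that, of 0]] .
  then show ?thesis using T by (simp add: poly_growth_distributions_def)
qed

text \<open>The coefficient of the reproducing series for \<open>M = N + 2\<close> against the growth \<open>2^(JN)\<close> of a norm with
\<open>N\<close> derivatives of \<open>\<theta>(2^J \<cdot>)\<close>.\<close>

lemma dyadic_decay: "(2::real) ^ J / 2 ^ (J * (N + 2)) * (2 ^ J) ^ N = (1 / 2) ^ J"
proof -
  have "(2::real) ^ (J * (N + 2)) = (2 ^ J) ^ N * (2 ^ J * 2 ^ J)"
    by (simp add: power_mult power_add power2_eq_square)
  then show ?thesis by (simp add: power_one_over)
qed

text \<open>The estimate makes \<open>x \<mapsto> T (\<lambda>y. \<theta> (2^J (y - x)))\<close> at most \<open>2^(JN)\<close> times a fixed multiple of \<open>weight N x\<close>.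
Hence the series of these functions, with the coefficients of the reproducing series for \<open>M = N + 2\<close>,
converges locally uniformly to a function \<open>F1\<close> of polynomial growth, and
\<open>T \<eta> = T (\<eta> * \<rho>) + \<integral> \<eta>\<^sup>(\<^sup>M\<^sup>) F1\<close>. An \<open>M\<close>-fold antiderivative of \<open>x \<mapsto> T (\<lambda>y. \<rho> (y - x))\<close> brings the first
term into the same form.\<close>

lemma bounded_imp_derivative_of_poly_growth:
  assumes T: "T \<in> distributions smul"
    and bound: "\<And>\<phi>. \<phi> \<in> test_functions \<Longrightarrow> norm (T \<phi>) \<le> C * weighted_norm N N \<phi>" and "0 \<le> C"
  shows "\<exists>F\<in>poly_growth. \<exists>m. \<forall>\<phi>\<in>test_functions.
    T \<phi> = distribution_derivative m (function_distribution smul F) \<phi>"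
proof -
  define M where "M = N + 2"
  have "1 \<le> M" by (simp add: M_def)
  then obtain \<rho> \<theta> :: "real \<Rightarrow> 'k" where \<rho>: "\<rho> \<in> test_functions_on {-1..1}"
    and \<theta>: "\<theta> \<in> test_functions_on {-1..1}" and int: "integral {-1..1} \<rho> = 1"
    and kernel: "\<And>x. dilation 2 \<rho> x - \<rho> x = nvd M \<theta> x"
    by (rule kernel_exists) (rule that)
  note test1 = subsetD[OF test_functions_on_subset[OF compact_Icc, of "-1" 1]]
  have \<theta>J: "(\<lambda>x. \<theta> (2 ^ J * x)) \<in> test_functions" for J :: nat
    by (rule test1[OF test_on_scaled_argument[OF \<theta>]]) simp
  define a :: "nat \<Rightarrow> real" where "a J = 2 ^ J / 2 ^ (J * M)" for J
  have a: "0 \<le> a J" "a J * (2 ^ J) ^ N = (1 / 2) ^ J" for J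
    using dyadic_decay[of J N] by (simp_all only: a_def M_def) simp
  define g where "g J x = T (\<lambda>y. \<theta> (2 ^ J * (y - x)))" for J :: nat and x :: real
  define D where "D = C * (real (Suc N) * (2 ^ N * (real (Suc N) * weighted_norm N N \<theta>)))"
  have \<theta>s: "\<theta> \<in> schwartz_functions" using test1[OF \<theta>] test_functions_subset_schwartz by auto
  have D: "0 \<le> D"
    unfolding D_def using \<open>0 \<le> C\<close> weighted_norm_nonneg[OF \<theta>s] by (intro mult_nonneg_nonneg) auto
  have g_cont: "continuous_on S (g J)" for J S
    unfolding g_def[abs_def] by (rule distribution_translate_continuous[OF T \<theta>J])
  have g_bound: "norm (a J *\<^sub>R g J x) \<le> D * weight N x * (1 / 2) ^ J" for J x
  proof -
    have "norm (g J x) \<le> C * (real (Suc N) * (2 ^ N * weight N x * weighted_norm N N (\<lambda>x. \<theta> (2 ^ J * x))))"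
      unfolding g_def by (rule translate_bound[OF bound \<open>0 \<le> C\<close> \<theta>J])
    also have "\<dots> \<le> C * (real (Suc N) * (2 ^ N * weight N x * (real (Suc N) * ((2 ^ J) ^ N * weighted_norm N N \<theta>))))"
      using \<open>0 \<le> C\<close> by (intro mult_left_mono weighted_norm_scaled_argument \<theta>s) (auto simp: less_imp_le)
    also have "\<dots> = D * weight N x * (2 ^ J) ^ N"
      by (simp only: D_def mult_ac)
    finally have "a J * norm (g J x) \<le> a J * (D * weight N x * (2 ^ J) ^ N)"
      using a(1) by (intro mult_left_mono)
    also have "\<dots> = D * weight N x * (a J * (2 ^ J) ^ N)" by (simp only: mult_ac)
    finally show ?thesis using a(1)[of J] unfolding a(2) by simp
  qed
  define F1 where "F1 x = (\<Sum>J. a J *\<^sub>R g J x)" for x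
  have unif: "uniform_limit {-R..R} (\<lambda>n x. \<Sum>J<n. a J *\<^sub>R g J x) F1 sequentially" for R
    unfolding F1_def[abs_def]
  proof (rule Weierstrass_m_test)
    fix J x assume x: "x \<in> {-R..R}"
    have "D * weight N x * (1 / 2) ^ J \<le> D * weight N R * (1 / 2) ^ J"
      using D x by (intro mult_right_mono mult_left_mono weight_le) auto
    with g_bound show "norm (a J *\<^sub>R g J x) \<le> D * weight N R * (1 / 2) ^ J" by (rule order_trans)
  next
    show "summable (\<lambda>J. D * weight N R * (1 / 2) ^ J)"
      by (intro summable_mult summable_geometric) simp
  qed
  have F1_interval: "continuous_on {-R..R} F1" for R
    by (rule uniform_limit_theorem[OF _ unif])
      (auto intro!: always_eventually continuous_on_sum continuous_on_scaleR continuous_on_const g_cont)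
  have "isCont F1 x" for x
    by (rule continuous_on_interior[OF F1_interval[of "\<bar>x\<bar> + 1"]])
      (auto simp: interior_atLeastAtMost_real)
  then have F1_cont: "continuous_on UNIV F1" by (simp add: continuous_at_imp_continuous_on)
  have "norm (F1 x) \<le> (D * 2) * weight N x" for x
  proof -
    have "norm (F1 x) \<le> (\<Sum>J. D * weight N x * (1 / 2) ^ J)"
      unfolding F1_def by (intro norm_suminf_le g_bound summable_mult summable_geometric) simp
    also have "\<dots> = (D * 2) * weight N x"
      by (simp add: suminf_mult suminf_geometric)
    finally show ?thesis .
  qed
  then have F1: "F1 \<in> poly_growth"
    using F1_cont D unfolding poly_growth_iff by (intro conjI exI[of _ "D * 2"] exI[of _ N]) auto
  obtain F2 where F2: "F2 \<in> poly_growth" "\<And>\<eta>. \<eta> \<in> test_functions \<Longrightarrow>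
      function_distribution smul (\<lambda>x. T (\<lambda>y. \<rho> (y - x))) \<eta> =
      distribution_derivative M (function_distribution smul F2) \<eta>"
    using function_distribution_iterated_antiderivative[OF translate_poly_growth[OF T bound \<open>0 \<le> C\<close> test1[OF \<rho>]]]
    by blast
  have F2_cont: "continuous_on UNIV F2" using F2(1) by (simp add: poly_growth_iff)
  define F where "F x = F2 x + (- 1) ^ M *\<^sub>R F1 x" for x
  have "F \<in> poly_growth"
  proof -
    obtain C1 n1 C2 n2 where C: "0 \<le> C1" "0 \<le> C2" "\<And>x. norm (F1 x) \<le> C1 * weight n1 x"
      "\<And>x. norm (F2 x) \<le> C2 * weight n2 x"
      using F1 F2(1) by (auto simp: poly_growth_iff)
    have "norm (F x) \<le> (C2 + C1) * weight (max n1 n2) x" for x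
    proof -
      have "norm (F x) \<le> norm (F2 x) + norm (F1 x)"
        unfolding F_def by (rule norm_triangle_le) simp
      also have "\<dots> \<le> C2 * weight (max n1 n2) x + C1 * weight (max n1 n2) x"
        using C by (intro add_mono order_trans[OF C(3)] order_trans[OF C(4)] mult_left_mono weight_mono) auto
      finally show ?thesis by (simp add: algebra_simps)
    qed
    moreover have "continuous_on UNIV F"
      unfolding F_def[abs_def] by (intro continuous_intros F1_cont F2_cont)
    ultimately show ?thesis using C(1,2) unfolding poly_growth_iff
      by (intro conjI exI[of _ "C2 + C1"] exI[of _ "max n1 n2"]) auto
  qed
  moreover have "T \<eta> = distribution_derivative M (function_distribution smul F) \<eta>" if \<eta>: "\<eta> \<in> test_functions" for \<eta>
  proof -
    obtain R where R: "0 < R" "\<And>n x. R \<le> \<bar>x\<bar> \<Longrightarrow> nvd n \<eta> x = 0"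
      using test_function_radius[OF \<eta>] by metis
    note sm = test_function_smooth[OF \<eta>]
    have cont: "continuous_on UNIV (nvd M \<eta>)" "continuous_on UNIV \<eta>"
      using smooth_continuous[OF sm] smooth_continuous[OF sm, of _ 0] by auto
    have "(\<lambda>J. a J *\<^sub>R T (conv_on (-R) R (nvd M \<eta>) (\<lambda>x. \<theta> (2 ^ J * x)))) sums
        (T \<eta> - T (conv_on (-R) R \<eta> \<rho>))"
      unfolding a_def by (rule reproducing_series[OF T \<eta> R \<rho> \<theta> int kernel])
    moreover have "(\<lambda>J. a J *\<^sub>R T (conv_on (-R) R (nvd M \<eta>) (\<lambda>x. \<theta> (2 ^ J * x)))) sums
        integral {-R..R} (\<lambda>x. smul (nvd M \<eta> x) (F1 x))"
    proof -
      let ?h = "\<lambda>n x. smul (nvd M \<eta> x) (\<Sum>J<n. a J *\<^sub>R g J x)"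
      have h_cont: "continuous_on {-R..R} (?h n)" for n
        by (intro continuous_on_smul continuous_on_sum continuous_on_scaleR continuous_on_const g_cont
            smooth_continuous sm)
      obtain B where B: "0 < B" "\<And>x. norm (nvd M \<eta> x) \<le> B" using test_function_boundedE[OF \<eta>] by metis
      have "uniform_limit {-R..R} ?h (\<lambda>x. smul (nvd M \<eta> x) (F1 x)) sequentially"
      proof (rule uniform_limitI)
        fix e :: real assume "0 < e"
        then have "0 < e / B" using B(1) by simp
        from uniform_limitD[OF unif[of R] this]
        show "\<forall>\<^sub>F n in sequentially. \<forall>x\<in>{-R..R}. dist (?h n x) (smul (nvd M \<eta> x) (F1 x)) < e"
        proof eventually_elim
          case (elim n)
          show ?case
          proof
            fix x assume "x \<in> {-R..R}"
            then have less: "dist (\<Sum>J<n. a J *\<^sub>R g J x) (F1 x) < e / B" using elim by blast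
            have "dist (?h n x) (smul (nvd M \<eta> x) (F1 x)) = norm (nvd M \<eta> x) * dist (\<Sum>J<n. a J *\<^sub>R g J x) (F1 x)"
              by (simp only: dist_norm flip: scale_right_diff_distrib norm_scale)
            also have "\<dots> \<le> B * dist (\<Sum>J<n. a J *\<^sub>R g J x) (F1 x)"
              by (intro mult_right_mono B) simp
            also have "\<dots> < e" using less B(1) by (simp add: pos_less_divide_eq mult.commute)
            finally show "dist (?h n x) (smul (nvd M \<eta> x) (F1 x)) < e" .
          qed
        qed
      qed
      then obtain I J where IJ: "\<And>n. (?h n has_integral I n) {-R..R}"
        "((\<lambda>x. smul (nvd M \<eta> x) (F1 x)) has_integral J) {-R..R}" "I \<longlonglongrightarrow> J"
        by (rule uniform_limit_integral[OF _ h_cont trivial_limit_sequentially]) (rule that)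
      have I: "I n = (\<Sum>J<n. a J *\<^sub>R T (conv_on (-R) R (nvd M \<eta>) (\<lambda>x. \<theta> (2 ^ J * x))))" for n
      proof (rule has_integral_unique[OF IJ(1)])
        have "((\<lambda>x. \<Sum>J<n. a J *\<^sub>R smul (nvd M \<eta> x) (g J x)) has_integral
            (\<Sum>J<n. a J *\<^sub>R T (conv_on (-R) R (nvd M \<eta>) (\<lambda>x. \<theta> (2 ^ J * x))))) {-R..R}"
          unfolding g_def
          by (intro has_integral_sum has_integral_cmul distribution_conv_on[OF T cont(1) \<theta>J]) (use R(1) in auto)
        moreover have "(\<Sum>J<n. a J *\<^sub>R smul (nvd M \<eta> x) (g J x)) = ?h n x" for x
          by (simp add: bounded_bilinear.sum_right[OF bounded_bilinear_smul]
              bounded_bilinear.scaleR_right[OF bounded_bilinear_smul])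
        ultimately show "(?h n has_integral
            (\<Sum>J<n. a J *\<^sub>R T (conv_on (-R) R (nvd M \<eta>) (\<lambda>x. \<theta> (2 ^ J * x))))) {-R..R}"
          by simp
      qed
      show ?thesis
        using IJ(3) unfolding sums_def I[symmetric] integral_unique[OF IJ(2)] .
    qed
    ultimately have "T \<eta> - T (conv_on (-R) R \<eta> \<rho>) = integral {-R..R} (\<lambda>x. smul (nvd M \<eta> x) (F1 x))"
      by (rule sums_unique2)
    also have "\<dots> = function_distribution smul F1 (nvd M \<eta>)"
      by (rule function_distribution_interval[symmetric, OF F1_cont cont(1) R(2)])
    finally have "T \<eta> = T (conv_on (-R) R \<eta> \<rho>) + function_distribution smul F1 (nvd M \<eta>)"
      by (simp add: diff_eq_eq add.commute)
    also have "T (conv_on (-R) R \<eta> \<rho>) = function_distribution smul (\<lambda>x. T (\<lambda>y. \<rho> (y - x))) \<eta>"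
      using R by (intro distribution_convolution[OF T cont(2) test1[OF \<rho>], symmetric]) (use R(2)[of _ 0] in auto)
    also have "\<dots> = (- 1) ^ M *\<^sub>R function_distribution smul F2 (nvd M \<eta>)"
      using F2(2)[OF \<eta>] by (simp add: distribution_derivative_def)
    also have "(- 1) ^ M *\<^sub>R function_distribution smul F2 (nvd M \<eta>) + function_distribution smul F1 (nvd M \<eta>) =
        (- 1) ^ M *\<^sub>R (function_distribution smul F2 (nvd M \<eta>) + (- 1) ^ M *\<^sub>R function_distribution smul F1 (nvd M \<eta>))"
      by (simp add: scaleR_add_right flip: power_mult_distrib)
    also have "function_distribution smul F2 (nvd M \<eta>) + (- 1) ^ M *\<^sub>R function_distribution smul F1 (nvd M \<eta>) =
        function_distribution smul F (nvd M \<eta>)"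
    proof -
      have F_cont: "continuous_on UNIV F"
        unfolding F_def[abs_def] by (intro continuous_intros F1_cont F2_cont)
      have fd: "function_distribution smul H (nvd M \<eta>) = integral {-R..R} (\<lambda>x. smul (nvd M \<eta> x) (H x))"
        if "continuous_on UNIV H" for H
        by (rule function_distribution_interval[OF that cont(1) R(2)])
      have int: "((\<lambda>x. smul (nvd M \<eta> x) (H x)) has_integral integral {-R..R} (\<lambda>x. smul (nvd M \<eta> x) (H x))) {-R..R}"
        if "continuous_on UNIV H" for H
        by (intro integrable_integral integrable_continuous_real continuous_on_smul smooth_continuous sm
            continuous_on_subset[OF that]) simp
      have "((\<lambda>x. smul (nvd M \<eta> x) (F2 x) + (- 1) ^ M *\<^sub>R smul (nvd M \<eta> x) (F1 x)) has_integral
        integral {-R..R} (\<lambda>x. smul (nvd M \<eta> x) (F2 x)) + (- 1) ^ M *\<^sub>R integral {-R..R} (\<lambda>x. smul (nvd M \<eta> x) (F1 x))) {-R..R}"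
        by (intro has_integral_add has_integral_cmul int F1_cont F2_cont)
      then show ?thesis
        unfolding fd[OF F_cont] fd[OF F1_cont] fd[OF F2_cont] F_def
        by (simp add: integral_unique scale_right_distrib bounded_bilinear.scaleR_right[OF bounded_bilinear_smul])
    qed
    finally show ?thesis by (simp add: distribution_derivative_def)
  qed
  ultimately show ?thesis by blast
qed

end

section \<open>Tempered distributions from functions of polynomial growth\<close>

text \<open>A bound that is uniform in the interval and small near infinity; it stands in for absolute
integrability, as the integrand takes values in an arbitrary Banach space.\<close>

lemma norm_integral_le_arctan:
  fixes h :: "real \<Rightarrow> 'x::banach"
  assumes "continuous_on UNIV h" and "\<And>x. norm (h x) \<le> K * inverse (1 + x\<^sup>2)" and "a \<le> b"
  shows "norm (integral {a..b} h) \<le> K * (arctan b - arctan a)"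
proof -
  have "(arctan has_vector_derivative inverse (1 + x\<^sup>2)) (at x)" for x
    using DERIV_arctan by (simp only: has_real_derivative_iff_has_vector_derivative)
  note arctan = has_vector_derivative_at_within[OF this]
  have "((\<lambda>x. inverse (1 + x\<^sup>2)) has_integral (arctan b - arctan a)) {a..b}"
    by (rule fundamental_theorem_of_calculus[OF \<open>a \<le> b\<close> arctan])
  then have int: "((\<lambda>x. K * inverse (1 + x\<^sup>2)) has_integral K * (arctan b - arctan a)) {a..b}"
    by (rule has_integral_mult_right)
  have "norm (integral {a..b} h) \<le> integral {a..b} (\<lambda>x. K * inverse (1 + x\<^sup>2))"
    by (intro integral_norm_bound_integral has_integral_integrable[OF int] assms(2)
        integrable_continuous_real continuous_on_subset[OF assms(1)]) simp
  then show ?thesis unfolding integral_unique[OF int] .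
qed

lemma
  fixes h :: "real \<Rightarrow> 'x::banach"
  assumes cont: "continuous_on UNIV h" and bound: "\<And>x. norm (h x) \<le> K * inverse (1 + x\<^sup>2)"
  shows convergent_symmetric_integrals: "convergent (\<lambda>k::nat. integral {-real k..real k} h)"
    and norm_lim_symmetric_integrals: "norm (lim (\<lambda>k::nat. integral {-real k..real k} h)) \<le> K * pi"
proof -
  define I where "I k = integral {-real k..real k} h" for k :: nat
  have K: "0 \<le> K" using order_trans[OF norm_ge_zero bound[of 0]] by simp
  have int: "h integrable_on {a..b}" for a b
    by (intro integrable_continuous_real continuous_on_subset[OF cont]) auto
  have le: "dist (I k) (I l) \<le> 2 * K * dist (arctan (real k)) (arctan (real l))" if "k \<le> l" for k l
  proof -
    have 1: "integral {-real l..-real k} h + I k = integral {-real l..real k} h"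
      unfolding I_def using that by (intro Henstock_Kurzweil_Integration.integral_combine int) auto
    have 2: "integral {-real l..real k} h + integral {real k..real l} h = I l"
      unfolding I_def using that by (intro Henstock_Kurzweil_Integration.integral_combine int) auto
    have "I l - I k = integral {-real l..-real k} h + integral {real k..real l} h"
      unfolding 2[symmetric] 1[symmetric] by simp
    also have "norm \<dots> \<le> K * (arctan (-real k) - arctan (-real l)) + K * (arctan (real l) - arctan (real k))"
      using that by (intro norm_triangle_le add_mono norm_integral_le_arctan cont bound) auto
    also have "\<dots> = 2 * K * (arctan (real l) - arctan (real k))"
      by (simp add: arctan_minus algebra_simps)
    also have "arctan (real l) - arctan (real k) = dist (arctan (real k)) (arctan (real l))"
      using that arctan_le_iff[of "real k" "real l"] by (simp add: dist_real_def)
    finally show ?thesis by (simp add: dist_norm norm_minus_commute)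
  qed
  have "Cauchy (\<lambda>k. arctan (real k))"
    by (rule LIMSEQ_imp_Cauchy[OF filterlim_compose[OF tendsto_arctan_at_top filterlim_real_sequentially]])
  have "Cauchy I"
  proof (rule metric_CauchyI)
    fix e :: real assume "0 < e"
    then have "0 < e / (2 * K + 1)" using K by simp
    from metric_CauchyD[OF \<open>Cauchy (\<lambda>k. arctan (real k))\<close> this]
    obtain M where M: "\<And>m n. M \<le> m \<Longrightarrow> M \<le> n \<Longrightarrow> dist (arctan (real m)) (arctan (real n)) < e / (2 * K + 1)"
      by metis
    have "dist (I m) (I n) < e" if "M \<le> m" "M \<le> n" for m n
    proof -
      have "dist (I m) (I n) \<le> 2 * K * dist (arctan (real m)) (arctan (real n))"
        using le[of m n] le[of n m] by (cases "m \<le> n") (auto simp: dist_commute)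
      also have "\<dots> \<le> (2 * K + 1) * dist (arctan (real m)) (arctan (real n))"
        by (intro mult_right_mono) auto
      also have "\<dots> < e" using M[OF that] K by (simp add: pos_less_divide_eq mult.commute)
      finally show ?thesis .
    qed
    then show "\<exists>M. \<forall>m\<ge>M. \<forall>n\<ge>M. dist (I m) (I n) < e" by blast
  qed
  then have conv: "convergent I" by (rule Cauchy_convergent)
  then show "convergent (\<lambda>k::nat. integral {-real k..real k} h)" by (simp add: I_def[abs_def])
  have "norm (I k) \<le> K * pi" for k
  proof -
    have "norm (I k) \<le> K * (arctan (real k) - arctan (- real k))"
      unfolding I_def by (intro norm_integral_le_arctan cont bound) auto
    also have "\<dots> \<le> K * pi"
      using K arctan_ubound[of "real k"] by (intro mult_left_mono) (auto simp: arctan_minus)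
    finally show ?thesis .
  qed
  then have "norm (lim I) \<le> K * pi"
    using conv by (intro LIMSEQ_le_const2[OF tendsto_norm]) (auto simp: convergent_LIMSEQ_iff)
  then show "norm (lim (\<lambda>k::nat. integral {-real k..real k} h)) \<le> K * pi"
    by (simp add: I_def[abs_def])
qed

context banach_space_over
begin

text \<open>The Schwartz function compensates the growth of \<open>F\<close> and leaves a factor \<open>1 / (1 + x^2)\<close>, so the
integral of \<open>\<psi>\<^sup>(\<^sup>m\<^sup>) F\<close> exists as a limit over symmetric intervals and is bounded by a seminorm of
\<open>\<psi>\<close>.\<close>

lemma poly_growth_tempered:
  assumes F: "F \<in> poly_growth"
  shows "restricts_tempered smul (distribution_derivative m (function_distribution smul F))"
proof -
  obtain C n where C: "0 \<le> C" "\<And>x. norm (F x) \<le> C * weight n x" and contF: "continuous_on UNIV F"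
    using F by (auto simp: poly_growth_iff)
  define h where "h \<psi> x = smul (nvd m \<psi> x) (F x)" for \<psi> :: "real \<Rightarrow> 'k" and x
  define I where "I \<psi> k = integral {-real k..real k} (h \<psi>)" for \<psi> and k :: nat
  define S where "S \<psi> = (- 1) ^ m *\<^sub>R lim (I \<psi>)" for \<psi>
  have h_cont: "continuous_on A (h \<psi>)" if "\<psi> \<in> schwartz_functions" for \<psi> A
    unfolding h_def[abs_def]
    by (intro continuous_on_smul smooth_continuous schwartz_smooth that continuous_on_subset[OF contF]) simp
  have h_bound: "norm (h \<psi> x) \<le> C * weighted_norm (n + 2) m \<psi> * inverse (1 + x\<^sup>2)"
    if \<psi>: "\<psi> \<in> schwartz_functions" for \<psi> x
  proof -
    have pos: "0 < 1 + x\<^sup>2" by (simp add: add_pos_nonneg)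
    have "norm (h \<psi> x) * (1 + x\<^sup>2) \<le> norm (nvd m \<psi> x) * (C * weight n x) * (1 + x\<^sup>2)"
      unfolding h_def norm_scale using C(2)[of x] pos by (intro mult_right_mono mult_left_mono) auto
    also have "\<dots> = C * (weight (n + 2) x * norm (nvd m \<psi> x))"
      by (simp only: weight_add weight_2 mult_ac)
    also have "\<dots> \<le> C * weighted_norm (n + 2) m \<psi>"
      using C(1) \<psi> by (intro mult_left_mono weighted_norm_ge) auto
    finally show ?thesis using pos by (simp add: divide_inverse[symmetric] pos_le_divide_eq)
  qed
  have lim: "I \<psi> \<longlonglongrightarrow> lim (I \<psi>)" if "\<psi> \<in> schwartz_functions" for \<psi>
    using convergent_symmetric_integrals[OF h_cont h_bound, OF that that]
    by (simp add: I_def[abs_def] convergent_LIMSEQ_iff)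
  have int: "(h \<psi> has_integral I \<psi> k) {-real k..real k}" if "\<psi> \<in> schwartz_functions" for \<psi> k
    unfolding I_def by (intro integrable_integral integrable_continuous_real h_cont that)
  have "linear_functional_on smul schwartz_functions S"
    unfolding linear_functional_on_def
  proof (intro conjI ballI allI)
    fix f g :: "real \<Rightarrow> 'k" assume fg: "f \<in> schwartz_functions" "g \<in> schwartz_functions"
    have "h (\<lambda>x. f x + g x) = (\<lambda>x. h f x + h g x)"
      using fg by (simp add: h_def nvd_add schwartz_smooth scale_left_distrib fun_eq_iff)
    then have "I (\<lambda>x. f x + g x) k = I f k + I g k" for k
      using has_integral_add[OF int[OF fg(1)] int[OF fg(2)]] by (simp add: I_def integral_unique)
    then have "I (\<lambda>x. f x + g x) = (\<lambda>k. I f k + I g k)" by (rule ext)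
    then have "I (\<lambda>x. f x + g x) \<longlonglongrightarrow> lim (I f) + lim (I g)"
      using tendsto_add[OF lim[OF fg(1)] lim[OF fg(2)]] by (simp only:)
    then have "lim (I (\<lambda>x. f x + g x)) = lim (I f) + lim (I g)" by (rule limI)
    then show "S (\<lambda>x. f x + g x) = S f + S g" by (simp add: S_def scaleR_add_right)
  next
    fix c and f :: "real \<Rightarrow> 'k" assume f: "f \<in> schwartz_functions"
    interpret sc: bounded_linear "smul c" by (rule bounded_bilinear.bounded_linear_right[OF bounded_bilinear_smul])
    have "h (\<lambda>x. c * f x) = (\<lambda>x. smul c (h f x))"
      using f by (simp add: h_def nvd_mult schwartz_smooth fun_eq_iff)
    then have "I (\<lambda>x. c * f x) k = smul c (I f k)" for k
      using has_integral_linear[OF int[OF f] sc.bounded_linear_axioms] by (simp add: I_def integral_unique o_def)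
    then have "I (\<lambda>x. c * f x) = (\<lambda>k. smul c (I f k))" by (rule ext)
    then have "I (\<lambda>x. c * f x) \<longlonglongrightarrow> smul c (lim (I f))"
      using sc.tendsto[OF lim[OF f]] by (simp only:)
    then have "lim (I (\<lambda>x. c * f x)) = smul c (lim (I f))" by (rule limI)
    then show "S (\<lambda>x. c * f x) = smul c (S f)" by (simp add: S_def sc.scaleR)
  qed
  moreover have "norm (S \<psi>) \<le> (C * pi) * weighted_norm (n + 2) m \<psi>" if \<psi>: "\<psi> \<in> schwartz_functions" for \<psi>
    using norm_lim_symmetric_integrals[OF h_cont h_bound, OF \<psi> \<psi>]
    by (simp add: S_def I_def[abs_def] mult_ac)
  ultimately have "S \<in> tempered_distributions smul" by (rule tempered_distributionI)
  moreover have "distribution_derivative m (function_distribution smul F) \<eta> = S \<eta>" if \<eta>: "\<eta> \<in> test_functions" for \<eta>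
  proof -
    obtain R where R: "0 < R" "\<And>n x. R \<le> \<bar>x\<bar> \<Longrightarrow> nvd n \<eta> x = 0"
      using test_function_radius[OF \<eta>] by metis
    have "I \<eta> k = function_distribution smul F (nvd m \<eta>)" if "nat \<lceil>R\<rceil> \<le> k" for k
      unfolding I_def h_def[abs_def]
    proof (rule function_distribution_interval[symmetric, OF contF smooth_continuous[OF test_function_smooth[OF \<eta>]]])
      fix x assume "real k \<le> \<bar>x\<bar>"
      with that have "R \<le> \<bar>x\<bar>" by linarith
      then show "nvd m \<eta> x = 0" by (rule R(2))
    qed
    then have "\<forall>\<^sub>F k in sequentially. I \<eta> k = function_distribution smul F (nvd m \<eta>)"
      unfolding eventually_sequentially by blast
    then have "lim (I \<eta>) = function_distribution smul F (nvd m \<eta>)"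
      by (intro limI tendsto_eventually)
    then show ?thesis by (simp add: S_def distribution_derivative_def)
  qed
  ultimately show ?thesis by (auto simp: restricts_tempered_def)
qed

end

section \<open>Uniform boundedness\<close>

text \<open>Completeness of the Schwartz space, for rapidly convergent series. For fixed \<open>k\<close> and \<open>i\<close> the
\<open>j\<close>-th term is controlled by \<open>weighted_norm j j\<close> as soon as \<open>j\<close> exceeds both, so every weighted series of
derivatives converges uniformly and the series may be differentiated term by term.\<close>

lemma schwartz_series:
  fixes F :: "nat \<Rightarrow> real \<Rightarrow> 'k::{real_normed_field,euclidean_space}"
  assumes F: "\<And>j. F j \<in> schwartz_functions" and small: "\<And>j. weighted_norm j j (F j) \<le> (1 / 2) ^ j"
  obtains s where "s \<in> schwartz_functions" and "\<And>x. (\<lambda>j. F j x) sums s x"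
    and "\<And>n. (\<lambda>J. weighted_norm n n (\<lambda>x. s x - (\<Sum>j<J. F j x))) \<longlonglongrightarrow> 0"
proof -
  have sm: "smooth (F j)" for j by (rule schwartz_smooth[OF F])
  have small_deriv: "norm (nvd i (F j) x) \<le> (1 / 2) ^ j * inverse (weight k x)" if "max k i \<le> j" for i j k x
  proof -
    have "weight k x * norm (nvd i (F j) x) \<le> weighted_norm k j (F j)"
      using that by (intro weighted_norm_ge F) simp
    also have "\<dots> \<le> weighted_norm j j (F j)" using that by (intro weighted_norm_mono F) auto
    also have "\<dots> \<le> (1 / 2) ^ j" by (rule small)
    finally have "norm (nvd i (F j) x) * weight k x \<le> (1 / 2) ^ j" by (simp only: mult.commute)
    then show ?thesis by (simp only: pos_le_divide_eq[OF weight_pos] flip: divide_inverse)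
  qed
  have geo: "summable (\<lambda>j. (1 / 2 :: real) ^ j)" by (rule summable_geometric) simp
  define d where "d i x = (\<Sum>j. nvd i (F j) x)" for i x
  have summable: "summable (\<lambda>j. nvd i (F j) x)" for i x
  proof (rule summable_comparison_test_ev[OF _ geo])
    show "\<forall>\<^sub>F j in sequentially. norm (nvd i (F j) x) \<le> (1 / 2) ^ j"
      unfolding eventually_sequentially using small_deriv[of 0 i _ x] by (intro exI[of _ i]) simp
  qed
  have tail: "weight k x * norm (d i x - (\<Sum>j<J. nvd i (F j) x)) \<le> 2 * (1 / 2) ^ J" if "max k i \<le> J" for i k x J
  proof -
    have "d i x - (\<Sum>j<J. nvd i (F j) x) = (\<Sum>j. nvd i (F (j + J)) x)"
      unfolding d_def using suminf_split_initial_segment[OF summable, of i x J] by simp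
    also have "norm \<dots> \<le> (\<Sum>j. (1 / 2) ^ J * inverse (weight k x) * (1 / 2) ^ j)"
    proof (rule norm_suminf_le)
      show "summable (\<lambda>j. (1 / 2) ^ J * inverse (weight k x) * (1 / 2) ^ j)"
        by (rule summable_mult[OF geo])
      show "norm (nvd i (F (j + J)) x) \<le> (1 / 2) ^ J * inverse (weight k x) * (1 / 2) ^ j" for j
        using small_deriv[of k i "j + J" x] that by (simp add: power_add mult_ac)
    qed
    also have "\<dots> = (1 / 2) ^ J * inverse (weight k x) * 2"
      by (subst suminf_mult[OF geo]) (simp add: suminf_geometric)
    finally have "norm (d i x - (\<Sum>j<J. nvd i (F j) x)) \<le> 2 * (1 / 2) ^ J * inverse (weight k x)"
      by (simp only: mult_ac)
    then have "norm (d i x - (\<Sum>j<J. nvd i (F j) x)) * weight k x \<le> 2 * (1 / 2) ^ J"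
      by (simp only: pos_le_divide_eq[OF weight_pos] flip: divide_inverse)
    then show ?thesis by (simp only: mult.commute)
  qed
  have tail_lim: "(\<lambda>J. 2 * (1 / 2 :: real) ^ J) \<longlonglongrightarrow> 0"
    by (intro tendsto_mult_right_zero LIMSEQ_power_zero) simp
  have deriv: "(d i has_vector_derivative d (Suc i) x) (at x)" for i x
  proof -
    have "\<exists>g. \<forall>x\<in>UNIV. (\<lambda>j. nvd i (F j) x) sums g x \<and>
        (g has_derivative (\<lambda>h. h *\<^sub>R d (Suc i) x)) (at x within UNIV)"
    proof (rule has_derivative_series[where f' = "\<lambda>j x h. h *\<^sub>R nvd (Suc i) (F j) x"])
      show "(nvd i (F j) has_derivative (\<lambda>h. h *\<^sub>R nvd (Suc i) (F j) x)) (at x within UNIV)" for j x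
        using smooth_has_derivative[OF sm[of j], of i x] by (simp add: has_vector_derivative_def)
      show "(\<lambda>j. nvd i (F j) 0) sums d i 0" unfolding d_def by (rule summable_sums[OF summable])
      fix e :: real assume "0 < e"
      from order_tendstoD(2)[OF tail_lim this] eventually_ge_at_top[of "Suc i"]
      show "\<forall>\<^sub>F n in sequentially. \<forall>x\<in>UNIV. \<forall>h. norm ((\<Sum>j<n. h *\<^sub>R nvd (Suc i) (F j) x) - h *\<^sub>R d (Suc i) x) \<le> e * norm h"
      proof eventually_elim
        case (elim n)
        show ?case
        proof (intro ballI allI)
          fix x h
          have "norm ((\<Sum>j<n. h *\<^sub>R nvd (Suc i) (F j) x) - h *\<^sub>R d (Suc i) x) =
              \<bar>h\<bar> * norm (d (Suc i) x - (\<Sum>j<n. nvd (Suc i) (F j) x))"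
            by (simp only: norm_minus_commute norm_scaleR flip: scaleR_sum_right scaleR_diff_right)
          also have "\<dots> \<le> \<bar>h\<bar> * e"
            using tail[of 0 "Suc i" n x] elim by (intro mult_left_mono) auto
          finally show "norm ((\<Sum>j<n. h *\<^sub>R nvd (Suc i) (F j) x) - h *\<^sub>R d (Suc i) x) \<le> e * norm h"
            by (simp add: mult.commute)
        qed
      qed
    qed auto
    then obtain g where g: "\<And>x. (\<lambda>j. nvd i (F j) x) sums g x"
      "\<And>x. (g has_derivative (\<lambda>h. h *\<^sub>R d (Suc i) x)) (at x)"
      by auto
    have "g = d i" using g(1) by (auto simp: d_def fun_eq_iff sums_iff)
    with g(2) show ?thesis by (simp add: has_vector_derivative_def)
  qed
  have smd: "smooth (d 0)" and nvd_d: "nvd i (d 0) = d i" for i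
    using smooth_derivative_sequence[of d "d 0", OF refl deriv] by auto
  have partial: "(\<lambda>x. \<Sum>j<J. F j x) \<in> schwartz_functions" for J
    by (rule schwartz_sum) (simp_all add: F)
  have nvd_diff_partial: "nvd i (\<lambda>x. d 0 x - (\<Sum>j<J. F j x)) = (\<lambda>x. d i x - (\<Sum>j<J. nvd i (F j) x))" for i J
    by (simp add: nvd_diff[OF smd smooth_sum] sm nvd_sum nvd_d)
  have "bounded (range (\<lambda>x. weight k x *\<^sub>R nvd i (d 0) x))" for k i
  proof -
    let ?J = "max k i"
    have "bounded (range (\<lambda>x. weight k x *\<^sub>R nvd i (\<lambda>x. \<Sum>j<?J. F j x) x))"
      using partial[of ?J] by (auto simp: schwartz_functions_def)
    moreover have "bounded (range (\<lambda>x. weight k x *\<^sub>R (d i x - (\<Sum>j<?J. nvd i (F j) x))))"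
      unfolding bounded_iff using tail[of k i ?J] by (auto simp: less_imp_le)
    ultimately have "bounded (range (\<lambda>x. weight k x *\<^sub>R nvd i (\<lambda>x. \<Sum>j<?J. F j x) x +
        weight k x *\<^sub>R (d i x - (\<Sum>j<?J. nvd i (F j) x))))"
      by (rule bounded_plus_comp)
    then show ?thesis by (simp add: nvd_sum sm nvd_d flip: scaleR_add_right)
  qed
  then have s: "d 0 \<in> schwartz_functions" using smd by (simp add: schwartz_functions_def)
  show thesis
  proof (rule that[OF s])
    show "(\<lambda>j. F j x) sums d 0 x" for x
      using summable_sums[OF summable, of 0 x] by (simp add: d_def)
    fix n :: nat
    have upper: "(\<lambda>J. \<Sum>i\<le>n. 2 * (1 / 2 :: real) ^ J) \<longlonglongrightarrow> 0"
      using tendsto_mult_right_zero[OF tail_lim, of "real (Suc n)"] by simp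
    have le: "\<forall>\<^sub>F J in sequentially. weighted_norm n n (\<lambda>x. d 0 x - (\<Sum>j<J. F j x)) \<le> (\<Sum>i\<le>n. 2 * (1 / 2) ^ J)"
      using eventually_ge_at_top[of n]
    proof eventually_elim
      case (elim J)
      show ?case
      proof (rule weighted_norm_le)
        fix j x assume "j \<le> n"
        then have "max n j \<le> J" using elim by simp
        then show "weight n x * norm (nvd j (\<lambda>x. d 0 x - (\<Sum>j<J. F j x)) x) \<le> 2 * (1 / 2) ^ J"
          unfolding nvd_diff_partial by (rule tail)
      qed
    qed
    have nonneg: "\<forall>\<^sub>F J in sequentially. 0 \<le> weighted_norm n n (\<lambda>x. d 0 x - (\<Sum>j<J. F j x))"
      using weighted_norm_nonneg[OF schwartz_diff[OF s partial]] by simp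
    show "(\<lambda>J. weighted_norm n n (\<lambda>x. d 0 x - (\<Sum>j<J. F j x))) \<longlonglongrightarrow> 0"
      by (rule tendsto_sandwich[OF nonneg le tendsto_const upper])
  qed
qed

text \<open>Scaling \<open>f\<close> into the ball where \<open>q\<close> is at most \<open>B\<close>; the auxiliary \<open>\<delta>\<close> covers the case \<open>p f = 0\<close>.\<close>

lemma homogeneous_bound:
  fixes p q :: "(real \<Rightarrow> 'k::real_normed_field) \<Rightarrow> real"
  assumes bound: "\<And>f. f \<in> V \<Longrightarrow> p f < e \<Longrightarrow> q f \<le> B" and "0 < e"
    and V: "function_subspace V" and p: "\<And>f. f \<in> V \<Longrightarrow> 0 \<le> p f"
    "\<And>r f. 0 < r \<Longrightarrow> f \<in> V \<Longrightarrow> p (\<lambda>x. r *\<^sub>R f x) = r * p f"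
    and q: "\<And>r f. 0 < r \<Longrightarrow> f \<in> V \<Longrightarrow> q (\<lambda>x. r *\<^sub>R f x) = r * q f"
    and f: "f \<in> V" and "0 \<le> B"
  shows "q f \<le> (B / e) * p f"
proof -
  have "q f * e \<le> B * p f + \<delta>" if "0 < \<delta>" for \<delta>
  proof -
    define t where "t = p f + \<delta> / (B + 1)"
    have pos: "0 < \<delta> / (B + 1)" using that \<open>0 \<le> B\<close> by simp
    have t: "0 < t" "p f < t" using p(1)[OF f] pos by (auto simp: t_def)
    have et: "0 < e / t" using t(1) \<open>0 < e\<close> by simp
    have "p (\<lambda>x. (e / t) *\<^sub>R f x) = e / t * p f" by (rule p(2)[OF et f])
    also have "\<dots> < e" using t \<open>0 < e\<close> by (simp add: pos_divide_less_eq)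
    finally have "q (\<lambda>x. (e / t) *\<^sub>R f x) \<le> B"
      by (intro bound function_subspaceD(4)[OF V f])
    then have "e / t * q f \<le> B" by (simp only: q[OF et f])
    then have "q f * e \<le> B * t" using t(1) by (simp add: pos_divide_le_eq mult.commute)
    also have "\<dots> = B * p f + B / (B + 1) * \<delta>" by (simp add: t_def distrib_left)
    also have "B / (B + 1) * \<delta> \<le> 1 * \<delta>" using \<open>0 \<le> B\<close> that by (intro mult_right_mono) auto
    finally show ?thesis by simp
  qed
  then have "q f * e \<le> B * p f" by (rule field_le_epsilon)
  then show ?thesis using \<open>0 < e\<close> by (simp add: pos_le_divide_eq)
qed

text \<open>Baire's theorem for a complete space whose topology is given by an increasing sequence of
seminorms, specialised to closed sets \<open>A N\<close> that cover the space: one of them contains a ball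
around 0. The hypothesis \<open>midpoint\<close> is what remains of convexity and symmetry. If no \<open>A N\<close> contains
such a ball, then from any point \<open>s\<close> an arbitrarily small step \<open>f\<close> or \<open>-f\<close> leads out of \<open>A N\<close>, and by closedness a
whole ball around the new point avoids \<open>A N\<close>. The steps are chosen so small that the points
converge and that the limit stays in all these balls; it lies in no \<open>A N\<close>.\<close>

lemma barrel_contains_ball:
  fixes V :: "(real \<Rightarrow> 'k::real_normed_field) set" and A :: "nat \<Rightarrow> (real \<Rightarrow> 'k) set"
  assumes V: "function_subspace V" and p: "\<And>n. seminorm_on V (p n)"
    and mono: "\<And>m n f. f \<in> V \<Longrightarrow> m \<le> n \<Longrightarrow> p m f \<le> p n f"
    and complete: "\<And>F. (\<And>j. F j \<in> V) \<Longrightarrow> (\<And>j. p j (F j) \<le> (1 / 2) ^ j) \<Longrightarrow>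
      \<exists>s\<in>V. \<forall>n. (\<lambda>J. p n (\<lambda>x. s x - (\<Sum>j<J. F j x))) \<longlonglongrightarrow> 0"
    and cover: "\<And>f. f \<in> V \<Longrightarrow> \<exists>N. f \<in> A N"
    and midpoint: "\<And>N f g. f \<in> V \<Longrightarrow> g \<in> V \<Longrightarrow> (\<lambda>x. f x + g x) \<in> A N \<Longrightarrow> (\<lambda>x. f x - g x) \<in> A N \<Longrightarrow> g \<in> A N"
    and closed: "\<And>N f. f \<in> V \<Longrightarrow> f \<notin> A N \<Longrightarrow> \<exists>M e. 0 < e \<and> (\<forall>g\<in>V. p M g < e \<longrightarrow> (\<lambda>x. f x + g x) \<notin> A N)"
  shows "\<exists>N M e. 0 < e \<and> (\<forall>f\<in>V. p M f < e \<longrightarrow> f \<in> A N)"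
proof (rule ccontr)
  assume "\<not> ?thesis"
  then have nb: "\<exists>f\<in>V. p M f < e \<and> f \<notin> A N" if "0 < e" for N M e
    using that by blast
  note Vd = function_subspaceD[OF V]
  \<comment> \<open>A state \<open>(s, M, e)\<close> stands for the closed ball of radius \<open>e\<close> around \<open>s\<close> with respect to \<open>p M\<close>.\<close>
  define P where "P n t = (fst t \<in> V \<and> (0::real) < snd (snd t) \<and> (n = 0 \<longrightarrow> fst t = (\<lambda>x. 0)))"
    for n :: nat and t :: "(real \<Rightarrow> 'k) \<times> nat \<times> real"
  define Q where "Q n t t' = (case (t, t') of ((s, M, e), (s', M', e')) \<Rightarrow>
      p (max M n) (\<lambda>x. s' x - s x) < min (e / 2) ((1 / 2) ^ n) \<and> M \<le> M' \<and> e' \<le> e / 2 \<and>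
      (\<forall>g\<in>V. p M' g \<le> e' \<longrightarrow> (\<lambda>x. s' x + g x) \<notin> A n))"
    for n :: nat and t t' :: "(real \<Rightarrow> 'k) \<times> nat \<times> real"
  have "\<exists>t. \<forall>n. P n (t n) \<and> Q n (t n) (t (Suc n))"
  proof (rule dependent_nat_choice)
    show "\<exists>t. P 0 t" using Vd(1) by (intro exI[of _ "(\<lambda>x. 0, 0, 1)"]) (simp add: P_def)
    fix t n assume "P n t"
    then obtain s M e where t: "t = (s, M, e)" and s: "s \<in> V" and e: "0 < e"
      by (cases t) (auto simp: P_def)
    obtain f where f: "f \<in> V" "p (max M n) f < min (e / 2) ((1 / 2) ^ n)" "f \<notin> A n"
      using nb[of "min (e / 2) ((1 / 2) ^ n)" "max M n" n] e by auto
    have minus: "p m (\<lambda>x. - f x) = p m f" for m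
      using seminorm_onD(2)[OF p f(1), of m "-1"] by simp
    obtain f' where f': "f' \<in> V" "p (max M n) f' < min (e / 2) ((1 / 2) ^ n)" "(\<lambda>x. s x + f' x) \<notin> A n"
    proof (cases "(\<lambda>x. s x + f x) \<in> A n")
      case True
      then have "(\<lambda>x. s x - f x) \<notin> A n" using midpoint[OF s f(1)] f(3) by blast
      then show thesis using f minus by (intro that[of "\<lambda>x. - f x"] Vd(5)) auto
    next
      case False
      with f show thesis by (intro that)
    qed
    have s': "(\<lambda>x. s x + f' x) \<in> V" by (rule Vd(2)[OF s f'(1)])
    from closed[OF this f'(3)] obtain M1 e1
      where M1: "0 < e1" "\<forall>g\<in>V. p M1 g < e1 \<longrightarrow> (\<lambda>x. s x + f' x + g x) \<notin> A n"
      by (elim exE conjE)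
    have "(\<lambda>x. s x + f' x + g x) \<notin> A n" if "g \<in> V" "p (max M M1) g \<le> min (e / 2) (e1 / 2)" for g
    proof -
      have "p M1 g \<le> p (max M M1) g" using that(1) by (rule mono) simp
      also have "\<dots> < e1" using that(2) M1(1) by auto
      finally show ?thesis using M1(2) that(1) by blast
    qed
    with s' f'(2) e M1(1) have "P (Suc n) ((\<lambda>x. s x + f' x), max M M1, min (e / 2) (e1 / 2)) \<and>
        Q n t ((\<lambda>x. s x + f' x), max M M1, min (e / 2) (e1 / 2))"
      by (simp add: P_def Q_def t)
    then show "\<exists>t'. P (Suc n) t' \<and> Q n t t'" by (rule exI)
  qed
  then obtain t where t: "\<And>n. P n (t n)" "\<And>n. Q n (t n) (t (Suc n))" by blast
  define s M e where "s n = fst (t n)" and "M n = fst (snd (t n))" and "e n = snd (snd (t n))" for n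
  have s: "s n \<in> V" "s 0 = (\<lambda>x. 0)" and e: "0 < e n" for n
    using t(1)[of n] t(1)[of 0] by (auto simp: P_def s_def e_def)
  have step: "p (max (M n) n) (\<lambda>x. s (Suc n) x - s n x) < min (e n / 2) ((1 / 2) ^ n)"
    "M n \<le> M (Suc n)" "e (Suc n) \<le> e n / 2" for n
    using t(2)[of n] unfolding Q_def s_def M_def e_def by (simp_all only: split_beta prod.sel)
  have avoid: "(\<lambda>x. s (Suc n) x + g x) \<notin> A n" if "g \<in> V" "p (M (Suc n)) g \<le> e (Suc n)" for n g
    using t(2)[of n] that unfolding Q_def s_def M_def e_def by (simp add: split_beta)
  define F where "F n x = s (Suc n) x - s n x" for n x
  have F: "F n \<in> V" for n unfolding F_def[abs_def] by (intro Vd(6) s)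
  have pF: "p (M n) (F n) < e n / 2" "p n (F n) \<le> (1 / 2) ^ n" for n
    using step(1)[of n] mono[OF F, of "M n" "max (M n) n" n] mono[OF F, of n "max (M n) n" n]
    by (auto simp: F_def[abs_def])
  have partial: "(\<Sum>j<J. F j x) = s J x" for J x
    by (induction J) (simp_all add: s(2) F_def)
  obtain u where u: "u \<in> V" "\<And>n. (\<lambda>J. p n (\<lambda>x. u x - s J x)) \<longlonglongrightarrow> 0"
    using complete[OF F pF(2)] by (auto simp: partial)
  obtain N where N: "u \<in> A N" using cover[OF u(1)] by blast
  let ?k = "Suc N"
  have Mmono: "M ?k \<le> M J" if "?k \<le> J" for J
    using lift_Suc_mono_le[of M, OF step(2) that] .
  \<comment> \<open>The radii at least halve and the \<open>n\<close>-th step is shorter than \<open>e n / 2\<close>, so the distance to \<open>s ?k\<close> telescopes.\<close>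
  have dist: "p (M ?k) (\<lambda>x. s J x - s ?k x) \<le> e ?k - e J" if "?k \<le> J" for J
    using that
  proof (induction J rule: dec_induct)
    case base
    show ?case using seminorm_onD(2)[OF p Vd(1), of "M ?k" 0] by simp
  next
    case (step J)
    have "p (M ?k) (\<lambda>x. (s J x - s ?k x) + F J x) \<le> p (M ?k) (\<lambda>x. s J x - s ?k x) + p (M ?k) (F J)"
      by (intro seminorm_onD(1)[OF p] Vd(6) s F)
    also have "p (M ?k) (F J) \<le> p (M J) (F J)" by (intro mono F Mmono step.hyps)
    also have "\<dots> < e J / 2" by (rule pF)
    also have "p (M ?k) (\<lambda>x. s J x - s ?k x) \<le> e ?k - e J" by (rule step.IH)
    finally have "p (M ?k) (\<lambda>x. (s J x - s ?k x) + F J x) < e ?k - e J + e J / 2" by simp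
    moreover have "e (Suc J) \<le> e J / 2" by (rule \<open>\<And>n. e (Suc n) \<le> e n / 2\<close>)
    ultimately show ?case by (simp add: F_def)
  qed
  have "p (M ?k) (\<lambda>x. u x - s ?k x) - e ?k \<le> p (M ?k) (\<lambda>x. u x - s J x)" if "?k \<le> J" for J
  proof -
    have "p (M ?k) (\<lambda>x. (u x - s J x) + (s J x - s ?k x)) \<le> p (M ?k) (\<lambda>x. u x - s J x) + p (M ?k) (\<lambda>x. s J x - s ?k x)"
      by (intro seminorm_onD(1)[OF p] Vd(6) s u)
    with dist[OF that] e[of J] show ?thesis by simp
  qed
  then have "p (M ?k) (\<lambda>x. u x - s ?k x) - e ?k \<le> 0"
    by (intro LIMSEQ_le_const[OF u(2)]) blast
  then have "(\<lambda>x. s ?k x + (u x - s ?k x)) \<notin> A N"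
    by (intro avoid Vd(6) u s) simp
  with N show False by simp
qed

text \<open>Taking \<open>K = UNIV\<close> gives the Schwartz space and \<open>K = {-1..1}\<close> the test functions supported there. On
the latter the weights are immaterial up to constants, so one family of seminorms serves both.\<close>

lemma schwartz_barrel:
  fixes A :: "nat \<Rightarrow> (real \<Rightarrow> 'k::{real_normed_field,euclidean_space}) set" and K :: "real set"
  defines "V \<equiv> {f \<in> schwartz_functions. \<forall>x. x \<notin> K \<longrightarrow> f x = 0}"
  assumes cover: "\<And>f. f \<in> V \<Longrightarrow> \<exists>N. f \<in> A N"
    and midpoint: "\<And>N f g. f \<in> V \<Longrightarrow> g \<in> V \<Longrightarrow> (\<lambda>x. f x + g x) \<in> A N \<Longrightarrow> (\<lambda>x. f x - g x) \<in> A N \<Longrightarrow> g \<in> A N"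
    and closed: "\<And>N f. f \<in> V \<Longrightarrow> f \<notin> A N \<Longrightarrow> \<exists>M e. 0 < e \<and> (\<forall>g\<in>V. weighted_norm M M g < e \<longrightarrow> (\<lambda>x. f x + g x) \<notin> A N)"
  shows "\<exists>N M e. 0 < e \<and> (\<forall>f\<in>V. weighted_norm M M f < e \<longrightarrow> f \<in> A N)"
proof (rule barrel_contains_ball[where p = "\<lambda>n. weighted_norm n n"])
  show "function_subspace V"
    using function_subspace_schwartz by (auto simp: V_def function_subspace_def)
  show "seminorm_on V (weighted_norm n n)" for n
    by (rule seminorm_on_weighted_norm) (auto simp: V_def)
  show "weighted_norm m m f \<le> weighted_norm n n f" if "f \<in> V" "m \<le> n" for m n f
    using that by (intro weighted_norm_mono) (auto simp: V_def)
  fix F :: "nat \<Rightarrow> real \<Rightarrow> 'k"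
  assume F: "\<And>j. F j \<in> V" "\<And>j. weighted_norm j j (F j) \<le> (1 / 2) ^ j"
  have Fs: "F j \<in> schwartz_functions" for j using F(1)[of j] by (simp add: V_def)
  obtain s where s: "s \<in> schwartz_functions" "\<And>x. (\<lambda>j. F j x) sums s x"
    "\<And>n. (\<lambda>J. weighted_norm n n (\<lambda>x. s x - (\<Sum>j<J. F j x))) \<longlonglongrightarrow> 0"
    by (rule schwartz_series[OF Fs F(2)]) (rule that)
  have "s x = 0" if "x \<notin> K" for x
  proof -
    have "(\<lambda>j. F j x) = (\<lambda>j. 0)" using F(1) that by (auto simp: V_def)
    with s(2)[of x] show ?thesis by (simp add: sums_iff)
  qed
  with s show "\<exists>s\<in>V. \<forall>n. (\<lambda>J. weighted_norm n n (\<lambda>x. s x - (\<Sum>j<J. F j x))) \<longlonglongrightarrow> 0"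
    by (intro bexI[of _ s]) (auto simp: V_def)
qed (fact cover midpoint closed)+

context banach_space_over
begin

text \<open>The Banach-Steinhaus theorem for the sequence \<open>S\<close>, whose pointwise boundedness follows from the
Cauchy property; the uniform estimate passes to the limit \<open>T\<close>.\<close>

lemma pointwise_convergent_imp_bounded:
  assumes S: "\<And>n. S n \<in> tempered_distributions smul"
    and conv: "\<And>\<phi>. \<phi> \<in> test_functions \<Longrightarrow> (\<lambda>n. S n \<phi>) \<longlonglongrightarrow> T \<phi>"
    and cauchy: "\<And>\<psi>. \<psi> \<in> schwartz_functions \<Longrightarrow> Cauchy (\<lambda>n. S n \<psi>)"
  shows "\<exists>C N. 0 \<le> C \<and> (\<forall>\<phi>\<in>test_functions. norm (T \<phi>) \<le> C * weighted_norm N N \<phi>)"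
proof -
  note lin = linear_functional_onD[OF _ function_subspace_schwartz]
  have Slin: "linear_functional_on smul schwartz_functions (S n)" for n
    using S[of n] by (simp add: tempered_distributions_def)
  define A where "A N = {\<psi>. \<forall>n. norm (S n \<psi>) \<le> real N}" for N
  have "\<exists>N M e. 0 < e \<and> (\<forall>f\<in>{f \<in> schwartz_functions. \<forall>x. x \<notin> UNIV \<longrightarrow> f x = 0}.
      weighted_norm M M f < e \<longrightarrow> f \<in> A N)"
  proof (rule schwartz_barrel; simp only: UNIV_I not_True_eq_False simp_thms Collect_mem_eq)
    fix f :: "real \<Rightarrow> 'k" assume f: "f \<in> schwartz_functions"
    obtain B where "\<And>n. norm (S n f) \<le> B"
      using Cauchy_Bseq[OF cauchy[OF f]] unfolding Bseq_def by blast
    moreover have "B \<le> real (nat \<lceil>B\<rceil>)" by linarith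
    ultimately have "f \<in> A (nat \<lceil>B\<rceil>)" unfolding A_def by (auto intro: order_trans)
    then show "\<exists>N. f \<in> A N" by (rule exI)
  next
    fix N and f g :: "real \<Rightarrow> 'k"
    assume fg: "f \<in> schwartz_functions" "g \<in> schwartz_functions"
      and mem: "(\<lambda>x. f x + g x) \<in> A N" "(\<lambda>x. f x - g x) \<in> A N"
    have "norm (S n g) \<le> real N" for n
    proof -
      have "2 *\<^sub>R S n g = S n (\<lambda>x. f x + g x) - S n (\<lambda>x. f x - g x)"
        by (simp only: lin(1)[OF Slin fg] lin(4)[OF Slin fg]) (simp add: scaleR_2)
      also have "norm \<dots> \<le> real N + real N"
        using mem by (intro norm_triangle_le_diff add_mono) (auto simp: A_def)
      finally show ?thesis by simp
    qed
    then show "g \<in> A N" by (simp add: A_def)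
  next
    fix N and f :: "real \<Rightarrow> 'k" assume f: "f \<in> schwartz_functions" "f \<notin> A N"
    then obtain n where n: "real N < norm (S n f)" by (auto simp: A_def not_le)
    obtain M C where C: "0 \<le> C" "\<And>f. f \<in> schwartz_functions \<Longrightarrow> norm (S n f) \<le> C * weighted_norm M M f"
      using tempered_distribution_bound[OF S] by metis
    let ?e = "(norm (S n f) - real N) / (C + 1)"
    have "(\<lambda>x. f x + g x) \<notin> A N" if g: "g \<in> schwartz_functions" "weighted_norm M M g < ?e" for g
    proof -
      have "norm (S n g) \<le> C * weighted_norm M M g" by (rule C(2)[OF g(1)])
      also have "\<dots> \<le> (C + 1) * weighted_norm M M g"
        using weighted_norm_nonneg[OF g(1)] by (intro mult_right_mono) auto
      also have "\<dots> < norm (S n f) - real N" using g(2) C(1) by (simp add: pos_less_divide_eq mult.commute)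
      finally have "norm (S n g) < norm (S n f) - real N" .
      moreover have "norm (S n f) \<le> norm (S n f + S n g) + norm (S n g)"
        using norm_triangle_ineq4[of "S n f + S n g" "S n g"] by simp
      ultimately have "real N < norm (S n (\<lambda>x. f x + g x))"
        by (simp only: lin(1)[OF Slin f(1) g(1)])
      then show ?thesis by (auto simp: A_def not_le)
    qed
    moreover have "0 < ?e" using n C(1) by simp
    ultimately show "\<exists>M e. 0 < e \<and> (\<forall>g\<in>schwartz_functions. weighted_norm M M g < e \<longrightarrow> (\<lambda>x. f x + g x) \<notin> A N)"
      by blast
  qed
  then obtain N M e where e: "0 < e" "\<And>f. f \<in> schwartz_functions \<Longrightarrow> weighted_norm M M f < e \<Longrightarrow> f \<in> A N"
    by auto
  have bound: "norm (S n f) \<le> (real N / e) * weighted_norm M M f" if f: "f \<in> schwartz_functions" for n f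
  proof (rule homogeneous_bound[where p = "weighted_norm M M" and q = "\<lambda>f. norm (S n f)",
        OF _ e(1) function_subspace_schwartz])
    show "norm (S n f) \<le> real N" if "f \<in> schwartz_functions" "weighted_norm M M f < e" for f
      using e(2)[OF that] by (simp add: A_def)
    show "weighted_norm M M (\<lambda>x. r *\<^sub>R f x) = r * weighted_norm M M f" if "0 < r" "f \<in> schwartz_functions" for r f
      using weighted_norm_mult[OF that(2), of M M "of_real r"] that(1) by (simp add: scaleR_conv_of_real)
    show "norm (S n (\<lambda>x. r *\<^sub>R f x)) = r * norm (S n f)" if "0 < r" "f \<in> schwartz_functions" for r f
      using lin(3)[OF Slin that(2)] that(1) by simp
  qed (use f in \<open>auto intro: weighted_norm_nonneg\<close>)
  have "norm (T \<phi>) \<le> (real N / e) * weighted_norm M M \<phi>" if \<phi>: "\<phi> \<in> test_functions" for \<phi>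
    using \<phi> test_functions_subset_schwartz
    by (intro LIMSEQ_le_const2[OF tendsto_norm[OF conv[OF \<phi>]]] exI allI impI bound) blast
  with e(1) show ?thesis by (intro exI[of _ "real N / e"] exI[of _ M]) auto
qed

lemma test_on_eq_schwartz:
  "{f \<in> schwartz_functions. \<forall>x. x \<notin> {a..b} \<longrightarrow> f x = 0} = test_functions_on {a..b}"
  using test_functions_on_subset_schwartz[of "{a..b}"]
  by (auto simp: test_functions_on_iff schwartz_smooth simp del: atLeastAtMost_iff)

text \<open>\<open>A N\<close> consists of the \<open>\<phi>\<close> for which \<open>\<eta> \<mapsto> T (\<eta> * \<phi>)\<close> satisfies the seminorm estimate with constants \<open>N\<close>. These
sets cover the space because every such functional is tempered. They are closed because
\<open>\<phi> \<mapsto> T (\<eta> * \<phi>)\<close> is continuous for each fixed \<open>\<eta>\<close>, as the supports of the convolutions stay in a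
compact set.\<close>

lemma uniform_convolution_bound:
  assumes T: "T \<in> distributions smul"
    and b: "\<forall>\<phi>\<in>test_functions. restricts_tempered smul (function_distribution smul (convolution T \<phi>))"
  shows "\<exists>C N. 0 \<le> C \<and> (\<forall>\<phi>\<in>test_functions_on {-1..1}. \<forall>\<eta>\<in>test_functions. \<forall>R>0.
    (\<forall>x. R \<le> \<bar>x\<bar> \<longrightarrow> \<eta> x = 0) \<longrightarrow>
    norm (T (conv_on (-R) R \<eta> \<phi>)) \<le> C * weighted_norm N N \<phi> * weighted_norm N N \<eta>)"
proof -
  let ?V = "test_functions_on {-1..1} :: (real \<Rightarrow> 'k) set"
  note lin = linear_functional_onD[OF distribution_linear[OF T] function_subspace_test]
  note test1 = subsetD[OF test_functions_on_subset[OF compact_Icc, of "-1" 1]]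
  note VK = function_subspaceD[OF function_subspace_test_on[OF closed_atLeastAtMost, of "-1" 1]]
  note schwartz1 = subsetD[OF test_functions_on_subset_schwartz[OF compact_Icc, of "-1" 1]]
  note schwartz = subsetD[OF test_functions_subset_schwartz]
  have cont: "continuous_on UNIV \<eta>" if "\<eta> \<in> test_functions" for \<eta> :: "real \<Rightarrow> 'k"
    using smooth_continuous[OF test_function_smooth[OF that], of _ 0] by simp
  define U where "U \<phi> \<eta> = function_distribution smul (\<lambda>x. T (\<lambda>y. \<phi> (y - x))) \<eta>" for \<phi> \<eta> :: "real \<Rightarrow> 'k"
  have U: "U \<phi> \<eta> = T (conv_on (-R) R \<eta> \<phi>)"
    if "\<phi> \<in> ?V" "\<eta> \<in> test_functions" "0 < R" "\<And>x. R \<le> \<bar>x\<bar> \<Longrightarrow> \<eta> x = 0" for \<phi> \<eta> R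
    unfolding U_def by (rule distribution_convolution[OF T cont[OF that(2)] test1[OF that(1)] that(3,4)])
  have U_diff: "U (\<lambda>x. \<phi> x - \<psi> x) \<eta> = U \<phi> \<eta> - U \<psi> \<eta>"
    if V: "\<phi> \<in> ?V" "\<psi> \<in> ?V" and \<eta>: "\<eta> \<in> test_functions" for \<phi> \<psi> \<eta>
  proof -
    obtain R where R: "0 < R" "\<And>n x. R \<le> \<bar>x\<bar> \<Longrightarrow> nvd n \<eta> x = 0"
      using test_function_radius[OF \<eta>] by metis
    have R0: "\<eta> x = 0" if "R \<le> \<bar>x\<bar>" for x using R(2)[OF that, of 0] by simp
    have UR: "U f \<eta> = T (conv_on (-R) R \<eta> f)" if "f \<in> ?V" for f
      by (rule U[OF that \<eta> R(1)]) (rule R0)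
    have "U (\<lambda>x. \<phi> x - \<psi> x) \<eta> =
        T (\<lambda>y. conv_on (-R) R \<eta> \<phi> y - conv_on (-R) R \<eta> \<psi> y)"
      unfolding UR[OF VK(6)[OF V]]
        conv_on_diff[OF cont[OF \<eta>] test_function_continuous[OF V(1)] test_function_continuous[OF V(2)]] ..
    also have "\<dots> = U \<phi> \<eta> - U \<psi> \<eta>"
      unfolding UR[OF V(1)] UR[OF V(2)] by (rule lin(4)) (intro conv_on_test cont test1 V \<eta>)+
    finally show ?thesis .
  qed
  have U_scale: "U (\<lambda>x. r *\<^sub>R \<phi> x) \<eta> = r *\<^sub>R U \<phi> \<eta>"
    if V: "\<phi> \<in> ?V" and \<eta>: "\<eta> \<in> test_functions" for \<phi> \<eta> r
  proof -
    obtain R where R: "0 < R" "\<And>n x. R \<le> \<bar>x\<bar> \<Longrightarrow> nvd n \<eta> x = 0"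
      using test_function_radius[OF \<eta>] by metis
    have R0: "\<eta> x = 0" if "R \<le> \<bar>x\<bar>" for x using R(2)[OF that, of 0] by simp
    have UR: "U f \<eta> = T (conv_on (-R) R \<eta> f)" if "f \<in> ?V" for f
      by (rule U[OF that \<eta> R(1)]) (rule R0)
    show ?thesis
      unfolding UR[OF VK(4)[OF V]] UR[OF V] conv_on_scaleR
      by (intro lin(3) conv_on_test cont test1 V \<eta>)
  qed
  define A where "A N = {\<phi>. \<forall>\<eta>\<in>test_functions. norm (U \<phi> \<eta>) \<le> real N * weighted_norm N N \<eta>}" for N
  have "\<exists>N M e. 0 < e \<and> (\<forall>f\<in>{f \<in> schwartz_functions. \<forall>x. x \<notin> {-1..1} \<longrightarrow> f x = 0}.
      weighted_norm M M f < e \<longrightarrow> f \<in> A N)"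
  proof (rule schwartz_barrel; simp only: test_on_eq_schwartz)
    fix \<phi> :: "real \<Rightarrow> 'k" assume \<phi>: "\<phi> \<in> ?V"
    have "(\<lambda>z. \<phi> (0 - z)) \<in> test_functions" by (rule test_functions_reflect[OF test1[OF \<phi>]])
    from bspec[OF b this] obtain S where S: "S \<in> tempered_distributions smul"
      "\<And>\<eta>. \<eta> \<in> test_functions \<Longrightarrow> U \<phi> \<eta> = S \<eta>"
      by (auto simp: restricts_tempered_def U_def convolution_eq_translate)
    obtain M C where C: "0 \<le> C" "\<And>f. f \<in> schwartz_functions \<Longrightarrow> norm (S f) \<le> C * weighted_norm M M f"
      using tempered_distribution_bound[OF S(1)] by metis
    \<comment> \<open>The single index of \<open>A\<close> has to dominate the constant as well as the order of the norm.\<close>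
    let ?N = "max M (nat \<lceil>C\<rceil>)"
    have CN: "C \<le> real ?N" by linarith
    have "norm (U \<phi> \<eta>) \<le> real ?N * weighted_norm ?N ?N \<eta>" if \<eta>: "\<eta> \<in> test_functions" for \<eta>
    proof -
      have "norm (U \<phi> \<eta>) \<le> C * weighted_norm M M \<eta>" unfolding S(2)[OF \<eta>] by (rule C(2)[OF schwartz[OF \<eta>]])
      also have "\<dots> \<le> real ?N * weighted_norm ?N ?N \<eta>"
        by (rule mult_mono[OF CN]) (auto intro: weighted_norm_mono weighted_norm_nonneg schwartz[OF \<eta>])
      finally show ?thesis .
    qed
    then have "\<phi> \<in> A ?N" unfolding A_def by blast
    then show "\<exists>N. \<phi> \<in> A N" by (rule exI)
  next
    fix N and f g :: "real \<Rightarrow> 'k"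
    assume fg: "f \<in> ?V" "g \<in> ?V" and mem: "(\<lambda>x. f x + g x) \<in> A N" "(\<lambda>x. f x - g x) \<in> A N"
    have "norm (U g \<eta>) \<le> real N * weighted_norm N N \<eta>" if \<eta>: "\<eta> \<in> test_functions" for \<eta>
    proof -
      have "2 *\<^sub>R U g \<eta> = U (\<lambda>x. 2 *\<^sub>R g x) \<eta>" by (rule U_scale[OF fg(2) \<eta>, symmetric])
      also have "(\<lambda>x. 2 *\<^sub>R g x) = (\<lambda>x. (f x + g x) - (f x - g x))" by (simp add: scaleR_2)
      also have "U \<dots> \<eta> = U (\<lambda>x. f x + g x) \<eta> - U (\<lambda>x. f x - g x) \<eta>"
        by (intro U_diff VK fg \<eta>)
      also have "norm \<dots> \<le> real N * weighted_norm N N \<eta> + real N * weighted_norm N N \<eta>"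
        using mem \<eta> by (intro norm_triangle_le_diff add_mono) (auto simp: A_def)
      finally show ?thesis by simp
    qed
    then show "g \<in> A N" by (simp add: A_def)
  next
    fix N and f :: "real \<Rightarrow> 'k" assume f: "f \<in> ?V" "f \<notin> A N"
    then obtain \<eta> where \<eta>: "\<eta> \<in> test_functions" "real N * weighted_norm N N \<eta> < norm (U f \<eta>)"
      by (auto simp: A_def not_le)
    obtain R where R: "0 < R" "\<And>n x. R \<le> \<bar>x\<bar> \<Longrightarrow> nvd n \<eta> x = 0"
      using test_function_radius[OF \<eta>(1)] by metis
    have R0: "\<eta> x = 0" if "R \<le> \<bar>x\<bar>" for x using R(2)[OF that, of 0] by simp
    obtain B where B: "0 < B" "\<And>x. norm (\<eta> x) \<le> B" using test_function_boundedE[OF \<eta>(1), of 0] by auto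
    obtain m C where C: "0 \<le> C" "\<And>f. f \<in> test_functions_on {-R + -1..R + 1} \<Longrightarrow> norm (T f) \<le> C * weighted_norm 0 m f"
      using distribution_bound[OF T compact_Icc] by metis
    define E where "E = C * (real (Suc m) * (B * (2 * R)))"
    have E: "0 \<le> E" unfolding E_def using C(1) B(1) R(1) by simp
    have U_le: "norm (U g \<eta>) \<le> E * weighted_norm m m g" if g: "g \<in> ?V" for g
    proof -
      have sm: "smooth g" using g by (simp add: test_functions_on_def)
      have Ug: "U g \<eta> = T (conv_on (-R) R \<eta> g)"
        by (rule U[OF g \<eta>(1) R(1)]) (rule R0)
      have "norm (U g \<eta>) \<le> C * weighted_norm 0 m (conv_on (-R) R \<eta> g)"
        unfolding Ug by (intro C(2) conv_on_test_on cont \<eta>(1) g)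
      also have "weighted_norm 0 m (conv_on (-R) R \<eta> g) \<le> (\<Sum>j\<le>m. B * weighted_norm m m g * (R - - R))"
      proof (rule weighted_norm_le)
        fix j y assume "j \<le> m"
        then have "norm (conv_on (-R) R \<eta> (nvd j g) y) \<le> B * weighted_norm m m g * (R - - R)"
          using R(1) by (intro norm_conv_on_le cont \<eta>(1) smooth_continuous sm B
              norm_nvd_le_weighted_norm schwartz1 g) auto
        then show "weight 0 y * norm (nvd j (conv_on (-R) R \<eta> g) y) \<le> B * weighted_norm m m g * (R - - R)"
          by (simp add: nvd_conv_on[OF cont[OF \<eta>(1)] sm])
      qed
      finally have "norm (U g \<eta>) \<le> C * (\<Sum>j\<le>m. B * weighted_norm m m g * (R - - R))"
        using C(1) by (simp add: mult_left_mono)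
      then show ?thesis by (simp add: E_def algebra_simps)
    qed
    let ?e = "(norm (U f \<eta>) - real N * weighted_norm N N \<eta>) / (E + 1)"
    have "(\<lambda>x. f x + g x) \<notin> A N" if g: "g \<in> ?V" "weighted_norm m m g < ?e" for g
    proof -
      have "norm (U g \<eta>) \<le> E * weighted_norm m m g" by (rule U_le[OF g(1)])
      also have "\<dots> \<le> (E + 1) * weighted_norm m m g"
        using weighted_norm_nonneg[OF schwartz1[OF g(1)]] by (intro mult_right_mono) auto
      also have "\<dots> < norm (U f \<eta>) - real N * weighted_norm N N \<eta>"
        using g(2) E by (simp add: pos_less_divide_eq mult.commute)
      finally have less: "norm (U g \<eta>) < norm (U f \<eta>) - real N * weighted_norm N N \<eta>" .
      have "U f \<eta> = U (\<lambda>x. (f x + g x) - g x) \<eta>" by simp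
      also have "\<dots> = U (\<lambda>x. f x + g x) \<eta> - U g \<eta>" by (intro U_diff VK f(1) g(1) \<eta>(1))
      also have "norm \<dots> \<le> norm (U (\<lambda>x. f x + g x) \<eta>) + norm (U g \<eta>)" by (rule norm_triangle_ineq4)
      finally have "real N * weighted_norm N N \<eta> < norm (U (\<lambda>x. f x + g x) \<eta>)" using less by simp
      with \<eta>(1) show ?thesis by (auto simp: A_def not_le)
    qed
    moreover have "0 < ?e" using \<eta>(2) E by simp
    ultimately show "\<exists>M e. 0 < e \<and> (\<forall>g\<in>?V. weighted_norm M M g < e \<longrightarrow> (\<lambda>x. f x + g x) \<notin> A N)"
      by blast
  qed
  then obtain N M e where e: "0 < e" "\<And>f. f \<in> ?V \<Longrightarrow> weighted_norm M M f < e \<Longrightarrow> f \<in> A N"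
    unfolding test_on_eq_schwartz by blast
  define L where "L = max N M"
  show ?thesis
  proof (intro exI[of _ "real N / e"] exI[of _ L] conjI ballI allI impI)
    show "0 \<le> real N / e" using e(1) by simp
    fix \<phi> \<eta> :: "real \<Rightarrow> 'k" and R
    assume \<phi>: "\<phi> \<in> ?V" and \<eta>: "\<eta> \<in> test_functions" and R: "0 < R" "\<forall>x. R \<le> \<bar>x\<bar> \<longrightarrow> \<eta> x = 0"
    have U\<phi>: "U \<phi> \<eta> = T (conv_on (-R) R \<eta> \<phi>)"
      by (rule U[OF \<phi> \<eta> R(1)]) (use R(2) in blast)
    have "norm (U \<phi> \<eta>) \<le> (real N * weighted_norm N N \<eta> / e) * weighted_norm M M \<phi>"
    proof (rule homogeneous_bound[where p = "weighted_norm M M" and q = "\<lambda>f. norm (U f \<eta>)",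
          OF _ e(1) function_subspace_test_on[OF closed_atLeastAtMost, of "-1" 1]])
      show "norm (U \<phi> \<eta>) \<le> real N * weighted_norm N N \<eta>" if "\<phi> \<in> ?V" "weighted_norm M M \<phi> < e" for \<phi>
        using e(2)[OF that] \<eta> by (simp add: A_def)
      show "weighted_norm M M (\<lambda>x. r *\<^sub>R f x) = r * weighted_norm M M f" if "0 < r" "f \<in> ?V" for r f
        using weighted_norm_mult[OF schwartz1[OF that(2)], of M M "of_real r"] that(1)
        by (simp add: scaleR_conv_of_real)
      show "norm (U (\<lambda>x. r *\<^sub>R f x) \<eta>) = r * norm (U f \<eta>)" if "0 < r" "f \<in> ?V" for r f
        using U_scale[OF that(2) \<eta>] that(1) by simp
      show "0 \<le> real N * weighted_norm N N \<eta>" using weighted_norm_nonneg[OF schwartz[OF \<eta>]] by simp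
    qed (use \<phi> in \<open>auto intro: weighted_norm_nonneg schwartz1\<close>)
    also have "\<dots> = (real N / e) * (weighted_norm M M \<phi> * weighted_norm N N \<eta>)" by simp
    also have "\<dots> \<le> (real N / e) * (weighted_norm L L \<phi> * weighted_norm L L \<eta>)"
      using e(1) schwartz1[OF \<phi>] schwartz[OF \<eta>]
      by (intro mult_left_mono mult_mono weighted_norm_mono weighted_norm_nonneg) (auto simp: L_def)
    finally show "norm (T (conv_on (-R) R \<eta> \<phi>)) \<le>
        real N / e * weighted_norm L L \<phi> * weighted_norm L L \<eta>"
      unfolding U\<phi> by (simp only: mult.assoc)
  qed
qed

text \<open>Each term of the reproducing series is estimated by the bilinear bound. The dilated argument
costs \<open>2^(JN)\<close>, the coefficient gains \<open>2^J 2^(-JM)\<close>, and \<open>M = N + 2\<close> leaves \<open>2^(-J)\<close>.\<close>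

lemma convolutions_tempered_imp_bounded:
  assumes T: "T \<in> distributions smul"
    and b: "\<forall>\<phi>\<in>test_functions. restricts_tempered smul (function_distribution smul (convolution T \<phi>))"
  shows "\<exists>C N. 0 \<le> C \<and> (\<forall>\<phi>\<in>test_functions. norm (T \<phi>) \<le> C * weighted_norm N N \<phi>)"
proof -
  obtain C N where "0 \<le> C" and "\<forall>\<phi>\<in>test_functions_on {-1..1}. \<forall>\<eta>\<in>test_functions. \<forall>R>0.
    (\<forall>x. R \<le> \<bar>x\<bar> \<longrightarrow> \<eta> x = 0) \<longrightarrow>
    norm (T (conv_on (-R) R \<eta> \<phi>)) \<le> C * weighted_norm N N \<phi> * weighted_norm N N \<eta>"
    using uniform_convolution_bound[OF T b] by (elim exE conjE) (rule that)
  then have C: "0 \<le> C" "\<And>\<phi> \<eta> R. \<phi> \<in> test_functions_on {-1..1} \<Longrightarrow> \<eta> \<in> test_functions \<Longrightarrow>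
    0 < R \<Longrightarrow> (\<And>x. R \<le> \<bar>x\<bar> \<Longrightarrow> \<eta> x = 0) \<Longrightarrow>
    norm (T (conv_on (-R) R \<eta> \<phi>)) \<le> C * weighted_norm N N \<phi> * weighted_norm N N \<eta>"
    by auto
  define M where "M = N + 2"
  have "1 \<le> M" by (simp add: M_def)
  then obtain \<rho> \<theta> :: "real \<Rightarrow> 'k" where \<rho>: "\<rho> \<in> test_functions_on {-1..1}"
    and \<theta>: "\<theta> \<in> test_functions_on {-1..1}" and int: "integral {-1..1} \<rho> = 1"
    and kernel: "\<And>x. dilation 2 \<rho> x - \<rho> x = nvd M \<theta> x"
    by (rule kernel_exists) (rule that)
  note schwartz1 = subsetD[OF test_functions_on_subset_schwartz[OF compact_Icc, of "-1" 1]]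
  note schwartz = subsetD[OF test_functions_subset_schwartz]
  define a :: "nat \<Rightarrow> real" where "a J = 2 ^ J / 2 ^ (J * M)" for J
  have a: "0 \<le> a J" "a J * (2 ^ J) ^ N = (1 / 2) ^ J" for J
    using dyadic_decay[of J N] by (simp_all only: a_def M_def) simp
  define D where "D = C * (real (Suc N) * weighted_norm N N \<theta>) * real (Suc N)"
  define L where "L = N + M"
  have D: "0 \<le> D"
    unfolding D_def using C(1) weighted_norm_nonneg[OF schwartz1[OF \<theta>]] by (intro mult_nonneg_nonneg) auto
  have "norm (T \<eta>) \<le> (C * weighted_norm N N \<rho> + 2 * D) * weighted_norm L L \<eta>" if \<eta>: "\<eta> \<in> test_functions" for \<eta>
  proof -
    obtain R where R: "0 < R" "\<And>n x. R \<le> \<bar>x\<bar> \<Longrightarrow> nvd n \<eta> x = 0"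
      using test_function_radius[OF \<eta>] by metis
    define W where "W = weighted_norm L L \<eta>"
    have W: "0 \<le> W" unfolding W_def by (rule weighted_norm_nonneg[OF schwartz[OF \<eta>]])
    let ?t = "\<lambda>J. a J *\<^sub>R T (conv_on (-R) R (nvd M \<eta>) (\<lambda>x. \<theta> (2 ^ J * x)))"
    have sums: "?t sums (T \<eta> - T (conv_on (-R) R \<eta> \<rho>))"
      unfolding a_def by (rule reproducing_series[OF T \<eta> R \<rho> \<theta> int kernel])
    have term_bound: "norm (?t J) \<le> D * W * (1 / 2) ^ J" for J
    proof -
      have \<theta>J: "0 \<le> weighted_norm N N (\<lambda>x. \<theta> (2 ^ J * x))"
        by (rule weighted_norm_nonneg[OF schwartz1[OF test_on_scaled_argument[OF \<theta>]]]) simp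
      have "norm (T (conv_on (-R) R (nvd M \<eta>) (\<lambda>x. \<theta> (2 ^ J * x)))) \<le>
          C * weighted_norm N N (\<lambda>x. \<theta> (2 ^ J * x)) * weighted_norm N N (nvd M \<eta>)"
        using R by (intro C(2) test_on_scaled_argument \<theta> test_functions_nvd \<eta>) auto
      also have "\<dots> \<le> C * (real (Suc N) * ((2 ^ J) ^ N * weighted_norm N N \<theta>)) * (real (Suc N) * W)"
      proof (intro mult_mono mult_left_mono)
        show "weighted_norm N N (\<lambda>x. \<theta> (2 ^ J * x)) \<le> real (Suc N) * ((2 ^ J) ^ N * weighted_norm N N \<theta>)"
          by (rule weighted_norm_scaled_argument[OF schwartz1[OF \<theta>]]) simp
        have "weighted_norm N N (nvd M \<eta>) \<le> real (Suc N) * weighted_norm N (N + M) \<eta>"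
          by (rule weighted_norm_nvd[OF schwartz[OF \<eta>]])
        also have "\<dots> \<le> real (Suc N) * W"
          unfolding W_def by (intro mult_left_mono weighted_norm_mono schwartz[OF \<eta>]) (auto simp: L_def)
        finally show "weighted_norm N N (nvd M \<eta>) \<le> real (Suc N) * W" .
      qed (use C(1) \<theta>J weighted_norm_nonneg[OF schwartz1[OF \<theta>]] weighted_norm_nonneg[OF schwartz[OF test_functions_nvd[OF \<eta>]]]
          in \<open>auto intro!: mult_nonneg_nonneg\<close>)
      also have "\<dots> = D * W * (2 ^ J) ^ N" by (simp only: D_def mult_ac)
      finally have "a J * norm (T (conv_on (-R) R (nvd M \<eta>) (\<lambda>x. \<theta> (2 ^ J * x)))) \<le> a J * (D * W * (2 ^ J) ^ N)"
        using a(1) by (intro mult_left_mono)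
      also have "\<dots> = D * W * (a J * (2 ^ J) ^ N)" by (simp only: mult_ac)
      finally show ?thesis using a(1)[of J] unfolding a(2) by simp
    qed
    have "norm (T \<eta> - T (conv_on (-R) R \<eta> \<rho>)) \<le> (\<Sum>J. D * W * (1 / 2) ^ J)"
      unfolding sums_unique[OF sums] by (intro norm_suminf_le[OF term_bound] summable_mult summable_geometric) simp
    also have "\<dots> = 2 * D * W" by (simp add: suminf_mult suminf_geometric)
    finally have "norm (T \<eta>) \<le> norm (T (conv_on (-R) R \<eta> \<rho>)) + 2 * D * W"
      using norm_triangle_sub[of "T \<eta>" "T (conv_on (-R) R \<eta> \<rho>)"] by simp
    also have "norm (T (conv_on (-R) R \<eta> \<rho>)) \<le> C * weighted_norm N N \<rho> * weighted_norm N N \<eta>"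
      using R(1) R(2)[of _ 0] by (intro C(2) \<rho> \<eta>) auto
    also have "\<dots> \<le> C * weighted_norm N N \<rho> * W"
      unfolding W_def using C(1) weighted_norm_nonneg[OF schwartz1[OF \<rho>]]
      by (intro mult_left_mono weighted_norm_mono schwartz[OF \<eta>]) (auto simp: L_def)
    finally show ?thesis by (simp add: W_def algebra_simps)
  qed
  moreover have "0 \<le> C * weighted_norm N N \<rho> + 2 * D"
    using C(1) D weighted_norm_nonneg[OF schwartz1[OF \<rho>]] by simp
  ultimately show ?thesis by blast
qed

end

section \<open>The equivalence\<close>

theorem theorem2p16:
  fixes smul :: "'k::{real_normed_field,euclidean_space} \<Rightarrow> 'x::banach \<Rightarrow> 'x"
    and T :: "(real \<Rightarrow> 'k) \<Rightarrow> 'x"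
  assumes "banach_space_over smul"
    and "T \<in> distributions smul"
  defines "a \<equiv> T \<in> poly_growth_distributions smul"
    and "b \<equiv> (\<forall>\<phi>\<in>test_functions.
                restricts_tempered smul (function_distribution smul (convolution T \<phi>)))"
    and "c \<equiv> (\<exists>F\<in>poly_growth. \<exists>m::nat. \<forall>\<phi>\<in>test_functions.
                T \<phi> = distribution_derivative m (function_distribution smul F) \<phi>)"
    and "d \<equiv> (\<exists>m\<^sub>o::nat. 0 < m\<^sub>o \<and> (\<forall>\<phi>\<in>test_functions.
                norm (T \<phi>) \<le> real m\<^sub>o * weighted_norm m\<^sub>o m\<^sub>o \<phi>))"
    and "e \<equiv> restricts_tempered smul T"
    and "f \<equiv> (\<exists>S :: nat \<Rightarrow> (real \<Rightarrow> 'k) \<Rightarrow> 'x.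
                (\<forall>n. S n \<in> tempered_distributions smul) \<and>
                (\<forall>\<phi>\<in>test_functions. (\<lambda>n. S n \<phi>) \<longlonglongrightarrow> T \<phi>) \<and>
                (\<forall>\<psi>\<in>schwartz_functions. Cauchy (\<lambda>n. S n \<psi>)))"
  shows "(a \<longleftrightarrow> b) \<and> (a \<longleftrightarrow> c) \<and> (a \<longleftrightarrow> d) \<and> (a \<longleftrightarrow> e) \<and> (a \<longleftrightarrow> f)"
proof -
  interpret banach_space_over smul by fact
  note T = \<open>T \<in> distributions smul\<close>
  have bounded_imp_d: d
    if bounded: "\<exists>C N. 0 \<le> C \<and> (\<forall>\<phi>\<in>test_functions. norm (T \<phi>) \<le> C * weighted_norm N N \<phi>)"
  proof -
    obtain C N where C: "0 \<le> C" "\<And>\<phi>. \<phi> \<in> test_functions \<Longrightarrow> norm (T \<phi>) \<le> C * weighted_norm N N \<phi>"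
      using bounded by blast
    \<comment> \<open>One positive integer that serves as constant, as weight and as number of derivatives.\<close>
    define m where "m = Suc (max N (nat \<lceil>C\<rceil>))"
    have "C \<le> real m" "N \<le> m" unfolding m_def by linarith+
    have "norm (T \<phi>) \<le> real m * weighted_norm m m \<phi>" if \<phi>: "\<phi> \<in> test_functions" for \<phi>
    proof -
      have s: "\<phi> \<in> schwartz_functions" using \<phi> test_functions_subset_schwartz by blast
      have "C * weighted_norm N N \<phi> \<le> real m * weighted_norm m m \<phi>"
        using \<open>C \<le> real m\<close> \<open>N \<le> m\<close> s by (intro mult_mono weighted_norm_mono weighted_norm_nonneg) auto
      with C(2)[OF \<phi>] show ?thesis by (rule order_trans)
    qed
    then show d unfolding d_def by (intro exI[of _ m]) (simp add: m_def)
  qed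
  have "b" if a
  proof -
    have "restricts_tempered smul (function_distribution smul (convolution T \<phi>))" if "\<phi> \<in> test_functions" for \<phi>
    proof -
      have "convolution T \<phi> \<in> poly_growth"
        using \<open>a\<close> that by (simp add: a_def poly_growth_distributions_def)
      from poly_growth_tempered[OF this, of 0] show ?thesis by (simp add: distribution_derivative_def)
    qed
    then show b by (simp add: b_def)
  qed
  moreover have "d" if b
    using that by (intro bounded_imp_d convolutions_tempered_imp_bounded T) (simp add: b_def)
  moreover have "a" if d
  proof -
    obtain m where "\<And>\<phi>. \<phi> \<in> test_functions \<Longrightarrow> norm (T \<phi>) \<le> real m * weighted_norm m m \<phi>"
      using \<open>d\<close> unfolding d_def by blast
    from bounded_imp_poly_growth_distribution[OF T this] show a by (simp add: a_def)
  qed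
  moreover have "c" if d
  proof -
    obtain m where "\<And>\<phi>. \<phi> \<in> test_functions \<Longrightarrow> norm (T \<phi>) \<le> real m * weighted_norm m m \<phi>"
      using \<open>d\<close> unfolding d_def by blast
    from bounded_imp_derivative_of_poly_growth[OF T this] show c by (simp add: c_def)
  qed
  moreover have "e" if c
  proof -
    obtain F m where F: "F \<in> poly_growth"
      "\<And>\<phi>. \<phi> \<in> test_functions \<Longrightarrow> T \<phi> = distribution_derivative m (function_distribution smul F) \<phi>"
      using \<open>c\<close> unfolding c_def by blast
    from poly_growth_tempered[OF F(1), of m] show e
      unfolding e_def restricts_tempered_def by (simp add: F(2))
  qed
  moreover have "f" if e
  proof -
    obtain S where S: "S \<in> tempered_distributions smul" "\<And>\<phi>. \<phi> \<in> test_functions \<Longrightarrow> T \<phi> = S \<phi>"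
      using \<open>e\<close> unfolding e_def restricts_tempered_def by blast
    then show f unfolding f_def by (intro exI[of _ "\<lambda>n. S"]) (simp add: convergent_Cauchy convergent_const)
  qed
  moreover have "d" if f
  proof -
    obtain S where "\<And>n. S n \<in> tempered_distributions smul"
      "\<And>\<phi>. \<phi> \<in> test_functions \<Longrightarrow> (\<lambda>n. S n \<phi>) \<longlonglongrightarrow> T \<phi>"
      "\<And>\<psi>. \<psi> \<in> schwartz_functions \<Longrightarrow> Cauchy (\<lambda>n. S n \<psi>)"
      using \<open>f\<close> unfolding f_def by blast
    then show d by (intro bounded_imp_d pointwise_convergent_imp_bounded)
  qed
  ultimately show ?thesis by blast
qed

end
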